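(* For a subset $V\subset\mathcal{M}_8$ let $\overline{V}$ denote its topological closure and $V_\sharp$ its set of limit points (accumulation points) in $\mathcal{M}_8$. (1) $\overline{\mathcal{X}}=\mathcal{X}_\sharp\sqcup\mathcal{X}_2$, where $\mathcal{X}_2$ is the set of isolated points of $\mathcal{X}$. (2) $\mathcal{X}_\sharp$ and $\mathcal{Y}$ are each homeomorphic to a Cantor set. (3) Furthermore: (a) $\mathcal{Y}=(\mathcal{X}_0)_\sharp=(\mathcal{X}_1^\alpha)_\sharp=(\mathcal{X}_2^\alpha)_\sharp$. (b) $\mathcal{X}_\sharp=\mathcal{Y}\cup\mathcal{X}_1\cup\mathcal{X}_2^\beta=(\mathcal{X}_1)_\sharp=(\mathcal{X}_2^\beta)_\sharp=(\mathcal{X}_2)_\sharp$.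
   Context: Sequences. $\Omega=\{0,1,2\}^{\mathbb{N}}$, with elements $\omega=\omega_1\omega_2\cdots$ called oracles; $\sigma$ is the left shift, $(\sigma\omega)_n=\omega_{n+1}$. $\Omega_0$ is the set of sequences in which all three symbols occur infinitely often, $\Omega_1$ those in which exactly two symbols occur infinitely often, $\Omega_2$ the eventually constant sequences. Generalized overgroups. Let $T_2$ be the rooted binary tree whose vertices are the finite words over $\{0,1\}$. Let $a\in \mathrm{Aut}(T_2)$ swap the two subtrees at the root ($0w\leftrightarrow 1w$). A sequence $(p_n)_{n\ge1}$ with $p_n\in\{P,I\}$ is identified with the automorphism that acts at each vertex $1^{n-1}0$ by swapping the two subtrees below it if $p_n=P$ and trivially if $p_n=I$, and acts trivially at all other vertices. Let $x=(P,P,P,\dots)$, and let $b_\omega,c_\omega,d_\omega$ be the automorphisms given by the sequences with $b_n=P$ iff $\omega_n\in\{0,1\}$, $c_n=P$ iff $\omega_n\in\{0,2\}$, $d_n=P$ iff $\omega_n\in\{1,2\}$. Put $\tilde b_\omega=xb_\omega$, $\tilde c_\omega=xc_\omega$, $\tilde d_\omega=xd_\omega$. $\tilde G_\omega$ is the group generated by $\tilde S_\omega=(a,b_\omega,c_\omega,d_\omega,x,\tilde b_\omega,\tilde c_\omega,\tilde d_\omega)$. Words. Consider words over the alphabet $\{a,b,c,d,x,\tilde b,\tilde c,\tilde d\}$. Simple contractions: $a^2=1$, and products of letters other than $a$ are computed in the elementary abelian group $E=\{1,b,c,d,x,\tilde b,\tilde c,\tilde d\}$ of order 8 with $bc=d$,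 $\tilde b=xb$, $\tilde c=xc$, $\tilde d=xd$. A word is reduced if letters $a$ alternate with letters from $E\setminus\{1\}$. Decomposition relative to $\omega$: for $y\in E\setminus\{1\}$ let $p_y\in\{\emptyset,a\}$ be such that $p_y=a$ iff: $\omega_1\in\{0,1\}$ for $y=b$; $\omega_1\in\{0,2\}$ for $y=c$; $\omega_1\in\{1,2\}$ for $y=d$; always for $y=x$; $\omega_1=2$ for $y=\tilde b$; $\omega_1=1$ for $y=\tilde c$; $\omega_1=0$ for $y=\tilde d$. If $W$ is reduced with an even number of $a$'s, replace each letter $y\neq a$ preceded by an even number of $a$'s by $(p_y,y)$ and each letter $y\ne a$ preceded by an odd number of $a$'s by $(y,p_y)$, multiply coordinatewise and reduce; this gives reduced words $W_0,W_1$. These are in turn decomposed relative to $\sigma\omega$, and so on; after $N$ steps one gets $2^N$ words $W_{i_1\cdots i_N}$, provided that all words met at earlier steps have an even number of $a$'s. Algorithm $\alpha$ (relative to $\omega$): given a nonempty reduced word $W$, decompose $N=\lceil\log_2|W|\rceil$ times; if at some step a word with an odd number of $a$'s has to be decomposed, stop with negative result. The result is positive iff all $2^N$ words $W_{i_1\cdots i_N}$ are empty. The empty word gives a positive result. Algorithm $\beta_{ij}$ ($\{i,j,k\}=\{0,1,2\}$, $\beta_{ij}=\beta_{ji}$), for $\omega$ in which $k$ occurs at most finitely often: same, with $N=\max\{N_0,\lceil\log_2|W|\rceil\}$, where $N_0$ is the largest index with $\omega_{N_0}=k$ ($N_0=0$ if none), and the result is positive iff each $W_{i_1\cdots i_N}$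 is either empty or equal to $e_{ij}$, where $e_{01}=\tilde b$, $e_{12}=\tilde d$, $e_{20}=\tilde c$ ($e_{ij}=e_{ji}$). Modified overgroups. For $\omega\in\Omega$, $\tilde G_\omega^\alpha$ is the group generated by eight elements $a,b,c,d,x,\tilde b,\tilde c,\tilde d$ (forming the ordered generating set $\tilde S_\omega^\alpha$), satisfying the simple contractions, in which a reduced word represents the identity iff it gives a positive result under $\alpha$ relative to $\omega$. For $\omega\in\Omega_1\cup\Omega_2$ with at most finitely many $k$'s, $\tilde G_\omega^{\beta_{ij}}$ (with $\tilde S_\omega^{\beta_{ij}}$) is defined in the same way using $\beta_{ij}$. Marked groups. $\mathcal{M}_k$ is the space of pairs $(G,S)$ with $S$ an ordered set of $k$ generators of $G$; $d((G_1,S_1),(G_2,S_2))=2^{-n}$ where $n$ is the largest integer such that the balls of radius $n$ about the identity of the (labelled) Cayley graphs are identical. Two marked groups are the same point iff the order-preserving bijection of generators extends to an isomorphism. Sets. $\mathcal{X}=\{(\tilde G_\omega,\tilde S_\omega)\}_{\omega\in\Omega}$; $\mathcal{X}_i=\{(\tilde G_\omega,\tilde S_\omega)\}_{\omega\in\Omega_i}$ for $i=0,1,2$; $\mathcal{X}_i^\alpha=\{(\tilde G_\omega^\alpha,\tilde S_\omega^\alpha)\}_{\omega\in\Omega_i}$ for $i=1,2$; $\mathcal{X}_2^\beta$ is the set of all $(\tilde G_\omega^\beta,\tilde S_\omega^\beta)$ with $\omega\in\Omega_2$ and $\beta\in\{\beta_{01},\beta_{12},\beta_{20}\}$ for which $\tilde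 G_\omega^\beta$ is defined; $\mathcal{Y}=\mathcal{X}_0\cup\mathcal{X}_1^\alpha\cup\mathcal{X}_2^\alpha$. *)

theory Defs
  imports "HOL-Analysis.Analysis" "HOL-Algebra.Generated_Groups"
begin

section \<open>The space of marked groups\<close>

definition is_marked :: "'g monoid \<Rightarrow> ('k \<Rightarrow> 'g) \<Rightarrow> bool" where
  "is_marked G S \<longleftrightarrow> group G \<and> range S \<subseteq> carrier G \<and> generate G (range S) = carrier G"

definition marked_iso :: "'g monoid \<Rightarrow> ('k \<Rightarrow> 'g) \<Rightarrow> 'h monoid \<Rightarrow> ('k \<Rightarrow> 'h) \<Rightarrow> bool" where
  "marked_iso G S H T \<longleftrightarrow> (\<exists>\<phi>\<in>iso G H. \<forall>i. \<phi> (S i) = T i)"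

text \<open>Balls about the identity of the Cayley graph, which has an edge from \<open>g\<close> to \<open>g S\<^sub>i\<close>
  labelled \<open>i\<close> for every \<open>g\<close> and \<open>i\<close>.\<close>

primrec cayley_ball :: "'g monoid \<Rightarrow> ('k \<Rightarrow> 'g) \<Rightarrow> nat \<Rightarrow> 'g set" where
  "cayley_ball G S 0 = {\<one>\<^bsub>G\<^esub>}"
| "cayley_ball G S (Suc n) = cayley_ball G S n
     \<union> {g \<otimes>\<^bsub>G\<^esub> S i | g i. g \<in> cayley_ball G S n}
     \<union> {g \<otimes>\<^bsub>G\<^esub> inv\<^bsub>G\<^esub> (S i) | g i. g \<in> cayley_ball G S n}"

text \<open>The ball of radius \<open>n\<close> is the ball of the geometric realisation (edges have length 1):
  an edge belongs to it iff one of its endpoints has distance less than \<open>n\<close> from the identity.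
  In particular the ball of radius 0 is a single vertex without loops, so that the largest \<open>n\<close> in
  the definition of the distance below exists for any two distinct marked groups.\<close>

definition cayley_edges :: "'g monoid \<Rightarrow> ('k \<Rightarrow> 'g) \<Rightarrow> nat \<Rightarrow> ('g \<times> 'k \<times> 'g) set" where
  "cayley_edges G S n = {(g, i, g \<otimes>\<^bsub>G\<^esub> S i) | g i. g \<in> carrier G \<and>
     (\<exists>m<n. g \<in> cayley_ball G S m \<or> g \<otimes>\<^bsub>G\<^esub> S i \<in> cayley_ball G S m)}"

definition same_ball ::
  "'g monoid \<Rightarrow> ('k \<Rightarrow> 'g) \<Rightarrow> 'h monoid \<Rightarrow> ('k \<Rightarrow> 'h) \<Rightarrow> nat \<Rightarrow> bool" where
  "same_ball G S H T n \<longleftrightarrow> (\<exists>\<phi>. bij_betw \<phi> (cayley_ball G S n) (cayley_ball H T n) \<and>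
     \<phi> \<one>\<^bsub>G\<^esub> = \<one>\<^bsub>H\<^esub> \<and>
     (\<lambda>(g, i, h). (\<phi> g, i, \<phi> h)) ` cayley_edges G S n = cayley_edges H T n)"


subsection \<open>Description by words in the generators and their inverses\<close>

definition gval :: "'g monoid \<Rightarrow> ('k \<Rightarrow> 'g) \<Rightarrow> 'k \<times> bool \<Rightarrow> 'g" where
  "gval G S p = (if snd p then S (fst p) else inv\<^bsub>G\<^esub> (S (fst p)))"

definition sval :: "'g monoid \<Rightarrow> ('k \<Rightarrow> 'g) \<Rightarrow> ('k \<times> bool) list \<Rightarrow> 'g" where
  "sval G S w = foldr (\<lambda>p g. gval G S p \<otimes>\<^bsub>G\<^esub> g) w \<one>\<^bsub>G\<^esub>"

lemma is_marked_in: "is_marked G S \<Longrightarrow> S i \<in> carrier G"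
  by (auto simp: is_marked_def)

lemma gval_closed: "is_marked G S \<Longrightarrow> gval G S p \<in> carrier G"
  using is_marked_in[of G S] by (auto simp: gval_def is_marked_def intro!: group.inv_closed)

lemma sval_Nil [simp]: "sval G S [] = \<one>\<^bsub>G\<^esub>"
  by (simp add: sval_def)

lemma sval_Cons: "sval G S (p # w) = gval G S p \<otimes>\<^bsub>G\<^esub> sval G S w"
  by (simp add: sval_def)

lemma marked_monoid: "is_marked G S \<Longrightarrow> Group.monoid G"
  by (simp add: is_marked_def group.is_monoid)

lemma sval_closed: "is_marked G S \<Longrightarrow> sval G S w \<in> carrier G"
  by (induction w) (auto simp: sval_Cons gval_closed intro!: monoid.m_closed monoid.one_closed
      dest: marked_monoid)

lemma sval_append:
  assumes "is_marked G S"
  shows "sval G S (u @ v) = sval G S u \<otimes>\<^bsub>G\<^esub> sval G S v"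
proof -
  interpret group G using assms by (simp add: is_marked_def)
  show ?thesis
    by (induction u) (auto simp: sval_Cons gval_closed[OF assms] sval_closed[OF assms] m_assoc)
qed

lemma sval_snoc:
  assumes "is_marked G S"
  shows "sval G S (u @ [p]) = sval G S u \<otimes>\<^bsub>G\<^esub> gval G S p"
proof -
  interpret group G using assms by (simp add: is_marked_def)
  show ?thesis
    by (simp add: sval_append[OF assms] sval_Cons gval_closed[OF assms])
qed

lemma carrier_eq_range_sval:
  assumes "is_marked G S"
  shows "carrier G = range (sval G S)"
proof
  interpret group G using assms by (simp add: is_marked_def)
  show "carrier G \<subseteq> range (sval G S)"
  proof
    fix g assume "g \<in> carrier G"
    then have "g \<in> generate G (range S)" using assms by (simp add: is_marked_def)
    then show "g \<in> range (sval G S)"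
    proof (induction rule: generate.induct)
      case one
      have "\<one>\<^bsub>G\<^esub> = sval G S []" by simp
      then show ?case by blast
    next
      case (incl h)
      then obtain i where "h = S i" by auto
      then have "h = sval G S [(i, True)]"
        using is_marked_in[OF assms] by (simp add: sval_Cons gval_def)
      then show ?case by blast
    next
      case (inv h)
      then obtain i where "h = S i" by auto
      then have "inv\<^bsub>G\<^esub> h = sval G S [(i, False)]"
        using is_marked_in[OF assms] by (simp add: sval_Cons gval_def)
      then show ?case by blast
    next
      case (eng h1 h2)
      then obtain u v where "h1 = sval G S u" "h2 = sval G S v" by auto
      then have "h1 \<otimes>\<^bsub>G\<^esub> h2 = sval G S (u @ v)" by (simp add: sval_append[OF assms])
      then show ?case by blast
    qed
  qed
  show "range (sval G S) \<subseteq> carrier G"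
    using sval_closed[OF assms] by auto
qed

lemma cayley_ball_eq:
  fixes G :: "'g monoid" and S :: "'k \<Rightarrow> 'g"
  assumes "is_marked G S"
  shows "cayley_ball G S n = sval G S ` {w. length w \<le> n}"
proof (induction n)
  case 0
  then show ?case by auto
next
  case (Suc n)
  show ?case
  proof
    show "cayley_ball G S (Suc n) \<subseteq> sval G S ` {w. length w \<le> Suc n}"
    proof
      fix g assume "g \<in> cayley_ball G S (Suc n)"
      then consider "g \<in> cayley_ball G S n"
        | h i where "h \<in> cayley_ball G S n" "g = h \<otimes>\<^bsub>G\<^esub> S i"
        | h i where "h \<in> cayley_ball G S n" "g = h \<otimes>\<^bsub>G\<^esub> inv\<^bsub>G\<^esub> S i"
        unfolding cayley_ball.simps by blast
      then consider "g \<in> cayley_ball G S n"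
        | h p where "h \<in> cayley_ball G S n" "g = h \<otimes>\<^bsub>G\<^esub> gval G S p"
      proof cases
        case (2 h i)
        then show ?thesis using that(2)[of h "(i, True)"] by (simp add: gval_def)
      next
        case (3 h i)
        then show ?thesis using that(2)[of h "(i, False)"] by (simp add: gval_def)
      qed blast
      then show "g \<in> sval G S ` {w. length w \<le> Suc n}"
      proof cases
        case 1
        then show ?thesis using Suc by auto
      next
        case 2
        then obtain w where w: "length w \<le> n" "h = sval G S w" using Suc by auto
        then have "g = sval G S (w @ [p])" using 2 by (simp add: sval_snoc[OF assms])
        then show ?thesis using w(1)
          by (intro image_eqI[of _ _ "w @ [p]"]) simp_all
      qed
    qed
    show "sval G S ` {w. length w \<le> Suc n} \<subseteq> cayley_ball G S (Suc n)"
    proof clarify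
      fix w :: "('k \<times> bool) list" assume len: "length w \<le> Suc n"
      show "sval G S w \<in> cayley_ball G S (Suc n)"
      proof (cases w rule: rev_cases)
        case Nil
        then have "sval G S w \<in> sval G S ` {w. length w \<le> n}" by (intro imageI) simp
        then show ?thesis unfolding cayley_ball.simps Suc by blast
      next
        case (snoc u p)
        then have *: "sval G S u \<in> cayley_ball G S n" using len unfolding Suc by (intro imageI) simp
        obtain i e where p: "p = (i, e)" by (cases p)
        have "sval G S w = sval G S u \<otimes>\<^bsub>G\<^esub> (if e then S i else inv\<^bsub>G\<^esub> S i)"
          using snoc p by (simp add: sval_snoc[OF assms] gval_def)
        with * show ?thesis unfolding cayley_ball.simps by (cases e) auto
      qed
    qed
  qed
qed

text \<open>Two marked groups have the same ball of radius \<open>n\<close> iff they have the same relations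
  \<open>u = v\<close> with \<open>u\<close>, \<open>v\<close> of length at most \<open>n\<close>.\<close>

lemma cayley_edges_image:
  assumes G: "is_marked G S" and H: "is_marked H T"
    and \<phi>: "\<And>u. length u \<le> n \<Longrightarrow> \<phi> (sval G S u) = sval H T u"
  shows "(\<lambda>(g, i, h). (\<phi> g, i, \<phi> h)) ` cayley_edges G S n \<subseteq> cayley_edges H T n"
proof clarify
  fix g i h assume "(g, i, h) \<in> cayley_edges G S n"
  then obtain m where m: "m < n" "h = g \<otimes>\<^bsub>G\<^esub> S i" "g \<in> carrier G"
    "g \<in> cayley_ball G S m \<or> h \<in> cayley_ball G S m"
    by (auto simp: cayley_edges_def)
  interpret G: group G using G by (simp add: is_marked_def)
  interpret H: group H using H by (simp add: is_marked_def)
  note Si = is_marked_in[OF G, of i] and Ti = is_marked_in[OF H, of i]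
  from m(4) show "(\<phi> g, i, \<phi> h) \<in> cayley_edges H T n"
  proof
    assume "g \<in> cayley_ball G S m"
    then obtain u where u: "length u \<le> m" "g = sval G S u"
      by (auto simp: cayley_ball_eq[OF G])
    have "h = sval G S (u @ [(i, True)])"
      using m u by (simp add: sval_snoc[OF G] gval_def)
    then have "\<phi> h = sval H T u \<otimes>\<^bsub>H\<^esub> T i" "\<phi> g = sval H T u"
      using \<phi>[of "u @ [(i, True)]"] \<phi>[of u] u m by (simp_all add: sval_snoc[OF H] gval_def)
    then show ?thesis
      using u(1) m(1) sval_closed[OF H, of u]
      by (force simp: cayley_edges_def cayley_ball_eq[OF H])
  next
    assume "h \<in> cayley_ball G S m"
    then obtain u where u: "length u \<le> m" "h = sval G S u"
      by (auto simp: cayley_ball_eq[OF G])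
    have "g = g \<otimes>\<^bsub>G\<^esub> S i \<otimes>\<^bsub>G\<^esub> inv\<^bsub>G\<^esub> S i"
      using m(3) Si by (simp add: G.m_assoc)
    then have "g = sval G S (u @ [(i, False)])"
      using m(2) u(2) by (simp add: sval_snoc[OF G] gval_def)
    then have "\<phi> g = sval H T u \<otimes>\<^bsub>H\<^esub> inv\<^bsub>H\<^esub> T i" "\<phi> h = sval H T u"
      using \<phi>[of "u @ [(i, False)]"] \<phi>[of u] u m by (simp_all add: sval_snoc[OF H] gval_def)
    moreover have "sval H T u \<otimes>\<^bsub>H\<^esub> inv\<^bsub>H\<^esub> T i \<otimes>\<^bsub>H\<^esub> T i = sval H T u"
      using sval_closed[OF H, of u] Ti by (simp add: H.m_assoc)
    ultimately show ?thesis
      using u(1) m(1) sval_closed[OF H, of u] Ti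
      by (force simp: cayley_edges_def cayley_ball_eq[OF H])
  qed
qed

lemma same_ball_iff:
  fixes G :: "'g monoid" and S :: "'k \<Rightarrow> 'g" and H :: "'h monoid" and T :: "'k \<Rightarrow> 'h"
  assumes G: "is_marked G S" and H: "is_marked H T"
  shows "same_ball G S H T n \<longleftrightarrow>
    (\<forall>u v. length u \<le> n \<longrightarrow> length v \<le> n \<longrightarrow>
       (sval G S u = sval G S v \<longleftrightarrow> sval H T u = sval H T v))"
proof
  interpret G: group G using G by (simp add: is_marked_def)
  interpret H: group H using H by (simp add: is_marked_def)
  assume "same_ball G S H T n"
  then obtain \<phi> where bij: "bij_betw \<phi> (cayley_ball G S n) (cayley_ball H T n)"
    and one: "\<phi> \<one>\<^bsub>G\<^esub> = \<one>\<^bsub>H\<^esub>"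
    and edges: "(\<lambda>(g, i, h). (\<phi> g, i, \<phi> h)) ` cayley_edges G S n = cayley_edges H T n"
    by (auto simp: same_ball_def)
  have edge: "\<phi> g \<in> carrier H \<and> \<phi> h = \<phi> g \<otimes>\<^bsub>H\<^esub> T i"
    if "(g, i, h) \<in> cayley_edges G S n" for g i h
  proof -
    have "(\<phi> g, i, \<phi> h) \<in> cayley_edges H T n" using that edges by force
    then show ?thesis by (auto simp: cayley_edges_def)
  qed
  have \<phi>: "\<phi> (sval G S u) = sval H T u" if "length u \<le> n" for u
    using that
  proof (induction u rule: rev_induct)
    case Nil
    then show ?case using one by simp
  next
    case (snoc p u)
    obtain i e where p: "p = (i, e)" by (cases p)
    note Si = is_marked_in[OF G, of i] and Ti = is_marked_in[OF H, of i]
    note cl = sval_closed[OF G, of u]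
    have IH: "\<phi> (sval G S u) = sval H T u" and len: "length u < n" using snoc by auto
    have ball: "sval G S u \<in> cayley_ball G S (length u)" by (auto simp: cayley_ball_eq[OF G])
    show ?case
    proof (cases e)
      case True
      have "(sval G S u, i, sval G S u \<otimes>\<^bsub>G\<^esub> S i) \<in> cayley_edges G S n"
        using ball len cl unfolding cayley_edges_def by blast
      from edge[OF this] show ?thesis
        using True p IH by (simp add: sval_snoc[OF G] sval_snoc[OF H] gval_def)
    next
      case False
      let ?g = "sval G S u \<otimes>\<^bsub>G\<^esub> inv\<^bsub>G\<^esub> S i"
      have g: "?g \<in> carrier G" "?g \<otimes>\<^bsub>G\<^esub> S i = sval G S u"
        using cl Si by (simp_all add: G.m_assoc)
      have "(?g, i, ?g \<otimes>\<^bsub>G\<^esub> S i) \<in> cayley_edges G S n"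
        using ball len g unfolding cayley_edges_def by auto
      from edge[OF this] have "\<phi> ?g \<in> carrier H" "sval H T u = \<phi> ?g \<otimes>\<^bsub>H\<^esub> T i"
        using g IH by auto
      then have "\<phi> ?g = sval H T u \<otimes>\<^bsub>H\<^esub> inv\<^bsub>H\<^esub> T i"
        using Ti by (simp add: H.m_assoc)
      then show ?thesis
        using False p by (simp add: sval_snoc[OF G] sval_snoc[OF H] gval_def)
    qed
  qed
  show "\<forall>u v. length u \<le> n \<longrightarrow> length v \<le> n \<longrightarrow>
       (sval G S u = sval G S v \<longleftrightarrow> sval H T u = sval H T v)"
  proof (intro allI impI)
    fix u v :: "('k \<times> bool) list" assume uv: "length u \<le> n" "length v \<le> n"
    have "sval G S u \<in> cayley_ball G S n" "sval G S v \<in> cayley_ball G S n"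
      using uv by (auto simp: cayley_ball_eq[OF G])
    then have "\<phi> (sval G S u) = \<phi> (sval G S v) \<longleftrightarrow> sval G S u = sval G S v"
      using bij inj_on_eq_iff[OF bij_betw_imp_inj_on] by metis
    then show "sval G S u = sval G S v \<longleftrightarrow> sval H T u = sval H T v"
      using \<phi> uv by auto
  qed
next
  assume rel: "\<forall>u v. length u \<le> n \<longrightarrow> length v \<le> n \<longrightarrow>
       (sval G S u = sval G S v \<longleftrightarrow> sval H T u = sval H T v)"
  define \<phi> where "\<phi> g = sval H T (SOME u. length u \<le> n \<and> sval G S u = g)" for g
  define \<psi> where "\<psi> g = sval G S (SOME u. length u \<le> n \<and> sval H T u = g)" for g
  have \<phi>: "\<phi> (sval G S u) = sval H T u" if "length u \<le> n" for u
  proof -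
    have "length (SOME v. length v \<le> n \<and> sval G S v = sval G S u) \<le> n \<and>
        sval G S (SOME v. length v \<le> n \<and> sval G S v = sval G S u) = sval G S u"
      by (rule someI[of _ u]) (use that in simp)
    then show ?thesis unfolding \<phi>_def using rel that by blast
  qed
  have \<psi>: "\<psi> (sval H T u) = sval G S u" if "length u \<le> n" for u
  proof -
    have "length (SOME v. length v \<le> n \<and> sval H T v = sval H T u) \<le> n \<and>
        sval H T (SOME v. length v \<le> n \<and> sval H T v = sval H T u) = sval H T u"
      by (rule someI[of _ u]) (use that in simp)
    then show ?thesis unfolding \<psi>_def using rel that by blast
  qed
  have bij: "bij_betw \<phi> (cayley_ball G S n) (cayley_ball H T n)"
    by (rule bij_betw_byWitness[where f' = \<psi>])
      (auto simp: cayley_ball_eq[OF G] cayley_ball_eq[OF H] \<phi> \<psi>)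
  have one: "\<phi> \<one>\<^bsub>G\<^esub> = \<one>\<^bsub>H\<^esub>"
    using \<phi>[of "[]"] by simp
  have sub1: "(\<lambda>(g, i, h). (\<phi> g, i, \<phi> h)) ` cayley_edges G S n \<subseteq> cayley_edges H T n"
    by (rule cayley_edges_image[OF G H \<phi>])
  have sub2: "(\<lambda>(g, i, h). (\<psi> g, i, \<psi> h)) ` cayley_edges H T n \<subseteq> cayley_edges G S n"
    by (rule cayley_edges_image[OF H G \<psi>])
  have ends: "g \<in> cayley_ball H T n \<and> h \<in> cayley_ball H T n"
    if edge: "(g, i, h) \<in> cayley_edges H T n" for g i h
  proof -
    interpret H: group H using H by (simp add: is_marked_def)
    note Ti = is_marked_in[OF H, of i]
    from edge obtain m where m: "m < n" "h = g \<otimes>\<^bsub>H\<^esub> T i" "g \<in> carrier H"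
      "g \<in> cayley_ball H T m \<or> h \<in> cayley_ball H T m"
      by (auto simp: cayley_edges_def)
    have mono: "cayley_ball H T k \<subseteq> cayley_ball H T n" if "k \<le> n" for k
      using that by (auto simp: cayley_ball_eq[OF H])
    have inv: "g = h \<otimes>\<^bsub>H\<^esub> inv\<^bsub>H\<^esub> T i"
      using m Ti by (simp add: H.m_assoc)
    have step: "x \<otimes>\<^bsub>H\<^esub> T i \<in> cayley_ball H T (Suc m)"
      "x \<otimes>\<^bsub>H\<^esub> inv\<^bsub>H\<^esub> T i \<in> cayley_ball H T (Suc m)"
      "x \<in> cayley_ball H T (Suc m)" if "x \<in> cayley_ball H T m" for x
      using that by auto
    have "g \<in> cayley_ball H T (Suc m) \<and> h \<in> cayley_ball H T (Suc m)"
      using m(4) step(1)[of g] step(2)[of h] step(3)[of g] step(3)[of h]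
      by (simp only: inv[symmetric] m(2)[symmetric]) blast
    then show ?thesis using mono[of "Suc m"] m(1) by (meson Suc_leI subsetD)
  qed
  have inv: "\<phi> (\<psi> g) = g" if "g \<in> cayley_ball H T n" for g
    using that by (auto simp: cayley_ball_eq[OF H] \<phi> \<psi>)
  have "cayley_edges H T n \<subseteq> (\<lambda>(g, i, h). (\<phi> g, i, \<phi> h)) ` cayley_edges G S n"
  proof clarify
    fix g i h assume e: "(g, i, h) \<in> cayley_edges H T n"
    have "(\<psi> g, i, \<psi> h) \<in> cayley_edges G S n" using sub2 e by force
    moreover have "(g, i, h) = (\<lambda>(g, i, h). (\<phi> g, i, \<phi> h)) (\<psi> g, i, \<psi> h)"
      using ends[OF e] by (simp add: inv)
    ultimately show "(g, i, h) \<in> (\<lambda>(g, i, h). (\<phi> g, i, \<phi> h)) ` cayley_edges G S n"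
      by (rule image_eqI[rotated])
  qed
  with bij one sub1 show "same_ball G S H T n"
    unfolding same_ball_def by (intro exI[of _ \<phi>]) auto
qed

lemma marked_iso_iff:
  assumes G: "is_marked G S" and H: "is_marked H T"
  shows "marked_iso G S H T \<longleftrightarrow>
    (\<forall>u v. sval G S u = sval G S v \<longleftrightarrow> sval H T u = sval H T v)"
proof
  interpret G: group G using G by (simp add: is_marked_def)
  interpret H: group H using H by (simp add: is_marked_def)
  assume "marked_iso G S H T"
  then obtain \<phi> where iso: "\<phi> \<in> iso G H" and gen: "\<And>i. \<phi> (S i) = T i"
    by (auto simp: marked_iso_def)
  then interpret group_hom G H \<phi>
    by unfold_locales (simp add: iso_def)
  have gv: "\<phi> (gval G S p) = gval H T p" for p
    using is_marked_in[OF G] by (simp add: gval_def gen)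
  have "\<phi> (sval G S u) = sval H T u" for u
    by (induction u) (simp_all add: sval_Cons gv gval_closed[OF G] sval_closed[OF G])
  moreover have "inj_on \<phi> (carrier G)" using iso by (simp add: iso_def bij_betw_def)
  ultimately show "\<forall>u v. sval G S u = sval G S v \<longleftrightarrow> sval H T u = sval H T v"
    by (metis sval_closed[OF G] inj_on_eq_iff)
next
  interpret G: group G using G by (simp add: is_marked_def)
  interpret H: group H using H by (simp add: is_marked_def)
  assume rel: "\<forall>u v. sval G S u = sval G S v \<longleftrightarrow> sval H T u = sval H T v"
  define \<phi> where "\<phi> g = sval H T (SOME u. sval G S u = g)" for g
  have \<phi>: "\<phi> (sval G S u) = sval H T u" for u
    unfolding \<phi>_def using rel by (metis (mono_tags, lifting) someI)
  have "\<phi> \<in> hom G H"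
    by (rule homI) (auto simp: carrier_eq_range_sval[OF G] \<phi> sval_closed[OF H]
        sval_append[OF G, symmetric] sval_append[OF H])
  moreover have "bij_betw \<phi> (carrier G) (carrier H)"
    unfolding bij_betw_def carrier_eq_range_sval[OF G] carrier_eq_range_sval[OF H]
    using rel by (auto simp: inj_on_def \<phi> image_image)
  moreover have "\<phi> (S i) = T i" for i
    using \<phi>[of "[(i, True)]"] is_marked_in[OF G] is_marked_in[OF H]
    by (simp add: sval_Cons gval_def)
  ultimately show "marked_iso G S H T"
    by (auto simp: marked_iso_def iso_def)
qed


subsection \<open>The metric space of marked groups\<close>

text \<open>Marked groups with generators indexed by a finite type \<open>'k\<close>, up to isomorphism. As finitely
  generated groups are countable, the underlying set may be taken to be a subset of the natural
  numbers; see \<open>marked_repr_ex\<close> below.\<close>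

quotient_type 'k marked =
  "nat monoid \<times> ('k::finite \<Rightarrow> nat)" / partial: "\<lambda>(G, S) (H, T). is_marked G S \<and> is_marked H T \<and> marked_iso G S H T"
proof (rule part_equivpI)
  let ?G = "\<lparr>carrier = {0}, mult = (\<lambda>_ _. 0), one = 0\<rparr> :: nat monoid"
  have G: "group ?G"
    by (rule groupI) auto
  then have M: "is_marked ?G (\<lambda>_::'k. 0)"
    using group.generate_incl[OF G, of "{0}"] generate.one[of ?G "{0}"]
    by (auto simp: is_marked_def)
  show "\<exists>x. (\<lambda>(G, S) (H, T). is_marked G S \<and> is_marked H T \<and> marked_iso G S H T) x
     (x :: nat monoid \<times> ('k \<Rightarrow> nat))"
    by (rule exI[of _ "(?G, \<lambda>_. 0)"]) (use M in \<open>simp add: marked_iso_iff\<close>)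
qed (auto intro!: sympI transpI simp: marked_iso_iff)

text \<open>The point of the space given by a marked group over an arbitrary type.\<close>

definition marked_repr :: "'g monoid \<Rightarrow> ('k::finite \<Rightarrow> 'g) \<Rightarrow> nat monoid \<times> ('k \<Rightarrow> nat)" where
  "marked_repr G S = (SOME (H, T). is_marked H T \<and> marked_iso G S H T)"

definition marking :: "'g monoid \<Rightarrow> ('k::finite \<Rightarrow> 'g) \<Rightarrow> 'k marked" where
  "marking G S = abs_marked (marked_repr G S)"

lemma marked_repr_ex:
  fixes G :: "'g monoid" and S :: "'k::finite \<Rightarrow> 'g"
  assumes G: "is_marked G S"
  shows "\<exists>(H :: nat monoid) (T :: 'k \<Rightarrow> nat). is_marked H T \<and> marked_iso G S H T"
proof -
  interpret G: group G using G by (simp add: is_marked_def)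
  have fin: "finite (UNIV :: 'k set)" by simp
  then have cb: "countable (UNIV :: ('k \<times> bool) set)"
    by (simp add: countable_finite finite_prod)
  have "countable (lists (UNIV :: ('k \<times> bool) set))"
    by (rule countable_lists[OF cb])
  then have "countable (carrier G)"
    unfolding carrier_eq_range_sval[OF G] by simp
  then obtain f :: "'g \<Rightarrow> nat" where f: "inj_on f (carrier G)"
    by (auto simp: countable_def)
  define f' where "f' = the_inv_into (carrier G) f"
  have ff: "f' (f g) = g" if "g \<in> carrier G" for g
    using that f by (simp add: f'_def the_inv_into_f_f)
  define H :: "nat monoid" where
    "H = \<lparr>carrier = f ` carrier G, mult = (\<lambda>m n. f (f' m \<otimes>\<^bsub>G\<^esub> f' n)), one = f \<one>\<^bsub>G\<^esub>\<rparr>"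
  have H: "group H"
  proof (rule groupI)
    show "x \<otimes>\<^bsub>H\<^esub> y \<in> carrier H" if "x \<in> carrier H" "y \<in> carrier H" for x y
      using that by (auto simp: H_def ff)
    show "x \<otimes>\<^bsub>H\<^esub> y \<otimes>\<^bsub>H\<^esub> z = x \<otimes>\<^bsub>H\<^esub> (y \<otimes>\<^bsub>H\<^esub> z)"
      if "x \<in> carrier H" "y \<in> carrier H" "z \<in> carrier H" for x y z
      using that by (auto simp: H_def ff G.m_assoc)
    show "\<exists>y\<in>carrier H. y \<otimes>\<^bsub>H\<^esub> x = \<one>\<^bsub>H\<^esub>" if "x \<in> carrier H" for x
    proof -
      from that obtain g where "g \<in> carrier G" "x = f g" by (auto simp: H_def)
      then have "f (inv\<^bsub>G\<^esub> g) \<in> carrier H \<and> f (inv\<^bsub>G\<^esub> g) \<otimes>\<^bsub>H\<^esub> x = \<one>\<^bsub>H\<^esub>"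
        by (auto simp: H_def ff)
      then show ?thesis by blast
    qed
  qed (auto simp: H_def ff)
  then interpret H: group H .
  have iso: "f \<in> iso G H"
    using f by (auto simp: iso_def hom_def H_def ff bij_betw_def)
  have cH: "carrier H = f ` carrier G" by (simp add: H_def)
  from iso interpret group_hom G H f
    by unfold_locales (simp add: iso_def)
  have gG: "generate G (range S) = carrier G"
    using G by (simp only: is_marked_def)
  have "range S \<subseteq> carrier G"
    using G by (simp only: is_marked_def)
  then have "generate H (f ` range S) = f ` generate G (range S)"
    by (rule generate_img)
  then have "generate H (range (f \<circ> S)) = carrier H"
    by (simp only: gG cH image_comp)
  moreover have "range (f \<circ> S) \<subseteq> carrier H"
    using is_marked_in[OF G] by (auto simp: cH)
  ultimately have "is_marked H (f \<circ> S)"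
    using H by (simp add: is_marked_def)
  moreover have "marked_iso G S H (f \<circ> S)"
    using iso by (auto simp: marked_iso_def)
  ultimately show ?thesis by blast
qed

lift_definition same_ball_at :: "'k::finite marked \<Rightarrow> 'k marked \<Rightarrow> nat \<Rightarrow> bool" is
  "\<lambda>(G, S) (H, T) n. same_ball G S H T n"
  by (auto simp: same_ball_iff marked_iso_iff fun_eq_iff)

lemma marked_cases:
  obtains G S where "is_marked G S" "p = abs_marked (G, S)"
proof -
  obtain G S where GS: "rep_marked p = (G, S)" by (cases "rep_marked p")
  have "(\<lambda>(G, S) (H, T). is_marked G S \<and> is_marked H T \<and> marked_iso G S H T)
      (rep_marked p) (rep_marked p)"
    by (rule Quotient_rep_reflp[OF Quotient_marked])
  then have "is_marked G S" by (simp add: GS)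
  moreover have "p = abs_marked (G, S)"
    using Quotient_abs_rep[OF Quotient_marked, of p] by (simp add: GS)
  ultimately show thesis by (rule that)
qed

lemma same_ball_at_abs:
  assumes "is_marked G S" "is_marked H T"
  shows "same_ball_at (abs_marked (G, S)) (abs_marked (H, T)) n = same_ball G S H T n"
  using assms by (subst same_ball_at.abs_eq) (auto simp: marked_iso_iff)

lemma abs_marked_eq_iff:
  assumes "is_marked G S" "is_marked H T"
  shows "abs_marked (G, S) = abs_marked (H, T) \<longleftrightarrow> marked_iso G S H T"
  using Quotient_rel[OF Quotient_marked, of "(G, S)" "(H, T)"] assms
  by (simp add: marked_iso_iff)

lemma marking_abs:
  assumes "is_marked G S"
  obtains H T where "is_marked H T" "marked_iso G S H T" "marking G S = abs_marked (H, T)"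
proof -
  obtain H T where HT: "marked_repr G S = (H, T)" by (cases "marked_repr G S")
  have "case marked_repr G S of (H, T) \<Rightarrow> is_marked H T \<and> marked_iso G S H T"
    unfolding marked_repr_def by (rule someI_ex) (use marked_repr_ex[OF assms] in auto)
  then show thesis using that[of H T] HT by (simp add: marking_def)
qed

lemma marking_eq_iff:
  assumes "is_marked G S" "is_marked H T"
  shows "marking G S = marking H T \<longleftrightarrow> marked_iso G S H T"
proof -
  obtain G' S' where 1: "is_marked G' S'" "marked_iso G S G' S'" "marking G S = abs_marked (G', S')"
    using assms(1) by (rule marking_abs)
  obtain H' T' where 2: "is_marked H' T'" "marked_iso H T H' T'" "marking H T = abs_marked (H', T')"
    using assms(2) by (rule marking_abs)
  show ?thesis using assms 1 2 by (simp add: abs_marked_eq_iff marked_iso_iff)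
qed

lemma same_ball_at_marking:
  assumes "is_marked G S" "is_marked H T"
  shows "same_ball_at (marking G S) (marking H T) n \<longleftrightarrow> same_ball G S H T n"
proof -
  obtain G' S' where 1: "is_marked G' S'" "marked_iso G S G' S'" "marking G S = abs_marked (G', S')"
    using assms(1) by (rule marking_abs)
  obtain H' T' where 2: "is_marked H' T'" "marked_iso H T H' T'" "marking H T = abs_marked (H', T')"
    using assms(2) by (rule marking_abs)
  show ?thesis using assms 1 2 by (simp add: same_ball_at_abs same_ball_iff marked_iso_iff)
qed

lemma same_ball_at_refl: "same_ball_at p p n"
  by (cases p rule: marked_cases) (auto simp: same_ball_at_abs same_ball_iff)

lemma same_ball_at_sym: "same_ball_at p q n \<Longrightarrow> same_ball_at q p n"
  by (cases p rule: marked_cases; cases q rule: marked_cases)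
    (simp add: same_ball_at_abs same_ball_iff)

lemma same_ball_at_trans: "same_ball_at p q n \<Longrightarrow> same_ball_at q r n \<Longrightarrow> same_ball_at p r n"
  by (cases p rule: marked_cases; cases q rule: marked_cases; cases r rule: marked_cases)
    (simp add: same_ball_at_abs same_ball_iff)

lemma same_ball_at_antimono: "same_ball_at p q n \<Longrightarrow> m \<le> n \<Longrightarrow> same_ball_at p q m"
  by (cases p rule: marked_cases; cases q rule: marked_cases)
    (simp add: same_ball_at_abs same_ball_iff)

lemma same_ball_at_0: "same_ball_at p q 0"
  by (cases p rule: marked_cases; cases q rule: marked_cases)
    (simp add: same_ball_at_abs same_ball_iff)

lemma marked_eq_iff: "p = q \<longleftrightarrow> (\<forall>n. same_ball_at p q n)"
proof
  assume *: "\<forall>n. same_ball_at p q n"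
  obtain G S where G: "is_marked G S" and p: "p = abs_marked (G, S)" by (rule marked_cases)
  obtain H T where H: "is_marked H T" and q: "q = abs_marked (H, T)" by (rule marked_cases)
  have "sval G S u = sval G S v \<longleftrightarrow> sval H T u = sval H T v" for u v
    using spec[OF *, of "max (length u) (length v)"]
    by (simp add: p q same_ball_at_abs[OF G H] same_ball_iff[OF G H])
  then show "p = q"
    by (simp add: p q abs_marked_eq_iff[OF G H] marked_iso_iff[OF G H])
qed (use same_ball_at_refl in blast)

lemma Greatest_same_ball_at:
  assumes "p \<noteq> q"
  shows "same_ball_at p q n \<longleftrightarrow> n \<le> (GREATEST n. same_ball_at p q n)"
proof -
  obtain m where "\<not> same_ball_at p q m" using assms marked_eq_iff by blast
  then have bd: "n \<le> m" if "same_ball_at p q n" for n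
    using that same_ball_at_antimono nat_le_linear by blast
  have "same_ball_at p q (GREATEST n. same_ball_at p q n)"
    using GreatestI_nat[of "same_ball_at p q", OF same_ball_at_0] bd by blast
  moreover have "n \<le> (GREATEST n. same_ball_at p q n)" if "same_ball_at p q n" for n
    using Greatest_le_nat[of "same_ball_at p q", OF that] bd by blast
  ultimately show ?thesis using same_ball_at_antimono by blast
qed

instantiation marked :: (finite) metric_space
begin

definition dist_marked :: "'a marked \<Rightarrow> 'a marked \<Rightarrow> real" where
  "dist_marked p q = (if p = q then 0 else (1/2) ^ (GREATEST n. same_ball_at p q n))"

definition uniformity_marked :: "('a marked \<times> 'a marked) filter" where
  "uniformity_marked = (INF e\<in>{0 <..}. principal {(x, y). dist x y < e})"

definition open_marked :: "'a marked set \<Rightarrow> bool" where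
  "open_marked U \<longleftrightarrow> (\<forall>x\<in>U. eventually (\<lambda>(x', y). x' = x \<longrightarrow> y \<in> U) uniformity)"

instance
proof
  fix p q r :: "'a marked"
  show "dist p q = 0 \<longleftrightarrow> p = q"
    by (simp add: dist_marked_def)
  have half: "(1/2 :: real) ^ m \<le> (1/2) ^ n \<longleftrightarrow> n \<le> m" for m n :: nat
    by (simp add: power_decreasing_iff)
  show "dist p q \<le> dist p r + dist q r"
  proof (cases "p = q \<or> p = r \<or> q = r")
    case True
    have "same_ball_at r q = same_ball_at q r"
      using same_ball_at_sym by blast
    then have "dist r q = dist q r"
      by (auto simp: dist_marked_def)
    moreover have "0 \<le> dist p r" "0 \<le> dist q r" by (auto simp: dist_marked_def)
    moreover have "dist p p = 0" "dist q q = 0" by (auto simp: dist_marked_def)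
    ultimately show ?thesis using True by auto
  next
    case False
    define n where "n = (GREATEST n. same_ball_at p q n)"
    have "\<not> same_ball_at p q (Suc n)"
      using False Greatest_same_ball_at[of p q "Suc n"] unfolding n_def by linarith
    then have "\<not> same_ball_at p r (Suc n) \<or> \<not> same_ball_at q r (Suc n)"
      using same_ball_at_trans same_ball_at_sym by blast
    then have "(GREATEST n. same_ball_at p r n) \<le> n \<or> (GREATEST n. same_ball_at q r n) \<le> n"
      using False Greatest_same_ball_at[of p r "Suc n"] Greatest_same_ball_at[of q r "Suc n"]
      by linarith
    then have "(1/2) ^ n \<le> dist p r \<or> (1/2) ^ n \<le> dist q r"
      using False by (simp add: dist_marked_def half)
    moreover have "0 \<le> dist p r" "0 \<le> dist q r" by (auto simp: dist_marked_def)
    moreover have "dist p q = (1/2) ^ n" using False by (simp add: dist_marked_def n_def)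
    ultimately show ?thesis by linarith
  qed
qed (simp_all only: uniformity_marked_def open_marked_def)

end


lemma dist_marked_less_iff: "dist p q < (1/2) ^ n \<longleftrightarrow> same_ball_at p q (Suc n)"
proof (cases "p = q")
  case True
  then show ?thesis by (simp add: same_ball_at_refl)
next
  case False
  then have "dist p q < (1/2) ^ n \<longleftrightarrow> n < (GREATEST n. same_ball_at p q n)"
    by (simp add: dist_marked_def power_strict_decreasing_iff)
  also have "\<dots> \<longleftrightarrow> same_ball_at p q (Suc n)"
    using Greatest_same_ball_at[OF False, of "Suc n"] by linarith
  finally show ?thesis .
qed


section \<open>The Cantor set\<close>

primrec cantor_step :: "nat \<Rightarrow> real set" where
  "cantor_step 0 = {0..1}"
| "cantor_step (Suc n) = (\<lambda>x. x / 3) ` cantor_step n \<union> (\<lambda>x. (x + 2) / 3) ` cantor_step n"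

definition cantor_set :: "real set" where
  "cantor_set = (\<Inter>n. cantor_step n)"


section \<open>Oracles\<close>

text \<open>Indices are shifted by one: \<open>\<omega> n\<close> stands for the symbol \<open>\<omega>\<^sub>n\<^sub>+\<^sub>1\<close>.\<close>

type_synonym oracle_seq = "nat \<Rightarrow> nat"

definition Oracles :: "oracle_seq set" where
  "Oracles = {\<omega>. \<forall>n. \<omega> n \<in> {0, 1, 2}}"

definition occurs_inf :: "oracle_seq \<Rightarrow> nat \<Rightarrow> bool" where
  "occurs_inf \<omega> s \<longleftrightarrow> infinite {n. \<omega> n = s}"

definition Oracles0 :: "oracle_seq set" where
  "Oracles0 = {\<omega> \<in> Oracles. \<forall>s\<in>{0, 1, 2}. occurs_inf \<omega> s}"

definition Oracles1 :: "oracle_seq set" where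
  "Oracles1 = {\<omega> \<in> Oracles. card {s \<in> {0, 1, 2}. occurs_inf \<omega> s} = 2}"

definition Oracles2 :: "oracle_seq set" where
  "Oracles2 = {\<omega> \<in> Oracles. \<exists>s. \<forall>\<^sub>F n in sequentially. \<omega> n = s}"

definition shift :: "oracle_seq \<Rightarrow> oracle_seq" where
  "shift \<omega> = (\<lambda>n. \<omega> (Suc n))"


section \<open>Generalized overgroups\<close>

text \<open>Vertices of the binary tree are words over \<open>{0, 1}\<close>, with 0 and 1 encoded as
  \<^const>\<open>False\<close> and \<^const>\<open>True\<close>.\<close>

definition tree_aut :: "(bool list \<Rightarrow> bool list) monoid" where
  "tree_aut = \<lparr>carrier = {f. bij f \<and> f [] = [] \<and> (\<forall>w i. \<exists>j. f (w @ [i]) = f w @ [j])},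
     mult = (\<circ>), one = id\<rparr>"

fun root_swap :: "bool list \<Rightarrow> bool list" where
  "root_swap [] = []"
| "root_swap (i # w) = (\<not> i) # w"

text \<open>The automorphism given by a sequence in \<open>{P, I}\<close>; \<open>p n\<close> holds iff the entry with number
  \<open>n + 1\<close> is \<open>P\<close>, in which case the two subtrees below the vertex \<open>1\<^sup>n0\<close> are swapped.\<close>

fun seq_aut :: "(nat \<Rightarrow> bool) \<Rightarrow> bool list \<Rightarrow> bool list" where
  "seq_aut p [] = []"
| "seq_aut p (True # w) = True # seq_aut (\<lambda>n. p (Suc n)) w"
| "seq_aut p (False # w) = False # (if p 0 then root_swap w else w)"

text \<open>The letters \<open>Lbt\<close>, \<open>Lct\<close>, \<open>Ldt\<close> are \<open>b\<close>, \<open>c\<close>, \<open>d\<close> with a tilde. Generating families are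
  indexed by the eight letters instead of the numbers from 1 to 8.\<close>

datatype letter = La | Lb | Lc | Ld | Lx | Lbt | Lct | Ldt

lemma UNIV_letter: "UNIV = {La, Lb, Lc, Ld, Lx, Lbt, Lct, Ldt}"
  using letter.exhaust by auto

instance letter :: finite
  by standard (simp add: UNIV_letter)

fun overgroup_gens :: "oracle_seq \<Rightarrow> letter \<Rightarrow> bool list \<Rightarrow> bool list" where
  "overgroup_gens \<omega> La = root_swap"
| "overgroup_gens \<omega> Lb = seq_aut (\<lambda>n. \<omega> n \<in> {0, 1})"
| "overgroup_gens \<omega> Lc = seq_aut (\<lambda>n. \<omega> n \<in> {0, 2})"
| "overgroup_gens \<omega> Ld = seq_aut (\<lambda>n. \<omega> n \<in> {1, 2})"
| "overgroup_gens \<omega> Lx = seq_aut (\<lambda>n. True)"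
| "overgroup_gens \<omega> Lbt = seq_aut (\<lambda>n. True) \<otimes>\<^bsub>tree_aut\<^esub> seq_aut (\<lambda>n. \<omega> n \<in> {0, 1})"
| "overgroup_gens \<omega> Lct = seq_aut (\<lambda>n. True) \<otimes>\<^bsub>tree_aut\<^esub> seq_aut (\<lambda>n. \<omega> n \<in> {0, 2})"
| "overgroup_gens \<omega> Ldt = seq_aut (\<lambda>n. True) \<otimes>\<^bsub>tree_aut\<^esub> seq_aut (\<lambda>n. \<omega> n \<in> {1, 2})"

definition overgroup :: "oracle_seq \<Rightarrow> (bool list \<Rightarrow> bool list) monoid" where
  "overgroup \<omega> = tree_aut\<lparr>carrier := generate tree_aut (range (overgroup_gens \<omega>))\<rparr>"

lemma group_tree_aut: "group tree_aut"
proof (rule groupI)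
  show "f \<otimes>\<^bsub>tree_aut\<^esub> g \<in> carrier tree_aut"
    if "f \<in> carrier tree_aut" "g \<in> carrier tree_aut" for f g
    using that by (auto simp: tree_aut_def bij_comp) metis
  show "\<exists>g\<in>carrier tree_aut. g \<otimes>\<^bsub>tree_aut\<^esub> f = \<one>\<^bsub>tree_aut\<^esub>"
    if "f \<in> carrier tree_aut" for f
  proof
    have f: "bij f" "f [] = []" "\<And>w i. \<exists>j. f (w @ [i]) = f w @ [j]"
      using that by (auto simp: tree_aut_def)
    show "inv_into UNIV f \<otimes>\<^bsub>tree_aut\<^esub> f = \<one>\<^bsub>tree_aut\<^esub>"
      using f by (simp add: tree_aut_def bij_is_inj)
    have "\<exists>j. inv_into UNIV f (w @ [i]) = inv_into UNIV f w @ [j]" for w i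
    proof -
      obtain v where v: "w @ [i] = f v" using f(1) by (metis bij_pointE)
      then have "v \<noteq> []" using f(2) by auto
      then obtain u j where u: "v = u @ [j]" by (metis rev_exhaust)
      then have "w = f u" using f(3)[of u j] v by auto
      then show ?thesis using u v f(1) by (metis bij_inv_eq_iff)
    qed
    moreover have "inv_into UNIV f [] = []" using f by (metis bij_inv_eq_iff)
    ultimately show "inv_into UNIV f \<in> carrier tree_aut"
      using f(1) by (auto simp: tree_aut_def bij_imp_bij_inv)
  qed
qed (auto simp: tree_aut_def comp_assoc)

lemma root_swap_twice: "root_swap (root_swap w) = w"
  by (cases w) auto

lemma seq_aut_twice: "seq_aut p (seq_aut p w) = w"
  by (induction p w rule: seq_aut.induct) (auto simp: root_swap_twice)

lemma root_swap_in: "root_swap \<in> carrier tree_aut"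
proof -
  have "\<exists>j. root_swap (w @ [i]) = root_swap w @ [j]" for w i
    by (cases w) auto
  then show ?thesis
    by (auto simp: tree_aut_def root_swap_twice intro!: o_bij[of root_swap])
qed

lemma seq_aut_in: "seq_aut p \<in> carrier tree_aut"
proof -
  have "\<exists>j. seq_aut p (w @ [i]) = seq_aut p w @ [j]" for w i
  proof (induction p w rule: seq_aut.induct)
    case (1 p)
    then show ?case by (cases i) auto
  next
    case (3 p w)
    then show ?case by (cases w) auto
  qed auto
  then show ?thesis
    by (auto simp: tree_aut_def seq_aut_twice fun_eq_iff intro!: o_bij[of "seq_aut p"])
qed

lemma overgroup_gens_in: "overgroup_gens \<omega> y \<in> carrier tree_aut"
proof -
  interpret group tree_aut by (rule group_tree_aut)
  show ?thesis by (cases y) (auto simp: root_swap_in seq_aut_in)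
qed

lemma is_marked_overgroup: "is_marked (overgroup \<omega>) (overgroup_gens \<omega>)"
proof -
  interpret group tree_aut by (rule group_tree_aut)
  have sub: "range (overgroup_gens \<omega>) \<subseteq> carrier tree_aut" using overgroup_gens_in by auto
  have sg: "subgroup (generate tree_aut (range (overgroup_gens \<omega>))) tree_aut"
    by (rule generate_is_subgroup[OF sub])
  have "generate (overgroup \<omega>) (range (overgroup_gens \<omega>)) =
      generate tree_aut (range (overgroup_gens \<omega>))"
    unfolding overgroup_def by (rule generate_consistent[OF _ sg]) (auto intro: generate.incl)
  moreover have "group (overgroup \<omega>)"
    unfolding overgroup_def by (rule subgroup.subgroup_is_group[OF sg group_tree_aut])
  ultimately show ?thesis
    by (auto simp: is_marked_def overgroup_def intro: generate.incl)
qed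


section \<open>Words and their decomposition\<close>

text \<open>Exponents of \<open>b\<close>, \<open>c\<close>, \<open>x\<close> of the elements of the elementary abelian group \<open>E\<close>, where
  \<open>d = bc\<close>.\<close>

fun E_coords :: "letter \<Rightarrow> bool \<times> bool \<times> bool" where
  "E_coords La = (False, False, False)"
| "E_coords Lb = (True, False, False)"
| "E_coords Lc = (False, True, False)"
| "E_coords Ld = (True, True, False)"
| "E_coords Lx = (False, False, True)"
| "E_coords Lbt = (True, False, True)"
| "E_coords Lct = (False, True, True)"
| "E_coords Ldt = (True, True, True)"

fun E_word :: "bool \<times> bool \<times> bool \<Rightarrow> letter list" where
  "E_word (False, False, False) = []"
| "E_word (True, False, False) = [Lb]"
| "E_word (False, True, False) = [Lc]"
| "E_word (True, True, False) = [Ld]"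
| "E_word (False, False, True) = [Lx]"
| "E_word (True, False, True) = [Lbt]"
| "E_word (False, True, True) = [Lct]"
| "E_word (True, True, True) = [Ldt]"

text \<open>The product of two letters different from \<open>a\<close>, as a word of length at most 1.\<close>

definition E_prod :: "letter \<Rightarrow> letter \<Rightarrow> letter list" where
  "E_prod y z = (case (E_coords y, E_coords z) of
     ((i, j, k), (i', j', k')) \<Rightarrow> E_word (i \<noteq> i', j \<noteq> j', k \<noteq> k'))"

definition reduced_word :: "letter list \<Rightarrow> bool" where
  "reduced_word W \<longleftrightarrow> successively (\<lambda>y z. (y = La) \<noteq> (z = La)) W"

text \<open>Left multiplication of a reduced word by a letter.\<close>

fun reduce_Cons :: "letter \<Rightarrow> letter list \<Rightarrow> letter list" where
  "reduce_Cons y [] = [y]"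
| "reduce_Cons y (z # W) =
     (if y = La \<and> z = La then W
      else if y \<noteq> La \<and> z \<noteq> La then E_prod y z @ W
      else y # z # W)"

definition reduce :: "letter list \<Rightarrow> letter list" where
  "reduce W = foldr reduce_Cons W []"

lemma reduced_word_reduce: "reduced_word (reduce W)"
proof -
  have *: "reduced_word (reduce_Cons y V)" if "reduced_word V" for y V
  proof (cases V)
    case (Cons z U)
    then show ?thesis using that
      by (cases U; cases y; cases z) (auto simp: reduced_word_def E_prod_def)
  qed (simp add: reduced_word_def)
  show ?thesis
    by (induction W) (auto simp: reduce_def * reduced_word_def[of "[]"])
qed

text \<open>The symbols \<open>s\<close> for which \<open>p\<^sub>y = a\<close> if \<open>s\<close> is the first symbol of the sequence.\<close>

fun swap_symbols :: "letter \<Rightarrow> nat set" where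
  "swap_symbols La = {}"
| "swap_symbols Lb = {0, 1}"
| "swap_symbols Lc = {0, 2}"
| "swap_symbols Ld = {1, 2}"
| "swap_symbols Lx = {0, 1, 2}"
| "swap_symbols Lbt = {2}"
| "swap_symbols Lct = {1}"
| "swap_symbols Ldt = {0}"

definition p_word :: "nat \<Rightarrow> letter \<Rightarrow> letter list" where
  "p_word s y = (if s \<in> swap_symbols y then [La] else [])"

text \<open>The two coordinates before reduction; the flag \<open>r\<close> says whether the number of letters \<open>a\<close>
  read so far is odd.\<close>

fun decompose :: "nat \<Rightarrow> bool \<Rightarrow> letter list \<Rightarrow> letter list \<times> letter list" where
  "decompose s r [] = ([], [])"
| "decompose s r (y # W) =
     (if y = La then decompose s (\<not> r) W
      else let (U, V) = decompose s r W in
        if r then (y # U, p_word s y @ V) else (p_word s y @ U, y # V))"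

definition component :: "nat \<Rightarrow> bool \<Rightarrow> letter list \<Rightarrow> letter list" where
  "component s i W = reduce ((if i then snd else fst) (decompose s False W))"

text \<open>\<open>N\<close>-fold decomposition relative to \<open>\<omega>\<close>; the outcome is positive iff only words with an even
  number of \<open>a\<close>'s had to be decomposed and all \<open>2\<^sup>N\<close> resulting words satisfy \<open>Q\<close>.\<close>

fun decomposition_test :: "(letter list \<Rightarrow> bool) \<Rightarrow> oracle_seq \<Rightarrow> nat \<Rightarrow> letter list \<Rightarrow> bool" where
  "decomposition_test Q \<omega> 0 W \<longleftrightarrow> Q W"
| "decomposition_test Q \<omega> (Suc N) W \<longleftrightarrow> even (count_list W La) \<and>
     (\<forall>i. decomposition_test Q (shift \<omega>) N (component (\<omega> 0) i W))"

definition log_length :: "letter list \<Rightarrow> nat" where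
  "log_length W = nat \<lceil>log 2 (real (length W))\<rceil>"

definition alpha :: "oracle_seq \<Rightarrow> letter list \<Rightarrow> bool" where
  "alpha \<omega> W \<longleftrightarrow> W = [] \<or> decomposition_test (\<lambda>V. V = []) \<omega> (log_length W) W"

definition last_index :: "oracle_seq \<Rightarrow> nat \<Rightarrow> nat" where
  "last_index \<omega> k = (if \<exists>n. \<omega> n = k then Suc (GREATEST n. \<omega> n = k) else 0)"

definition e_letter :: "nat \<Rightarrow> nat \<Rightarrow> letter" where
  "e_letter i j = (if {i, j} = {0, 1} then Lbt else if {i, j} = {1, 2} then Ldt else Lct)"

text \<open>The algorithm \<open>\<beta>\<^sub>i\<^sub>j\<close>, where \<open>{i, j, k} = {0, 1, 2}\<close> and \<open>k\<close> occurs finitely often in \<open>\<omega>\<close>.\<close>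

definition beta :: "nat \<Rightarrow> nat \<Rightarrow> nat \<Rightarrow> oracle_seq \<Rightarrow> letter list \<Rightarrow> bool" where
  "beta i j k \<omega> W \<longleftrightarrow> W = [] \<or>
     decomposition_test (\<lambda>V. V = [] \<or> V = [e_letter i j]) \<omega> (max (last_index \<omega> k) (log_length W)) W"


section \<open>Modified overgroups\<close>

definition word_val :: "'g monoid \<Rightarrow> (letter \<Rightarrow> 'g) \<Rightarrow> letter list \<Rightarrow> 'g" where
  "word_val G S W = foldr (\<lambda>y g. S y \<otimes>\<^bsub>G\<^esub> g) W \<one>\<^bsub>G\<^esub>"

definition simple_contractions :: "'g monoid \<Rightarrow> (letter \<Rightarrow> 'g) \<Rightarrow> bool" where
  "simple_contractions G S \<longleftrightarrow> S La \<otimes>\<^bsub>G\<^esub> S La = \<one>\<^bsub>G\<^esub> \<and>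
     (\<forall>y z. y \<noteq> La \<longrightarrow> z \<noteq> La \<longrightarrow> S y \<otimes>\<^bsub>G\<^esub> S z = word_val G S (E_prod y z))"

definition modified_overgroup ::
  "(letter list \<Rightarrow> bool) \<Rightarrow> 'g monoid \<Rightarrow> (letter \<Rightarrow> 'g) \<Rightarrow> bool" where
  "modified_overgroup pos G S \<longleftrightarrow> is_marked G S \<and> simple_contractions G S \<and>
     (\<forall>W. reduced_word W \<longrightarrow> (word_val G S W = \<one>\<^bsub>G\<^esub> \<longleftrightarrow> pos W))"


section \<open>Sets of marked groups\<close>

definition overgroup_points :: "oracle_seq set \<Rightarrow> letter marked set" where
  "overgroup_points A = (\<lambda>\<omega>. marking (overgroup \<omega>) (overgroup_gens \<omega>)) ` A"

definition alpha_points :: "oracle_seq set \<Rightarrow> letter marked set" where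
  "alpha_points A = {marking G S | (G :: nat monoid) S.
     \<exists>\<omega>\<in>A. modified_overgroup (alpha \<omega>) G S}"

definition beta_points :: "oracle_seq set \<Rightarrow> letter marked set" where
  "beta_points A = {marking G S | (G :: nat monoid) S.
     \<exists>\<omega>\<in>A. \<exists>i j k. {i, j, k} = {0, 1, 2} \<and> finite {n. \<omega> n = k} \<and>
       modified_overgroup (beta i j k \<omega>) G S}"

definition "XX = overgroup_points Oracles"
definition "XX0 = overgroup_points Oracles0"
definition "XX1 = overgroup_points Oracles1"
definition "XX2 = overgroup_points Oracles2"
definition "XX1_alpha = alpha_points Oracles1"
definition "XX2_alpha = alpha_points Oracles2"
definition "XX2_beta = beta_points Oracles2"
definition "YY = XX0 \<union> XX1_alpha \<union> XX2_alpha"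

definition limit_points :: "'a::topological_space set \<Rightarrow> 'a set" where
  "limit_points V = {p. p islimpt V}"

end

(* Adjoin symbols at infinity to an oracle: for a set F of symbols let the letters act on germs of
   sequences at 1^infinity as if the symbols of F occurred beyond all positions of the oracle. This
   gives one marked group for each pair (omega, F), in which a word is trivial iff after sufficiently
   many decompositions all its components are trivial or letters that do not see the remaining
   symbols, namely F and those of the tail of omega. The original groups, alpha and beta are the cases
   F = {}, {0, 1, 2} and {i, j}.

   The symbols of the tails, together with omega, vary over a compact space on which the marked group
   depends continuously, so all limits are of this form. If two or more symbols remain at infinity,
   omega and the symbols of all its tails can be recovered from the relations that are double
   commutators: those lift through the decomposition, because the other coordinate of the lift
   lies in a dihedral group, which is metabelian. If only one symbol remains at infinity, the oracle
   is eventually constant and the point is isolated. (Such points do not determine the oracle: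
   w01111... and w10000... give the same marked group.)

   Finally a compact perfect set with countably many clopen sets separating points is mapped onto the
   Cantor set by the ternary series of the digits at those levels where the set splits. *)

theory Submission
  imports Defs "HOL-Library.Diagonal_Subsequence"
begin

section \<open>Words and self-similar actions\<close>

text \<open>The algorithms only say which words are positive; that these words are the relators of a
  group is not evident. It follows by exhibiting permutations: the germ action realises every pair
  (\<open>\<omega>\<close>, \<open>F\<close>), and the algorithms are then compared with triviality
  in that group. The tree action satisfies the same axioms, so decomposition is treated once, in a
  locale. The obstacle to continuity is that words of length at most \<open>2 ^ N\<close> depend on
  the first \<open>N\<close> symbols and on the set of all symbols met later, however late. Oracles
  may converge while a symbol escapes to infinity; \<open>F\<close> records what has escaped.
  Different sets \<open>F\<close> may lead to the same tails, hence to the same point, so the tails,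
  not \<open>F\<close>, are what can be recovered. Restricting to double commutators loses nothing,
  because in the nondegenerate case no nontrivial element commutes with all commutators: a word that
  is trivial in another group but not in this one can be enlarged to a double commutator with the
  same property.\<close>

definition tail_symbols :: "oracle_seq \<Rightarrow> nat set \<Rightarrow> nat \<Rightarrow> nat set" where
  "tail_symbols \<omega> F N = F \<union> \<omega> ` {N..}"

lemma tail_symbols_Suc: "tail_symbols \<omega> F N = insert (\<omega> N) (tail_symbols \<omega> F (Suc N))"
proof -
  have "{N..} = insert N {Suc N..}" by auto
  then show ?thesis by (auto simp: tail_symbols_def)
qed

lemma tail_symbols_shift: "tail_symbols (shift \<omega>) F N = tail_symbols \<omega> F (Suc N)"
proof -
  have "\<exists>m\<ge>N. \<omega> n = \<omega> (Suc m)" if "n \<ge> Suc N" for n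
    using that by (intro exI[of _ "n - 1"]) auto
  then show ?thesis by (auto simp: tail_symbols_def shift_def image_iff)
qed

lemma tail_symbols_0: "tail_symbols \<omega> F 0 = insert (\<omega> 0) (tail_symbols (shift \<omega>) F 0)"
  by (subst tail_symbols_Suc) (simp add: tail_symbols_shift)

lemma tail_symbols_subset:
  "\<omega> \<in> Oracles \<Longrightarrow> F \<subseteq> {0, 1, 2} \<Longrightarrow> tail_symbols \<omega> F N \<subseteq> {0, 1, 2}"
  by (simp add: tail_symbols_def Oracles_def image_subset_iff del: insert_iff)

lemma tail_symbols_full: "\<omega> \<in> Oracles \<Longrightarrow> tail_symbols \<omega> {0, 1, 2} N = {0, 1, 2}"
  using tail_symbols_subset[of \<omega> "{0, 1, 2}" N] by (intro subset_antisym) (auto simp: tail_symbols_def)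

lemma shift_in_Oracles: "\<omega> \<in> Oracles \<Longrightarrow> shift \<omega> \<in> Oracles"
  by (simp add: Oracles_def shift_def)

text \<open>\<open>A\<close> stands for the symbols still to come: a single letter other than
  \<open>a\<close> is trivial iff it swaps at none of them. Depending on \<open>A\<close>, this is
  the leaf condition of \<open>\<alpha>\<close> (three symbols), of \<open>\<beta>\<close> (two
  symbols) or of the tree (the symbols of the tail).\<close>

definition leaf_pos :: "nat set \<Rightarrow> letter list \<Rightarrow> bool" where
  "leaf_pos A V \<longleftrightarrow> V = [] \<or> (\<exists>y. y \<noteq> La \<and> V = [y] \<and> swap_symbols y \<inter> A = {})"

lemma E_prod_cases: obtains "E_prod x y = []" | z where "z \<noteq> La" "E_prod x y = [z]"
  by (cases x; cases y) (auto simp: E_prod_def)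

lemma E_prod_self: "E_prod y y = []"
  by (cases y) (auto simp: E_prod_def)

lemma E_prod_commute: "E_prod y z = E_prod z y"
  by (cases y; cases z) (auto simp: E_prod_def)

text \<open>The map \<open>swap_symbols\<close> embeds \<open>E\<close> into the subsets of \<open>{0, 1, 2}\<close> with symmetric difference.\<close>

lemma swap_symbols_E_prod:
  assumes "y \<noteq> La" "z \<noteq> La"
  shows "E_prod y z = [] \<Longrightarrow> swap_symbols y = swap_symbols z"
    and "E_prod y z = [v] \<Longrightarrow> s \<in> swap_symbols v \<longleftrightarrow> (s \<in> swap_symbols y) \<noteq> (s \<in> swap_symbols z)"
  using assms by (cases y; cases z; force simp: E_prod_def)+

lemma length_reduce_Cons: "length (reduce_Cons y V) \<le> Suc (length V)"
proof (cases V)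
  case (Cons z U)
  have "length (E_prod y z) \<le> 1" by (cases y z rule: E_prod_cases) auto
  then show ?thesis using Cons by auto
qed simp

lemma length_reduce: "length (reduce W) \<le> length W"
proof (induction W)
  case (Cons y W)
  have "reduce (y # W) = reduce_Cons y (reduce W)" by (simp add: reduce_def)
  then show ?case using length_reduce_Cons[of y "reduce W"] Cons by simp
qed (simp add: reduce_def)

subsection \<open>Coordinates of a word\<close>

text \<open>Coordinates before reduction. They satisfy exact identities for concatenation and
  reversal, from which commutators can be computed; reduction matters only for the length.\<close>

definition coord :: "nat \<Rightarrow> bool \<Rightarrow> letter list \<Rightarrow> letter list" where
  "coord s i W = (if i then snd else fst) (decompose s False W)"

lemma decompose_flip: "decompose s (\<not> r) W = prod.swap (decompose s r W)"
  by (induction W arbitrary: r) (auto split: prod.splits simp: prod.swap_def)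

lemma coord_Nil [simp]: "coord s i [] = []"
  by (simp add: coord_def)

lemma coord_La [simp]: "coord s i (La # W) = coord s (\<not> i) W"
  using decompose_flip[of s False W] by (simp add: coord_def prod.swap_def)

lemma coord_Cons [simp]:
  "y \<noteq> La \<Longrightarrow> coord s i (y # W) = (if i then [y] else p_word s y) @ coord s i W"
  by (simp add: coord_def split: prod.splits)

lemma coord_append:
  "coord s i (U @ V) = coord s i U @ coord s (i \<noteq> odd (count_list U La)) V"
proof (induction U arbitrary: i)
  case (Cons y U)
  then show ?case by (cases "y = La"; cases i; cases "odd (count_list U La)") simp_all
qed simp

lemma count_list_rev [simp]: "count_list (rev W) y = count_list W y"
  by (induction W) auto

lemma rev_p_word [simp]: "rev (p_word s y) = p_word s y"
  by (simp add: p_word_def)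

text \<open>All letters are involutions, so reversal is inversion. Inverting an element that
  exchanges the halves also exchanges its coordinates, hence the parity.\<close>

lemma coord_rev: "coord s i (rev W) = rev (coord s (i \<noteq> odd (count_list W La)) W)"
proof (induction W arbitrary: i)
  case (Cons y W)
  then show ?case by (cases "y = La") (auto simp: coord_append)
qed simp

lemma component_coord: "component s i W = reduce (coord s i W)"
  by (simp add: component_def coord_def)

lemma length_coord: "length (coord s i W) \<le> length (filter (\<lambda>y. y \<noteq> La) W)"
proof (induction W arbitrary: i)
  case (Cons y W)
  have "length (p_word s y) \<le> 1" by (simp add: p_word_def)
  then show ?case using Cons[of i] Cons[of "\<not> i"] by (cases "y = La") auto
qed simp

text \<open>The two bounds are proved together: removing a leading letter other than
  \<open>a\<close> leaves a word that is empty or starts with \<open>a\<close>, and for the latter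
  the sharper bound holds.\<close>

lemma length_filter_reduced_word:
  assumes "reduced_word W"
  shows "2 * length (filter (\<lambda>y. y \<noteq> La) W) \<le> Suc (length W)"
    and "W \<noteq> [] \<Longrightarrow> hd W = La \<Longrightarrow> 2 * length (filter (\<lambda>y. y \<noteq> La) W) \<le> length W"
  using assms
proof (induction W)
  case (Cons y W)
  {
    case 1
    show ?case using Cons 1 by (cases W) (auto simp: reduced_word_def split: if_splits)
  next
    case 2
    show ?case using Cons 2 by (cases W) (auto simp: reduced_word_def split: if_splits)
  }
qed auto

text \<open>A coordinate has at most one letter for each letter other than \<open>a\<close>, which
  is about half of an alternating word. The surplus of 1/2 is absorbed since \<open>2 ^ N\<close> is
  an integer.\<close>

lemma length_component:
  assumes "reduced_word W" "length W \<le> 2 ^ Suc N"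
  shows "length (component s i W) \<le> 2 ^ N"
proof -
  have "length (component s i W) \<le> length (filter (\<lambda>y. y \<noteq> La) W)"
    unfolding component_coord using length_reduce length_coord le_trans by blast
  moreover have "2 * length (filter (\<lambda>y. y \<noteq> La) W) \<le> Suc (2 * 2 ^ N)"
    using length_filter_reduced_word(1)[OF assms(1)] assms(2) by simp
  ultimately show ?thesis by linarith
qed

lemma length_le_log_length: "length W \<le> 2 ^ log_length W"
proof (cases "W = []")
  case False
  let ?n = "length W"
  have n: "real ?n > 0" using False by simp
  have "log 2 (real ?n) \<le> real (log_length W)"
    unfolding log_length_def by linarith
  then have "real ?n \<le> 2 powr real (log_length W)"
    using n by (simp add: log_le_iff)
  then have "real ?n \<le> real (2 ^ log_length W)"
    by (simp add: powr_realpow)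
  then show ?thesis by linarith
qed simp

lemma decomposition_test_cong:
  "(\<And>V. Q V \<longleftrightarrow> Q' V) \<Longrightarrow> (\<And>n. n < N \<Longrightarrow> \<omega> n = \<omega>' n) \<Longrightarrow>
    decomposition_test Q \<omega> N W \<longleftrightarrow> decomposition_test Q' \<omega>' N W"
proof (induction N arbitrary: \<omega> \<omega>' W)
  case (Suc N)
  have "decomposition_test Q (shift \<omega>) N V \<longleftrightarrow> decomposition_test Q' (shift \<omega>') N V" for V
    by (rule Suc.IH) (auto simp: Suc.prems shift_def)
  then show ?case using Suc.prems(2)[of 0] by simp
qed simp

subsection \<open>Self-similar actions\<close>

text \<open>What the tree and the germs have in common. \<open>sub i\<close> embeds the space into
  itself as its half \<open>i\<close>; points outside both halves, such as the root of the tree, are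
  fixed. \<open>F\<close> enters only through \<open>act_trivial\<close>, which decides single
  letters; longer words are brought down to these by decomposition.\<close>

locale self_similar =
  fixes F :: "nat set" and act :: "oracle_seq \<Rightarrow> letter \<Rightarrow> 'x \<Rightarrow> 'x" and sub :: "bool \<Rightarrow> 'x \<Rightarrow> 'x"
  assumes sub_inject: "sub i x = sub j x' \<longleftrightarrow> i = j \<and> x = x'"
    and sub_cases: "(\<exists>i x'. x = sub i x') \<or> (\<forall>\<omega> y. act \<omega> y x = x)"
    and act_La: "act \<omega> La (sub i x) = sub (\<not> i) x"
    and act_True: "y \<noteq> La \<Longrightarrow> act \<omega> y (sub True x) = sub True (act (shift \<omega>) y x)"
    and act_False: "y \<noteq> La \<Longrightarrow> act \<omega> y (sub False x) =
      sub False (if \<omega> 0 \<in> swap_symbols y then act (shift \<omega>) La x else x)"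
    and act_La_La: "act \<omega> La (act \<omega> La x) = x"
    and act_E_prod: "y \<noteq> La \<Longrightarrow> z \<noteq> La \<Longrightarrow> act \<omega> y (act \<omega> z x) = foldr (act \<omega>) (E_prod y z) x"
    and act_trivial: "y \<noteq> La \<Longrightarrow> (\<forall>x. act \<omega> y x = x) \<longleftrightarrow> swap_symbols y \<inter> tail_symbols \<omega> F 0 = {}"
begin

definition word_act :: "oracle_seq \<Rightarrow> letter list \<Rightarrow> 'x \<Rightarrow> 'x" where
  "word_act \<omega> W = foldr (act \<omega>) W"

definition triv :: "oracle_seq \<Rightarrow> letter list \<Rightarrow> bool" where
  "triv \<omega> W \<longleftrightarrow> (\<forall>x. word_act \<omega> W x = x)"

lemma word_act_Nil [simp]: "word_act \<omega> [] x = x"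
  by (simp add: word_act_def)

lemma word_act_Cons: "word_act \<omega> (y # W) x = act \<omega> y (word_act \<omega> W x)"
  by (simp add: word_act_def)

lemma word_act_append: "word_act \<omega> (U @ V) x = word_act \<omega> U (word_act \<omega> V x)"
  by (simp add: word_act_def)

lemma act_act [simp]: "act \<omega> y (act \<omega> y x) = x"
  by (cases "y = La") (simp_all add: act_La_La act_E_prod E_prod_self)

lemma word_act_rev [simp]: "word_act \<omega> (rev W) (word_act \<omega> W x) = x"
  by (induction W) (simp_all add: word_act_append word_act_Cons)

lemma word_act_rev' [simp]: "word_act \<omega> W (word_act \<omega> (rev W) x) = x"
  using word_act_rev[of \<omega> "rev W" x] by simp

lemma word_act_reduce_Cons: "word_act \<omega> (reduce_Cons y W) x = act \<omega> y (word_act \<omega> W x)"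
  by (cases W) (auto simp: word_act_Cons word_act_append act_E_prod word_act_def)

lemma word_act_reduce: "word_act \<omega> (reduce W) x = word_act \<omega> W x"
proof (induction W)
  case (Cons y W)
  have "reduce (y # W) = reduce_Cons y (reduce W)" by (simp add: reduce_def)
  then show ?case using Cons by (simp add: word_act_reduce_Cons word_act_Cons)
qed (simp add: reduce_def)

lemma triv_reduce: "triv \<omega> (reduce W) \<longleftrightarrow> triv \<omega> W"
  by (simp add: triv_def word_act_reduce)

lemma word_act_p_word: "word_act \<omega> (p_word s y) x = (if s \<in> swap_symbols y then act \<omega> La x else x)"
  by (simp add: p_word_def word_act_Cons)

text \<open>The last letter acts first, whereas \<open>decompose\<close> counts the letters
  \<open>a\<close> from the left. Therefore the coordinate is indexed by the half in which the image
  lies, not by the half of the argument.\<close>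

lemma word_act_sub:
  "word_act \<omega> W (sub i x) = sub (i \<noteq> odd (count_list W La))
     (word_act (shift \<omega>) (coord (\<omega> 0) (i \<noteq> odd (count_list W La)) W) x)"
proof (induction W)
  case (Cons y W)
  define j where "j = (i \<noteq> odd (count_list W La))"
  have *: "word_act \<omega> W (sub i x) = sub j (word_act (shift \<omega>) (coord (\<omega> 0) j W) x)"
    using Cons by (simp only: j_def)
  have j: "(i \<noteq> odd (count_list (y # W) La)) = (if y = La then \<not> j else j)"
    by (auto simp: j_def)
  show ?case
    unfolding j word_act_Cons *
    by (cases "y = La"; cases j)
      (simp_all add: act_La act_True act_False word_act_Cons word_act_append word_act_p_word)
qed simp

lemma word_act_fixed: "(\<forall>\<omega> y. act \<omega> y x = x) \<Longrightarrow> word_act \<omega> W x = x"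
  by (induction W) (simp_all add: word_act_Cons)

lemma triv_iff_coord:
  "triv \<omega> W \<longleftrightarrow> even (count_list W La) \<and> (\<forall>i. triv (shift \<omega>) (coord (\<omega> 0) i W))"
proof
  assume *: "triv \<omega> W"
  have sub: "sub (i \<noteq> odd (count_list W La))
      (word_act (shift \<omega>) (coord (\<omega> 0) (i \<noteq> odd (count_list W La)) W) x) = sub i x" for i x
    by (subst word_act_sub[symmetric]) (use * in \<open>simp add: triv_def\<close>)
  have i: "(i \<noteq> odd (count_list W La)) = i" for i
    using sub[of i undefined] by (simp only: sub_inject)
  then have "word_act (shift \<omega>) (coord (\<omega> 0) i W) x = x" for i x
    using sub[of i x] by (simp only: sub_inject i)
  then show "even (count_list W La) \<and> (\<forall>i. triv (shift \<omega>) (coord (\<omega> 0) i W))"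
    using i unfolding triv_def by blast
next
  assume *: "even (count_list W La) \<and> (\<forall>i. triv (shift \<omega>) (coord (\<omega> 0) i W))"
  show "triv \<omega> W"
    unfolding triv_def
  proof
    fix x
    show "word_act \<omega> W x = x"
      using sub_cases[of x]
    proof
      assume "\<exists>i y. x = sub i y"
      then obtain i y where "x = sub i y" by blast
      then show ?thesis using * by (simp add: word_act_sub triv_def)
    qed (rule word_act_fixed)
  qed
qed

lemma triv_iff_component:
  "triv \<omega> W \<longleftrightarrow> even (count_list W La) \<and> (\<forall>i. triv (shift \<omega>) (component (\<omega> 0) i W))"
  unfolding triv_iff_coord[of \<omega> W] component_coord triv_reduce ..

lemma triv_Nil [simp]: "triv \<omega> []"
  by (simp add: triv_def)

lemma triv_odd: "odd (count_list W La) \<Longrightarrow> \<not> triv \<omega> W"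
  using triv_iff_coord by blast

lemma triv_letter: "y \<noteq> La \<Longrightarrow> triv \<omega> [y] \<longleftrightarrow> swap_symbols y \<inter> tail_symbols \<omega> F 0 = {}"
  using act_trivial[of y \<omega>] by (simp add: triv_def word_act_Cons)

text \<open>Each decomposition halves the bound on the length, so after \<open>N\<close> steps only
  words of length at most 1 are left, and \<open>act_trivial\<close> decides these. Every
  \<open>N\<close> that is large enough is allowed: this covers the larger number of steps in
  \<open>\<beta>\<close>, and all words of bounded length can be tested with a common
  \<open>N\<close>.\<close>

lemma triv_iff_decomposition_test:
  "reduced_word W \<Longrightarrow> length W \<le> 2 ^ N \<Longrightarrow>
     triv \<omega> W \<longleftrightarrow> decomposition_test (leaf_pos (tail_symbols \<omega> F N)) \<omega> N W"
proof (induction N arbitrary: \<omega> W)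
  case 0
  then have "length W \<le> 1" by simp
  then consider "W = []" | y where "W = [y]"
    by (cases W) auto
  then show ?case
  proof cases
    case (2 y)
    then show ?thesis
      using triv_odd[of "[La]" \<omega>] triv_letter[of y \<omega>] by (cases "y = La") (auto simp: leaf_pos_def)
  qed (simp add: leaf_pos_def)
next
  case (Suc N)
  have "triv (shift \<omega>) (component (\<omega> 0) i W) \<longleftrightarrow>
      decomposition_test (leaf_pos (tail_symbols (shift \<omega>) F N)) (shift \<omega>) N (component (\<omega> 0) i W)"
    for i
    by (rule Suc.IH) (simp add: component_def reduced_word_reduce, rule length_component[OF Suc.prems])
  then show ?case
    unfolding triv_iff_component[of \<omega> W] by (simp add: tail_symbols_shift)
qed

end

subsection \<open>The action on the binary tree\<close>

definition tree_act :: "oracle_seq \<Rightarrow> letter \<Rightarrow> bool list \<Rightarrow> bool list" where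
  "tree_act \<omega> y = (if y = La then root_swap else seq_aut (\<lambda>n. \<omega> n \<in> swap_symbols y))"

lemma seq_aut_seq_aut: "seq_aut p (seq_aut q w) = seq_aut (\<lambda>n. p n \<noteq> q n) w"
  by (induction q w arbitrary: p rule: seq_aut.induct) (auto simp: root_swap_twice)

lemma seq_aut_False: "seq_aut (\<lambda>n. False) w = w"
proof (induction w)
  case (Cons i w)
  then show ?case by (cases i) auto
qed simp

lemma seq_aut_replicate:
  "seq_aut p (replicate n True @ w) = replicate n True @ seq_aut (\<lambda>m. p (m + n)) w"
  by (induction n arbitrary: p) auto

lemma seq_aut_trivial: "(\<forall>w. seq_aut p w = w) \<longleftrightarrow> (\<forall>n. \<not> p n)"
proof
  assume *: "\<forall>w. seq_aut p w = w"
  show "\<forall>n. \<not> p n"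
  proof
    fix n
    \<comment> \<open>The second \<open>False\<close> is the step below the vertex with number
      \<open>n\<close>; it is flipped iff \<open>p n\<close> holds.\<close>
    have "seq_aut p (replicate n True @ [False, False]) = replicate n True @ [False, False]"
      using * by blast
    then show "\<not> p n" by (auto simp: seq_aut_replicate)
  qed
next
  assume "\<forall>n. \<not> p n"
  then have "p = (\<lambda>n. False)" by auto
  then show "\<forall>w. seq_aut p w = w" by (simp add: seq_aut_False)
qed

interpretation tree: self_similar "{}" tree_act Cons
proof
  fix \<omega> :: oracle_seq and x :: "bool list" and y z :: letter
  show "(\<exists>i y. x = i # y) \<or> (\<forall>\<omega> y. tree_act \<omega> y x = x)"
    by (cases x) (auto simp: tree_act_def)
  show "tree_act \<omega> y (True # x) = True # tree_act (shift \<omega>) y x" if "y \<noteq> La"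
    using that by (simp add: tree_act_def shift_def)
  show "tree_act \<omega> y (False # x) =
      False # (if \<omega> 0 \<in> swap_symbols y then tree_act (shift \<omega>) La x else x)" if "y \<noteq> La"
    using that by (simp add: tree_act_def)
  show "tree_act \<omega> y (tree_act \<omega> z x) = foldr (tree_act \<omega>) (E_prod y z) x"
    if "y \<noteq> La" "z \<noteq> La"
    using that swap_symbols_E_prod[OF that]
    by (cases y z rule: E_prod_cases) (simp_all add: tree_act_def seq_aut_seq_aut seq_aut_False)
  show "(\<forall>x. tree_act \<omega> y x = x) \<longleftrightarrow> swap_symbols y \<inter> tail_symbols \<omega> {} 0 = {}" if "y \<noteq> La"
    using that by (auto simp: tree_act_def seq_aut_trivial tail_symbols_def)
qed (auto simp: tree_act_def root_swap_twice)

lemma overgroup_gens_eq: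
  assumes "\<omega> \<in> Oracles"
  shows "overgroup_gens \<omega> y = tree_act \<omega> y"
proof -
  have *: "\<omega> n = 0 \<or> \<omega> n = 1 \<or> \<omega> n = 2" for n
    using assms by (auto simp: Oracles_def)
  have "(True \<noteq> (\<omega> n \<in> {0, 1})) = (\<omega> n \<in> {2})"
    "(True \<noteq> (\<omega> n \<in> {0, 2})) = (\<omega> n \<in> {1})"
    "(True \<noteq> (\<omega> n \<in> {1, 2})) = (\<omega> n \<in> {0})"
    "\<omega> n \<in> {0, 1, 2}" for n
    using *[of n] by (elim disjE; simp)+
  then show ?thesis
    by (cases y) (simp_all add: tree_act_def tree_aut_def comp_def seq_aut_seq_aut
        del: insert_iff singleton_iff)
qed

subsection \<open>The action on germs\<close>

text \<open>Points are infinite sequences with a decoration. The decoration records, at the fixed point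
  \<open>1\<^sup>\<infinity>\<close> of the letters other than \<open>a\<close>, the symbols of \<open>F\<close> as if they occurred at infinity in
  the oracle.\<close>

type_synonym germ = "(nat \<Rightarrow> bool) \<times> nat set"

definition germ_sub :: "bool \<Rightarrow> germ \<Rightarrow> germ" where
  "germ_sub i x = (case_nat i (fst x), snd x)"

text \<open>The decorations form an elementary abelian group under symmetric difference, and at the
  fixed point \<open>y\<close> translates by \<open>swap_symbols y \<inter> F\<close>, which is
  multiplicative in \<open>y\<close>. At all other points the decoration is merely carried along;
  there some entry is \<open>False\<close>, so that \<open>LEAST\<close> is meaningful.\<close>

definition germ_act :: "nat set \<Rightarrow> oracle_seq \<Rightarrow> letter \<Rightarrow> germ \<Rightarrow> germ" where
  "germ_act F \<omega> y x = (case x of (\<xi>, e) \<Rightarrow>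
     if y = La then (\<xi>(0 := \<not> \<xi> 0), e)
     else if \<forall>n. \<xi> n then (\<xi>, sym_diff e (swap_symbols y \<inter> F))
     else let n = (LEAST n. \<not> \<xi> n) in (\<xi>(Suc n := (\<xi> (Suc n) \<noteq> (\<omega> n \<in> swap_symbols y))), e))"

lemma germ_act_all: "y \<noteq> La \<Longrightarrow> \<forall>n. \<xi> n \<Longrightarrow>
    germ_act F \<omega> y (\<xi>, e) = (\<xi>, sym_diff e (swap_symbols y \<inter> F))"
  by (simp add: germ_act_def)

lemma germ_act_first:
  assumes "y \<noteq> La" "\<not> \<xi> n" "\<And>m. m < n \<Longrightarrow> \<xi> m"
  shows "germ_act F \<omega> y (\<xi>, e) = (\<xi>(Suc n := (\<xi> (Suc n) \<noteq> (\<omega> n \<in> swap_symbols y))), e)"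
proof -
  have "(LEAST n. \<not> \<xi> n) = n"
    using assms(2,3) by (intro Least_equality) (auto simp: not_le[symmetric])
  then show ?thesis using assms by (auto simp: germ_act_def Let_def)
qed

lemma first_False_cases:
  fixes \<xi> :: "nat \<Rightarrow> bool"
  obtains "\<forall>n. \<xi> n" | n where "\<not> \<xi> n" "\<And>m. m < n \<Longrightarrow> \<xi> m"
  using exists_least_iff[of "\<lambda>n. \<not> \<xi> n"] by blast

interpretation germ: self_similar F "germ_act F" germ_sub for F
proof
  fix \<omega> :: oracle_seq and x x' :: germ and y z :: letter and i j :: bool
  obtain \<xi> e where x: "x = (\<xi>, e)" by (cases x)
  have case_eq: "case_nat i f = case_nat j g \<longleftrightarrow> i = j \<and> f = g" for i j :: bool and f g
  proof
    assume eq: "case_nat i f = case_nat j g"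
    have "f n = g n" for n using fun_cong[OF eq, of "Suc n"] by simp
    then show "i = j \<and> f = g" using fun_cong[OF eq, of 0] by auto
  qed simp
  show "germ_sub i x = germ_sub j x' \<longleftrightarrow> i = j \<and> x = x'"
    by (cases x; cases x') (auto simp: germ_sub_def case_eq)
  have "\<xi> = case_nat (\<xi> 0) (\<lambda>n. \<xi> (Suc n))"
    by (auto simp: fun_eq_iff split: nat.splits)
  then show "(\<exists>i y. x = germ_sub i y) \<or> (\<forall>\<omega> y. germ_act F \<omega> y x = x)"
    unfolding x germ_sub_def by (metis fst_conv snd_conv)
  show "germ_act F \<omega> La (germ_sub i x) = germ_sub (\<not> i) x"
    by (auto simp: x germ_act_def germ_sub_def fun_eq_iff split: nat.splits)
  show "germ_act F \<omega> La (germ_act F \<omega> La x) = x"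
    by (auto simp: x germ_act_def)
  assume y: "y \<noteq> La"
  show "germ_act F \<omega> y (germ_sub True x) = germ_sub True (germ_act F (shift \<omega>) y x)"
  proof (cases \<xi> rule: first_False_cases)
    case 1
    then show ?thesis using y by (auto simp: x germ_sub_def germ_act_all split: nat.splits)
  next
    case (2 n)
    have "germ_act F \<omega> y (case_nat True \<xi>, e) = ((case_nat True \<xi>)(Suc (Suc n) :=
        (case_nat True \<xi> (Suc (Suc n)) \<noteq> (\<omega> (Suc n) \<in> swap_symbols y))), e)"
      by (rule germ_act_first) (use y 2 in \<open>auto split: nat.splits\<close>)
    then show ?thesis
      using germ_act_first[of y \<xi> n F "shift \<omega>" e] y
      by (auto simp: x germ_sub_def shift_def fun_eq_iff 2 split: nat.splits)
  qed
  have "germ_act F \<omega> y (case_nat False \<xi>, e) = ((case_nat False \<xi>)(Suc 0 :=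
      (case_nat False \<xi> (Suc 0) \<noteq> (\<omega> 0 \<in> swap_symbols y))), e)"
    by (rule germ_act_first) (use y in auto)
  then show "germ_act F \<omega> y (germ_sub False x) =
      germ_sub False (if \<omega> 0 \<in> swap_symbols y then germ_act F (shift \<omega>) La x else x)"
    by (auto simp: x germ_sub_def germ_act_def[of _ _ La] fun_eq_iff split: nat.splits)
  show "(\<forall>x. germ_act F \<omega> y x = x) \<longleftrightarrow> swap_symbols y \<inter> tail_symbols \<omega> F 0 = {}"
  proof
    assume *: "\<forall>x. germ_act F \<omega> y x = x"
    \<comment> \<open>The undecorated sequence of only \<open>True\<close> sees exactly the symbols
      of \<open>F\<close>.\<close>
    have "germ_act F \<omega> y (\<lambda>_. True, {}) = (\<lambda>_. True, {})"
      using * by blast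
    then have 1: "swap_symbols y \<inter> F = {}" using y by (simp add: germ_act_all)
    have "\<omega> n \<notin> swap_symbols y" for n
    proof -
      \<comment> \<open>The sequence with its only \<open>False\<close> at \<open>n\<close> sees
        exactly the symbol \<open>\<omega> n\<close>.\<close>
      have "germ_act F \<omega> y (\<lambda>m. m \<noteq> n, {}) = (\<lambda>m. m \<noteq> n, {})"
        using * by blast
      moreover have "germ_act F \<omega> y (\<lambda>m. m \<noteq> n, {}) =
          ((\<lambda>m. m \<noteq> n)(Suc n := ((Suc n \<noteq> n) \<noteq> (\<omega> n \<in> swap_symbols y))), {})"
        by (rule germ_act_first) (use y in auto)
      ultimately show ?thesis by (auto dest!: fun_cong[of _ _ "Suc n"])
    qed
    then show "swap_symbols y \<inter> tail_symbols \<omega> F 0 = {}"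
      using 1 by (auto simp: tail_symbols_def)
  next
    assume *: "swap_symbols y \<inter> tail_symbols \<omega> F 0 = {}"
    show "\<forall>x. germ_act F \<omega> y x = x"
    proof clarify
      fix \<xi> :: "nat \<Rightarrow> bool" and e
      show "germ_act F \<omega> y (\<xi>, e) = (\<xi>, e)"
      proof (cases \<xi> rule: first_False_cases)
        case 1
        moreover have "swap_symbols y \<inter> F = {}" using * by (auto simp: tail_symbols_def)
        ultimately show ?thesis using y by (simp add: germ_act_all)
      next
        case (2 n)
        moreover have "\<omega> n \<notin> swap_symbols y" using * by (auto simp: tail_symbols_def)
        ultimately show ?thesis using germ_act_first[of y \<xi> n F \<omega> e] y by simp
      qed
    qed
  qed
  assume z: "z \<noteq> La"
  show "germ_act F \<omega> y (germ_act F \<omega> z x) = foldr (germ_act F \<omega>) (E_prod y z) x"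
  proof (cases \<xi> rule: first_False_cases)
    case 1
    note [simp] = germ_act_all[OF _ 1]
    show ?thesis
      using y z swap_symbols_E_prod[OF y z]
      by (cases y z rule: E_prod_cases) (auto simp: x)
  next
    case (2 n)
    let ?\<eta> = "\<xi>(Suc n := (\<xi> (Suc n) \<noteq> (\<omega> n \<in> swap_symbols z)))"
    have "germ_act F \<omega> y (?\<eta>, e) =
        (?\<eta>(Suc n := (?\<eta> (Suc n) \<noteq> (\<omega> n \<in> swap_symbols y))), e)"
      by (rule germ_act_first) (use y 2 in auto)
    then have "germ_act F \<omega> y (germ_act F \<omega> z x) =
        (?\<eta>(Suc n := (?\<eta> (Suc n) \<noteq> (\<omega> n \<in> swap_symbols y))), e)"
      by (simp only: x germ_act_first[of z \<xi> n, OF z 2])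
    moreover have "germ_act F \<omega> v x = (\<xi>(Suc n := (\<xi> (Suc n) \<noteq> (\<omega> n \<in> swap_symbols v))), e)"
      if "v \<noteq> La" for v
      unfolding x by (rule germ_act_first[of v \<xi> n, OF that 2])
    ultimately show ?thesis
      using y z swap_symbols_E_prod[OF y z]
      by (cases y z rule: E_prod_cases) (auto simp: x fun_eq_iff)
  qed
qed

section \<open>Marked groups given by positive words\<close>

lemma word_val_Nil [simp]: "word_val G S [] = \<one>\<^bsub>G\<^esub>"
  by (simp add: word_val_def)

lemma word_val_Cons: "word_val G S (y # W) = S y \<otimes>\<^bsub>G\<^esub> word_val G S W"
  by (simp add: word_val_def)

lemma word_val_sval: "word_val G S W = sval G S (map (\<lambda>y. (y, True)) W)"
  by (induction W) (simp_all add: word_val_Cons sval_Cons gval_def)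

lemma word_val_closed: "is_marked G S \<Longrightarrow> word_val G S W \<in> carrier G"
  by (simp add: word_val_sval sval_closed)

lemma word_val_append:
  "is_marked G S \<Longrightarrow> word_val G S (U @ V) = word_val G S U \<otimes>\<^bsub>G\<^esub> word_val G S V"
  by (simp add: word_val_sval sval_append)

context
  fixes G :: "'g monoid" and S :: "letter \<Rightarrow> 'g"
  assumes marked: "is_marked G S" and contr: "simple_contractions G S"
begin

interpretation group G
  using marked by (simp add: is_marked_def)

lemma generator_self_inverse: "S y \<otimes>\<^bsub>G\<^esub> S y = \<one>\<^bsub>G\<^esub>"
  using contr by (cases "y = La") (simp_all add: simple_contractions_def E_prod_self)

lemma inv_generator: "inv\<^bsub>G\<^esub> S y = S y"
  using generator_self_inverse[of y] is_marked_in[OF marked, of y] inv_equality by blast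

lemma sval_word_val: "sval G S w = word_val G S (map fst w)"
  by (induction w) (simp_all add: sval_Cons word_val_Cons gval_def inv_generator)

lemma word_val_rev: "word_val G S (rev W) = inv\<^bsub>G\<^esub> word_val G S W"
  by (induction W)
    (simp_all add: word_val_append[OF marked] word_val_Cons inv_mult_group inv_generator
      is_marked_in[OF marked] word_val_closed[OF marked])

lemma word_val_reduce_Cons: "word_val G S (reduce_Cons y W) = S y \<otimes>\<^bsub>G\<^esub> word_val G S W"
proof (cases W)
  case (Cons z V)
  note [simp] = is_marked_in[OF marked] word_val_closed[OF marked]
  have "S y \<otimes>\<^bsub>G\<^esub> S z = word_val G S (E_prod y z)" if "y \<noteq> La" "z \<noteq> La"
    using that contr by (simp add: simple_contractions_def)
  then show ?thesis
    using Cons generator_self_inverse[of La]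
    by (auto simp: word_val_Cons word_val_append[OF marked] m_assoc[symmetric])
qed (simp add: word_val_Cons is_marked_in[OF marked])

lemma word_val_reduce: "word_val G S (reduce W) = word_val G S W"
proof (induction W)
  case (Cons y W)
  have "reduce (y # W) = reduce_Cons y (reduce W)" by (simp add: reduce_def)
  then show ?case using Cons by (simp add: word_val_reduce_Cons word_val_Cons)
qed (simp add: reduce_def)

lemma sval_eq_iff:
  "sval G S u = sval G S v \<longleftrightarrow> word_val G S (reduce (map fst (rev v @ u))) = \<one>\<^bsub>G\<^esub>"
proof -
  have "word_val G S (reduce (map fst (rev v @ u))) = inv\<^bsub>G\<^esub> sval G S v \<otimes>\<^bsub>G\<^esub> sval G S u"
    by (simp add: word_val_reduce word_val_append[OF marked] rev_map[symmetric] word_val_rev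
        sval_word_val)
  then show ?thesis
    using sval_closed[OF marked] by (metis inv_closed inv_equality inv_inv l_inv)
qed

end

lemma modified_overgroup_sval:
  assumes "modified_overgroup pos G S"
  shows "sval G S u = sval G S v \<longleftrightarrow> pos (reduce (map fst (rev v @ u)))"
  using assms sval_eq_iff[of G S u v] reduced_word_reduce by (simp add: modified_overgroup_def)

text \<open>A ball of radius \<open>n\<close> compares pairs of words of length at most
  \<open>n\<close>, and each pair gives one relator of length at most \<open>2 * n\<close>.\<close>

lemma modified_overgroup_same_ball:
  assumes G: "modified_overgroup pos G S" and H: "modified_overgroup pos' H T"
    and eq: "\<And>W. reduced_word W \<Longrightarrow> length W \<le> 2 * n \<Longrightarrow> pos W \<longleftrightarrow> pos' W"
  shows "same_ball G S H T n"
proof -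
  have "pos (reduce (map fst (rev v @ u))) \<longleftrightarrow> pos' (reduce (map fst (rev v @ u)))"
    if "length u \<le> n" "length v \<le> n" for u v :: "(letter \<times> bool) list"
    using that length_reduce[of "map fst (rev v @ u)"]
    by (intro eq reduced_word_reduce) simp
  moreover have "is_marked G S" "is_marked H T"
    using G H by (simp_all add: modified_overgroup_def)
  ultimately show ?thesis
    by (simp add: same_ball_iff modified_overgroup_sval[OF G] modified_overgroup_sval[OF H])
qed

lemma modified_overgroup_marking_eq_iff:
  assumes G: "modified_overgroup pos G S" and H: "modified_overgroup pos' H T"
  shows "marking G S = marking H T \<longleftrightarrow> (\<forall>W. reduced_word W \<longrightarrow> pos W = pos' W)"
proof -
  have marked: "is_marked G S" "is_marked H T"
    using G H by (simp_all add: modified_overgroup_def)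
  have "marking G S = marking H T \<longleftrightarrow>
      (\<forall>u v. sval G S u = sval G S v \<longleftrightarrow> sval H T u = sval H T v)"
    by (simp add: marking_eq_iff marked_iso_iff marked)
  also have "\<dots> \<longleftrightarrow> (\<forall>W. reduced_word W \<longrightarrow> pos W = pos' W)"
  proof
    assume *: "\<forall>u v. sval G S u = sval G S v \<longleftrightarrow> sval H T u = sval H T v"
    have "word_val G S W = word_val G S [] \<longleftrightarrow> word_val H T W = word_val H T []" for W
      unfolding word_val_sval using * by blast
    then show "\<forall>W. reduced_word W \<longrightarrow> pos W = pos' W"
      using G H by (simp add: modified_overgroup_def)
  qed (simp add: modified_overgroup_sval[OF G] modified_overgroup_sval[OF H] reduced_word_reduce)
  finally show ?thesis .
qed

text \<open>The sets of modified overgroups range over groups on natural numbers, whereas the groups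
  constructed here consist of maps. This transfers a construction to such a carrier.\<close>

lemma modified_overgroup_nat:
  assumes G: "modified_overgroup pos G S"
  obtains H :: "nat monoid" and T where "modified_overgroup pos H T" "marking H T = marking G S"
proof -
  have M: "is_marked G S" using G by (simp add: modified_overgroup_def)
  obtain H :: "nat monoid" and T where H: "is_marked H T" and iso: "marked_iso G S H T"
    using marked_repr_ex[OF M] by blast
  have eq: "word_val H T U = word_val H T V \<longleftrightarrow> word_val G S U = word_val G S V" for U V
    using iso by (simp add: word_val_sval marked_iso_iff[OF M H])
  have one: "word_val H T U = \<one>\<^bsub>H\<^esub> \<longleftrightarrow> word_val G S U = \<one>\<^bsub>G\<^esub>" for U
    using eq[of U "[]"] by simp
  interpret G: group G using M by (simp add: is_marked_def)
  interpret H: group H using H by (simp add: is_marked_def)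
  note in' = is_marked_in[OF M] is_marked_in[OF H]
  have contr: "simple_contractions G S" using G by (simp add: modified_overgroup_def)
  have "T La \<otimes>\<^bsub>H\<^esub> T La = \<one>\<^bsub>H\<^esub>"
    using contr one[of "[La, La]"] by (simp add: simple_contractions_def word_val_Cons in')
  moreover have "T y \<otimes>\<^bsub>H\<^esub> T z = word_val H T (E_prod y z)" if "y \<noteq> La" "z \<noteq> La" for y z
    using contr eq[of "[y, z]" "E_prod y z"] that
    by (simp add: simple_contractions_def word_val_Cons in')
  ultimately have "simple_contractions H T" by (simp add: simple_contractions_def)
  then have "modified_overgroup pos H T"
    using G H by (simp add: modified_overgroup_def one)
  moreover have "marking H T = marking G S"
    using iso by (simp add: marking_eq_iff H M marked_iso_iff)
  ultimately show thesis by (rule that)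
qed

subsection \<open>The marked group of an oracle with additional symbols at infinity\<close>

context self_similar
begin

text \<open>Inverses are given by reversed words. This group witnesses that the trivial words are
  the relators of some marked group.\<close>

definition act_group :: "oracle_seq \<Rightarrow> ('x \<Rightarrow> 'x) monoid" where
  "act_group \<omega> = \<lparr>carrier = range (word_act \<omega>), mult = (\<circ>), one = id\<rparr>"

lemma word_val_act_group: "word_val (act_group \<omega>) (act \<omega>) W = word_act \<omega> W"
proof (induction W)
  case (Cons y W)
  then show ?case by (simp add: word_val_Cons fun_eq_iff word_act_Cons act_group_def)
qed (simp add: act_group_def fun_eq_iff)

lemma group_act_group: "group (act_group \<omega>)"
proof (rule groupI)
  show "f \<otimes>\<^bsub>act_group \<omega>\<^esub> g \<in> carrier (act_group \<omega>)"
    if "f \<in> carrier (act_group \<omega>)" "g \<in> carrier (act_group \<omega>)" for f g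
  proof -
    obtain U V where "f = word_act \<omega> U" "g = word_act \<omega> V"
      using \<open>f \<in> _\<close> \<open>g \<in> _\<close> by (auto simp: act_group_def)
    then have "f \<circ> g = word_act \<omega> (U @ V)" by (auto simp: word_act_append)
    then show ?thesis by (simp add: act_group_def)
  qed
  have "id = word_act \<omega> []" by auto
  then show "\<one>\<^bsub>act_group \<omega>\<^esub> \<in> carrier (act_group \<omega>)" by (simp add: act_group_def)
  show "\<exists>g\<in>carrier (act_group \<omega>). g \<otimes>\<^bsub>act_group \<omega>\<^esub> f = \<one>\<^bsub>act_group \<omega>\<^esub>"
    if f: "f \<in> carrier (act_group \<omega>)" for f
  proof -
    obtain W where "f = word_act \<omega> W" using f by (auto simp: act_group_def)
    then have "word_act \<omega> (rev W) \<circ> f = id" by auto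
    then show ?thesis by (auto simp: act_group_def)
  qed
qed (auto simp: act_group_def comp_assoc)

lemma is_marked_act_group: "is_marked (act_group \<omega>) (act \<omega>)"
proof -
  interpret group "act_group \<omega>" by (rule group_act_group)
  have "act \<omega> y = word_act \<omega> [y]" for y by (auto simp: word_act_Cons)
  then have sub: "range (act \<omega>) \<subseteq> carrier (act_group \<omega>)" by (auto simp: act_group_def)
  have "word_act \<omega> W \<in> generate (act_group \<omega>) (range (act \<omega>))" for W
  proof (induction W)
    case Nil
    have "word_act \<omega> [] = \<one>\<^bsub>act_group \<omega>\<^esub>" by (auto simp: act_group_def)
    then show ?case using generate.one by metis
  next
    case (Cons y W)
    have "word_act \<omega> (y # W) = act \<omega> y \<otimes>\<^bsub>act_group \<omega>\<^esub> word_act \<omega> W"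
      by (auto simp: act_group_def word_act_Cons)
    then show ?case using Cons by (metis generate.eng generate.incl rangeI)
  qed
  then have "carrier (act_group \<omega>) \<subseteq> generate (act_group \<omega>) (range (act \<omega>))"
    by (auto simp: act_group_def)
  then show ?thesis
    using sub generate_incl[OF sub] group_act_group by (auto simp: is_marked_def)
qed

lemma simple_contractions_act_group: "simple_contractions (act_group \<omega>) (act \<omega>)"
proof -
  have "act \<omega> La \<circ> act \<omega> La = id" by auto
  moreover have "act \<omega> y \<circ> act \<omega> z = word_act \<omega> (E_prod y z)" if "y \<noteq> La" "z \<noteq> La" for y z
    using that by (auto simp: act_E_prod word_act_def)
  ultimately show ?thesis
    by (simp add: simple_contractions_def word_val_act_group) (simp add: act_group_def)
qed

lemma modified_overgroup_act_group: "modified_overgroup (triv \<omega>) (act_group \<omega>) (act \<omega>)"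
proof -
  have "word_act \<omega> W = \<one>\<^bsub>act_group \<omega>\<^esub> \<longleftrightarrow> triv \<omega> W" for W
    by (auto simp: act_group_def triv_def)
  then show ?thesis
    by (simp add: modified_overgroup_def is_marked_act_group simple_contractions_act_group
        word_val_act_group)
qed

end

definition germ_point :: "oracle_seq \<Rightarrow> nat set \<Rightarrow> letter marked" where
  "germ_point \<omega> F = marking (germ.act_group F \<omega>) (germ_act F \<omega>)"

text \<open>The test for words of length at most \<open>2 ^ N\<close> reads \<open>N\<close> symbols
  of the oracle and after that only the set of symbols in the tail. This is the source of
  continuity.\<close>

lemma germ_point_same_ball:
  assumes "\<And>n. n < N \<Longrightarrow> \<omega> n = \<omega>' n" "tail_symbols \<omega> F N = tail_symbols \<omega>' F' N"
    and "2 * n \<le> 2 ^ N"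
  shows "same_ball_at (germ_point \<omega> F) (germ_point \<omega>' F') n"
proof -
  note G = germ.modified_overgroup_act_group[of F \<omega>]
  note H = germ.modified_overgroup_act_group[of F' \<omega>']
  have "same_ball (germ.act_group F \<omega>) (germ_act F \<omega>) (germ.act_group F' \<omega>') (germ_act F' \<omega>') n"
  proof (rule modified_overgroup_same_ball[OF G H])
    fix W assume "reduced_word W" "length W \<le> 2 * n"
    moreover then have "length W \<le> 2 ^ N" using assms(3) by linarith
    ultimately show "germ.triv F \<omega> W \<longleftrightarrow> germ.triv F' \<omega>' W"
      using assms(1,2) decomposition_test_cong[of _ _ N \<omega> \<omega>']
      by (simp add: germ.triv_iff_decomposition_test)
  qed
  then show ?thesis
    unfolding germ_point_def by (simp add: same_ball_at_marking germ.is_marked_act_group)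
qed

lemma germ_point_eq_iff:
  "germ_point \<omega> F = germ_point \<omega>' F' \<longleftrightarrow>
    (\<forall>W. reduced_word W \<longrightarrow> germ.triv F \<omega> W = germ.triv F' \<omega>' W)"
  unfolding germ_point_def
  by (rule modified_overgroup_marking_eq_iff; rule germ.modified_overgroup_act_group)

lemma germ_point_eq_iff_triv:
  "germ_point \<omega> F = germ_point \<omega>' F' \<longleftrightarrow> (\<forall>W. germ.triv F \<omega> W = germ.triv F' \<omega>' W)"
  unfolding germ_point_eq_iff using germ.triv_reduce reduced_word_reduce by metis

lemma germ_point_cong:
  assumes "\<And>N. tail_symbols \<omega> F N = tail_symbols \<omega> F' N"
  shows "germ_point \<omega> F = germ_point \<omega> F'"
proof -
  have "same_ball_at (germ_point \<omega> F) (germ_point \<omega> F') n" for n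
    by (rule germ_point_same_ball[of "2 * n"]) (use assms in \<open>auto simp: less_imp_le\<close>)
  then show ?thesis using marked_eq_iff by blast
qed

lemma marking_eq_germ_point:
  assumes "modified_overgroup pos G S"
    and "\<And>W. reduced_word W \<Longrightarrow> pos W \<longleftrightarrow> germ.triv F \<omega> W"
  shows "marking G S = germ_point \<omega> F"
  unfolding germ_point_def
  using assms modified_overgroup_marking_eq_iff[OF assms(1) germ.modified_overgroup_act_group]
  by blast

subsection \<open>The three kinds of overgroups\<close>

lemma tree_modified_overgroup:
  assumes "\<omega> \<in> Oracles"
  shows "modified_overgroup (tree.triv \<omega>) (overgroup \<omega>) (overgroup_gens \<omega>)"
proof -
  have gens: "overgroup_gens \<omega> = tree_act \<omega>" using overgroup_gens_eq[OF assms] by auto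
  have val: "word_val (overgroup \<omega>) (tree_act \<omega>) W = tree.word_act \<omega> W" for W
  proof (induction W)
    case (Cons y W)
    then show ?case
      by (simp add: word_val_Cons fun_eq_iff tree.word_act_Cons overgroup_def tree_aut_def)
  qed (simp add: overgroup_def tree_aut_def fun_eq_iff)
  have "simple_contractions (overgroup \<omega>) (tree_act \<omega>)"
  proof -
    have "tree_act \<omega> La \<circ> tree_act \<omega> La = id" by auto
    moreover have "tree_act \<omega> y \<circ> tree_act \<omega> z = tree.word_act \<omega> (E_prod y z)"
      if "y \<noteq> La" "z \<noteq> La" for y z
      using that by (auto simp: tree.act_E_prod tree.word_act_def)
    ultimately show ?thesis
      by (simp add: simple_contractions_def val) (simp add: overgroup_def tree_aut_def)
  qed
  moreover have "tree.word_act \<omega> W = \<one>\<^bsub>overgroup \<omega>\<^esub> \<longleftrightarrow> tree.triv \<omega> W" for W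
    by (auto simp: overgroup_def tree_aut_def tree.triv_def)
  ultimately show ?thesis
    using is_marked_overgroup[of \<omega>] by (simp add: modified_overgroup_def gens val)
qed

text \<open>Both actions have \<open>F\<close> empty, hence the same decomposition tests decide
  their trivial words, and the marked groups agree because their relators do.\<close>

lemma overgroup_eq_germ_point:
  assumes "\<omega> \<in> Oracles"
  shows "marking (overgroup \<omega>) (overgroup_gens \<omega>) = germ_point \<omega> {}"
  by (rule marking_eq_germ_point[OF tree_modified_overgroup[OF assms]])
    (simp add: tree.triv_iff_decomposition_test[OF _ length_le_log_length]
      germ.triv_iff_decomposition_test[OF _ length_le_log_length])

lemma overgroup_points_eq:
  "A \<subseteq> Oracles \<Longrightarrow> overgroup_points A = (\<lambda>\<omega>. germ_point \<omega> {}) ` A"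
  unfolding overgroup_points_def by (rule image_cong) (auto simp: overgroup_eq_germ_point)

lemma swap_symbols_nonempty:
  "y \<noteq> La \<Longrightarrow> swap_symbols y \<noteq> {} \<and> swap_symbols y \<subseteq> {0, 1, 2}"
  by (cases y) auto

text \<open>Every letter other than \<open>a\<close> swaps at some symbol, so as long as all three
  symbols remain the empty word is the only trivial leaf.\<close>

lemma alpha_iff_triv:
  assumes "\<omega> \<in> Oracles" "reduced_word W"
  shows "alpha \<omega> W \<longleftrightarrow> germ.triv {0, 1, 2} \<omega> W"
proof -
  have "leaf_pos {0, 1, 2} V \<longleftrightarrow> V = []" for V
    using swap_symbols_nonempty by (auto simp: leaf_pos_def)
  then show ?thesis
    unfolding alpha_def using assms tail_symbols_full[OF assms(1)]
      decomposition_test_cong[of "leaf_pos {0, 1, 2}" "\<lambda>V. V = []" "log_length W" \<omega> \<omega> W]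
    by (cases "W = []") (simp_all add: germ.triv_iff_decomposition_test[OF _ length_le_log_length])
qed

text \<open>If \<open>k\<close> is the third symbol, \<open>e_letter i j\<close> is the one letter
  that swaps at \<open>k\<close> only.\<close>

lemma leaf_pos_pair:
  assumes "{i, j, k} = {0, 1, 2}"
  shows "leaf_pos {i, j} V \<longleftrightarrow> V = [] \<or> V = [e_letter i j]"
proof -
  have "y \<noteq> La \<and> swap_symbols y \<inter> {i, j} = {} \<longleftrightarrow> y = e_letter i j" for y
  proof -
    have "{i, j} \<subseteq> {i, j, k}" by auto
    then have ijk: "i \<in> {0, 1, 2}" "j \<in> {0, 1, 2}" unfolding assms by auto
    have "card {i, j, k} = 3" unfolding assms by simp
    then have "i \<noteq> j" by (auto simp: card_insert_if split: if_splits)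
    then have "i = 0 \<and> j = 1 \<or> i = 1 \<and> j = 0 \<or> i = 1 \<and> j = 2 \<or> i = 2 \<and> j = 1 \<or>
        i = 0 \<and> j = 2 \<or> i = 2 \<and> j = 0"
      using ijk by auto
    then show ?thesis
      by (elim disjE conjE; cases y; simp add: e_letter_def doubleton_eq_iff)
  qed
  then show ?thesis by (auto simp: leaf_pos_def)
qed

text \<open>Positions start at 0 here, so \<open>last_index \<omega> k\<close>, one more than the
  last position of \<open>k\<close>, is already the first position beyond it.\<close>

lemma tail_symbols_last_index:
  assumes "\<omega> \<in> Oracles" "{i, j, k} = {0, 1, 2}" "finite {n. \<omega> n = k}" "N \<ge> last_index \<omega> k"
  shows "tail_symbols \<omega> {i, j} N = {i, j}"
proof -
  have "\<omega> n \<in> {i, j}" if "n \<ge> N" for n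
  proof -
    have "\<omega> n \<noteq> k"
    proof
      assume n: "\<omega> n = k"
      obtain b where "\<forall>m\<in>{n. \<omega> n = k}. m \<le> b"
        using assms(3) finite_nat_set_iff_bounded_le by blast
      then have "n \<le> (GREATEST n. \<omega> n = k)"
        using n Greatest_le_nat[of "\<lambda>n. \<omega> n = k" n b] by blast
      moreover have "last_index \<omega> k = Suc (GREATEST n. \<omega> n = k)"
        using n by (auto simp: last_index_def)
      ultimately show False using that assms(4) by linarith
    qed
    moreover have "\<omega> n \<in> {i, j, k}" using assms(1,2) by (simp add: Oracles_def)
    ultimately show ?thesis by auto
  qed
  then show ?thesis by (auto simp: tail_symbols_def)
qed

text \<open>The additional steps up to \<open>last_index\<close> ensure that the set of remaining
  symbols is exactly \<open>{i, j}\<close>.\<close>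

lemma beta_iff_triv:
  assumes "\<omega> \<in> Oracles" "reduced_word W" "{i, j, k} = {0, 1, 2}" "finite {n. \<omega> n = k}"
  shows "beta i j k \<omega> W \<longleftrightarrow> germ.triv {i, j} \<omega> W"
proof -
  let ?N = "max (last_index \<omega> k) (log_length W)"
  have "length W \<le> 2 ^ ?N"
    using length_le_log_length[of W] power_increasing[of "log_length W" ?N "2::nat"] by linarith
  then have "germ.triv {i, j} \<omega> W \<longleftrightarrow> decomposition_test (leaf_pos {i, j}) \<omega> ?N W"
    using assms tail_symbols_last_index[OF assms(1,3,4), of ?N]
    by (simp add: germ.triv_iff_decomposition_test[of W ?N])
  then show ?thesis
    unfolding beta_def
    by (cases "W = []")
      (simp_all add: decomposition_test_cong[OF leaf_pos_pair[OF assms(3)], of ?N \<omega> \<omega>])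
qed

lemma alpha_points_eq:
  assumes "A \<subseteq> Oracles"
  shows "alpha_points A = (\<lambda>\<omega>. germ_point \<omega> {0, 1, 2}) ` A"
proof (intro equalityI subsetI)
  fix p assume "p \<in> alpha_points A"
  then obtain G :: "nat monoid" and S \<omega> where
    p: "\<omega> \<in> A" "modified_overgroup (alpha \<omega>) G S" "p = marking G S"
    by (auto simp: alpha_points_def)
  have "p = germ_point \<omega> {0, 1, 2}"
    unfolding p(3)
    by (rule marking_eq_germ_point[OF p(2)], rule alpha_iff_triv) (use p assms in auto)
  then show "p \<in> (\<lambda>\<omega>. germ_point \<omega> {0, 1, 2}) ` A" using p by blast
next
  fix p assume "p \<in> (\<lambda>\<omega>. germ_point \<omega> {0, 1, 2}) ` A"
  then obtain \<omega> where \<omega>: "\<omega> \<in> A" "p = germ_point \<omega> {0, 1, 2}" by blast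
  obtain H :: "nat monoid" and T where
    H: "modified_overgroup (germ.triv {0, 1, 2} \<omega>) H T" "p = marking H T"
    using modified_overgroup_nat[OF germ.modified_overgroup_act_group[of "{0, 1, 2}" \<omega>]] \<omega>(2)
    unfolding germ_point_def by metis
  moreover have "\<omega> \<in> Oracles" using \<omega>(1) assms by blast
  ultimately have "modified_overgroup (alpha \<omega>) H T"
    by (simp add: modified_overgroup_def alpha_iff_triv)
  then show "p \<in> alpha_points A" using \<omega>(1) H(2) unfolding alpha_points_def by blast
qed

lemma beta_points_eq:
  assumes "A \<subseteq> Oracles"
  shows "beta_points A = {germ_point \<omega> {i, j} | \<omega> i j k.
    \<omega> \<in> A \<and> {i, j, k} = {0, 1, 2} \<and> finite {n. \<omega> n = k}}"
proof (intro equalityI subsetI)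
  fix p assume "p \<in> beta_points A"
  then obtain G :: "nat monoid" and S \<omega> i j k where
    p: "\<omega> \<in> A" "{i, j, k} = {0, 1, 2}" "finite {n. \<omega> n = k}"
      "modified_overgroup (beta i j k \<omega>) G S" "p = marking G S"
    unfolding beta_points_def by blast
  have "p = germ_point \<omega> {i, j}"
    unfolding p(5)
    by (rule marking_eq_germ_point[OF p(4)], rule beta_iff_triv) (use p assms in auto)
  then show "p \<in> {germ_point \<omega> {i, j} | \<omega> i j k.
    \<omega> \<in> A \<and> {i, j, k} = {0, 1, 2} \<and> finite {n. \<omega> n = k}}" using p by blast
next
  fix p assume "p \<in> {germ_point \<omega> {i, j} | \<omega> i j k.
    \<omega> \<in> A \<and> {i, j, k} = {0, 1, 2} \<and> finite {n. \<omega> n = k}}"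
  then obtain \<omega> i j k where
    \<omega>: "\<omega> \<in> A" "{i, j, k} = {0, 1, 2}" "finite {n. \<omega> n = k}" "p = germ_point \<omega> {i, j}" by blast
  obtain H :: "nat monoid" and T where
    H: "modified_overgroup (germ.triv {i, j} \<omega>) H T" "p = marking H T"
    using modified_overgroup_nat[OF germ.modified_overgroup_act_group[of "{i, j}" \<omega>]] \<omega>(4)
    unfolding germ_point_def by metis
  have "beta i j k \<omega> W \<longleftrightarrow> germ.triv {i, j} \<omega> W" if "reduced_word W" for W
    using \<omega> assms that by (intro beta_iff_triv) auto
  then have "modified_overgroup (beta i j k \<omega>) H T"
    using H(1) by (simp add: modified_overgroup_def)
  then show "p \<in> beta_points A" using \<omega> H unfolding beta_points_def by blast
qed

section \<open>Recovering the oracle from double commutators\<close>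

text \<open>The letters are involutions, so \<open>rev\<close> gives inverses and this is the
  commutator.\<close>

definition comm_word :: "letter list \<Rightarrow> letter list \<Rightarrow> letter list" where
  "comm_word U V = U @ V @ rev U @ rev V"

text \<open>A word with coordinate \<open>V\<close> on the side \<open>j\<close>, if \<open>u\<close> is a letter whose coordinates
  are \<open>a\<close> and \<open>u\<close>.\<close>

definition lift_word :: "letter \<Rightarrow> bool \<Rightarrow> letter list \<Rightarrow> letter list" where
  "lift_word u j V = concat (map (\<lambda>y.
     if (y = La) = j then [La, if y = La then u else y, La] else [if y = La then u else y]) V)"

lemma lift_word_simps [simp]:
  "lift_word u j [] = []"
  "lift_word u j (y # V) =
     (if (y = La) = j then [La, if y = La then u else y, La] else [if y = La then u else y])
     @ lift_word u j V"
  by (simp_all add: lift_word_def)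

lemma lift_word_append [simp]: "lift_word u j (U @ V) = lift_word u j U @ lift_word u j V"
  by (induction U) simp_all

lemma lift_word_rev [simp]: "lift_word u j (rev V) = rev (lift_word u j V)"
  by (induction V) simp_all

lemma lift_word_comm_word:
  "lift_word u j (comm_word U V) = comm_word (lift_word u j U) (lift_word u j V)"
  by (simp add: comm_word_def)

lemma even_comm_word: "even (count_list (comm_word U V) y)"
  by (cases "even (count_list U y)"; cases "even (count_list V y)") (simp_all add: comm_word_def)

lemma even_lift_word: "u \<noteq> La \<Longrightarrow> even (count_list (lift_word u j V) La)"
  by (induction V) auto

lemma coord_comm_word:
  "even (count_list U La) \<Longrightarrow> even (count_list V La) \<Longrightarrow>
    coord s i (comm_word U V) = comm_word (coord s i U) (coord s i V)"
  by (simp add: comm_word_def coord_append coord_rev)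

text \<open>Every \<open>a\<close> of \<open>V\<close> becomes a letter \<open>u\<close> placed so
  that its coordinate on the side \<open>j\<close> is \<open>a\<close>, and every other letter is
  placed so that this coordinate is the letter itself; conjugation by \<open>a\<close> changes
  sides.\<close>

lemma coord_lift_word_same:
  assumes "u \<noteq> La" "s \<in> swap_symbols u"
  shows "coord s j (lift_word u j V) = V"
proof (induction V)
  case (Cons y V)
  then show ?case using assms by (cases "y = La"; cases j) (auto simp: p_word_def)
qed simp

text \<open>At the symbol \<open>s\<close> its coordinates are \<open>a\<close> and the letter
  itself; at the other symbols the first one is empty. It serves both for lifting and for testing
  whether \<open>s\<close> still occurs.\<close>

definition sing_letter :: "nat \<Rightarrow> letter" where
  "sing_letter s = (if s = 0 then Ldt else if s = 1 then Lct else Lbt)"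

definition co_sing_letter :: "nat \<Rightarrow> letter" where
  "co_sing_letter s = (if s = 0 then Ld else if s = 1 then Lc else Lb)"

lemma sing_letter:
  "s \<in> {0, 1, 2} \<Longrightarrow> sing_letter s \<noteq> La \<and> swap_symbols (sing_letter s) = {s}"
  by (auto simp: sing_letter_def)

lemma co_sing_letter:
  "s \<in> {0, 1, 2} \<Longrightarrow> co_sing_letter s \<noteq> La \<and> swap_symbols (co_sing_letter s) = {0, 1, 2} - {s}"
  by (auto simp: co_sing_letter_def)

lemma sing_letter_oracle:
  assumes "\<omega> \<in> Oracles"
  shows "sing_letter (\<omega> n) \<noteq> La" "swap_symbols (sing_letter (\<omega> n)) = {\<omega> n}"
proof -
  have "\<omega> n \<in> {0, 1, 2}" using assms unfolding Oracles_def by blast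
  then show "sing_letter (\<omega> n) \<noteq> La" "swap_symbols (sing_letter (\<omega> n)) = {\<omega> n}"
    using sing_letter by blast+
qed

section \<open>Commutators under decomposition\<close>

context self_similar
begin

lemma triv_comm_word:
  "triv \<omega> (comm_word U V) \<longleftrightarrow>
    (\<forall>x. word_act \<omega> U (word_act \<omega> V x) = word_act \<omega> V (word_act \<omega> U x))"
proof
  assume *: "triv \<omega> (comm_word U V)"
  show "\<forall>x. word_act \<omega> U (word_act \<omega> V x) = word_act \<omega> V (word_act \<omega> U x)"
  proof
    fix x
    have "word_act \<omega> (comm_word U V) (word_act \<omega> V (word_act \<omega> U x)) = word_act \<omega> V (word_act \<omega> U x)"
      using * by (simp add: triv_def)
    then show "word_act \<omega> U (word_act \<omega> V x) = word_act \<omega> V (word_act \<omega> U x)"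
      by (simp add: comm_word_def word_act_append)
  qed
next
  assume *: "\<forall>x. word_act \<omega> U (word_act \<omega> V x) = word_act \<omega> V (word_act \<omega> U x)"
  show "triv \<omega> (comm_word U V)"
    unfolding triv_def
  proof
    fix x
    show "word_act \<omega> (comm_word U V) x = x"
      using *[rule_format, of "word_act \<omega> (rev U) (word_act \<omega> (rev V) x)"]
      by (simp add: comm_word_def word_act_append)
  qed
qed

lemma triv_comm_word_left: "triv \<omega> U \<Longrightarrow> triv \<omega> (comm_word U V)"
  unfolding triv_comm_word by (simp add: triv_def)

text \<open>A group generated by two involutions is metabelian, as its words of even length are powers
  of the product of the two generators.\<close>

lemma even_dihedral_words_commute:
  assumes "set U \<subseteq> {y, z}" "set V \<subseteq> {y, z}" "even (length U)" "even (length V)"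
  shows "word_act \<omega> U (word_act \<omega> V x) = word_act \<omega> V (word_act \<omega> U x)"
proof -
  have pairs: "word_act \<omega> [p, q] (word_act \<omega> [p', q'] x) = word_act \<omega> [p', q'] (word_act \<omega> [p, q] x)"
    if "p \<in> {y, z}" "q \<in> {y, z}" "p' \<in> {y, z}" "q' \<in> {y, z}" for p q p' q' x
    using that by (auto simp: word_act_Cons)
  have pair_word: "word_act \<omega> [p, q] (word_act \<omega> W x) = word_act \<omega> W (word_act \<omega> [p, q] x)"
    if "p \<in> {y, z}" "q \<in> {y, z}" "set W \<subseteq> {y, z}" "even (length W)" for p q W x
    using that(3,4)
  proof (induction W arbitrary: x rule: induct_list012)
    case (3 p' q' W)
    have *: "word_act \<omega> (p' # q' # W) x = word_act \<omega> [p', q'] (word_act \<omega> W x)" for x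
      by (simp add: word_act_Cons)
    have "p' \<in> {y, z}" "q' \<in> {y, z}" using 3 by auto
    then show ?case
      unfolding * using 3 pairs[OF that(1,2)] by simp
  qed auto
  show ?thesis
    using assms(1,3)
  proof (induction U arbitrary: x rule: induct_list012)
    case (3 p q U)
    have *: "word_act \<omega> (p # q # U) x = word_act \<omega> [p, q] (word_act \<omega> U x)" for x
      by (simp add: word_act_Cons)
    have "p \<in> {y, z}" "q \<in> {y, z}" using 3 by auto
    then show ?case
      unfolding * using 3 pair_word[OF _ _ assms(2,4)] by simp
  qed auto
qed

text \<open>A commutator has even length, and words of even length in two involutions commute with
  each other.\<close>

lemma triv_dihedral_double_commutator:
  assumes "set (p @ q @ r @ t) \<subseteq> {y, z}"
  shows "triv \<omega> (comm_word (comm_word p q) (comm_word r t))"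
  unfolding triv_comm_word
  by (intro allI even_dihedral_words_commute[of _ y z]) (use assms in \<open>auto simp: comm_word_def\<close>)

lemma set_coord_lift_word:
  assumes "u \<noteq> La"
  shows "set (coord s (\<not> j) (lift_word u j V)) \<subseteq> {La, u}"
proof (induction V)
  case (Cons y V)
  then show ?case using assms by (cases "y = La"; cases j) (auto simp: p_word_def)
qed simp

lemma triv_lift_double_commutator:
  assumes u: "u \<noteq> La" "\<omega> 0 \<in> swap_symbols u"
  shows "triv \<omega> (lift_word u j (comm_word (comm_word p q) (comm_word r t))) \<longleftrightarrow>
    triv (shift \<omega>) (comm_word (comm_word p q) (comm_word r t))"
proof -
  let ?L = "lift_word u j" and ?C = "\<lambda>V. coord (\<omega> 0) (\<not> j) (lift_word u j V)"
  let ?D = "comm_word (comm_word p q) (comm_word r t)"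
  \<comment> \<open>Lifts contain an even number of letters \<open>a\<close>, so taking a coordinate
    commutes with forming commutators.\<close>
  have "coord (\<omega> 0) (\<not> j) (?L ?D) = comm_word (comm_word (?C p) (?C q)) (comm_word (?C r) (?C t))"
    using even_lift_word[OF u(1)]
    by (simp only: lift_word_comm_word coord_comm_word even_comm_word)
  moreover have "triv (shift \<omega>) (comm_word (comm_word (?C p) (?C q)) (comm_word (?C r) (?C t)))"
    by (rule triv_dihedral_double_commutator[of _ _ _ _ La u])
      (use set_coord_lift_word[OF u(1)] in auto)
  ultimately have "triv (shift \<omega>) (coord (\<omega> 0) (\<not> j) (?L ?D))" by simp
  moreover have "coord (\<omega> 0) j (?L ?D) = ?D"
    by (rule coord_lift_word_same[OF u])
  moreover have "(\<forall>i. Q i) \<longleftrightarrow> Q j \<and> Q (\<not> j)" for Q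
    by (cases j) (auto simp: all_bool_eq)
  ultimately show ?thesis
    unfolding triv_iff_coord[of \<omega> "?L ?D"] using even_lift_word[OF u(1), of j ?D] by simp
qed

text \<open>The coordinates are \<open>y p\<close> and \<open>p y\<close>, where \<open>p\<close> is
  \<open>a\<close> or empty. If \<open>p\<close> is \<open>a\<close> they are odd and hence
  nontrivial; otherwise both are \<open>y\<close>, relative to the shifted oracle.\<close>

lemma triv_letter_La_twice:
  assumes "y \<noteq> La"
  shows "triv \<omega> [La, y, La, y] \<longleftrightarrow> triv \<omega> [y]"
proof -
  have "triv \<omega> [La, y, La, y] \<longleftrightarrow>
      triv (shift \<omega>) (y # p_word (\<omega> 0) y) \<and> triv (shift \<omega>) (p_word (\<omega> 0) y @ [y])"
    unfolding triv_iff_coord[of \<omega>] using assms by (auto simp: all_bool_eq)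
  also have "\<dots> \<longleftrightarrow> \<omega> 0 \<notin> swap_symbols y \<and> triv (shift \<omega>) [y]"
    using triv_odd[of "[y, La]" "shift \<omega>"] assms by (auto simp: p_word_def)
  also have "\<dots> \<longleftrightarrow> triv \<omega> [y]"
    using assms by (auto simp: triv_letter tail_symbols_0[of \<omega>])
  finally show ?thesis .
qed

lemma triv_letter_La_twice':
  assumes "y \<noteq> La"
  shows "triv \<omega> [y, La, y, La] \<longleftrightarrow> triv \<omega> [y]"
proof -
  have "triv \<omega> [y, La, y, La] \<longleftrightarrow> triv \<omega> [La, y, La, y]"
  proof -
    have "(\<forall>x. f (g (f (g x))) = x) \<longleftrightarrow> (\<forall>x. g (f (g (f x))) = x)"
      if "\<And>x. f (f x) = x" "\<And>x. g (g x) = x" for f g :: "'x \<Rightarrow> 'x"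
      using that by metis
    then show ?thesis by (simp add: triv_def word_act_Cons)
  qed
  then show ?thesis using triv_letter_La_twice[OF assms] by simp
qed

text \<open>An odd word exchanges the two halves, so it does not commute with an element acting
  trivially on one half and nontrivially on the other. The commutator \<open>K\<close> is such an
  element: as \<open>t \<noteq> \<omega> 0\<close>, the letter \<open>y\<close> has an empty
  coordinate, which leaves \<open>u u\<close> on one side, while the other side carries
  \<open>(a y)^2\<close>, nontrivial because \<open>t\<close> still occurs later.\<close>

lemma odd_not_centralizing:
  assumes odd: "odd (count_list V La)" and \<omega>: "\<omega> \<in> Oracles"
    and t: "t \<in> tail_symbols \<omega> F (Suc 0)" "t \<noteq> \<omega> 0" "t \<in> {0, 1, 2}"
  shows "\<exists>g h. \<not> triv \<omega> (comm_word V (comm_word g h))"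
proof -
  define u y where "u = sing_letter (\<omega> 0)" and "y = sing_letter t"
  have u: "u \<noteq> La" "swap_symbols u = {\<omega> 0}"
    using sing_letter_oracle[OF \<omega>] by (simp_all add: u_def)
  have y: "y \<noteq> La" "swap_symbols y = {t}" using sing_letter[OF t(3)] by (simp_all add: y_def)
  define K where "K = comm_word [u] [La, y, La]"
  have K: "count_list K La = 4" "coord (\<omega> 0) False K = [La, y, La, y]" "coord (\<omega> 0) True K = [u, u]"
    using u y t by (simp_all add: K_def comm_word_def p_word_def)
  have "\<not> triv (shift \<omega>) [La, y, La, y]"
    using y t(1) by (simp add: triv_letter_La_twice triv_letter tail_symbols_shift)
  then obtain x where x: "word_act (shift \<omega>) [La, y, La, y] x \<noteq> x"
    by (auto simp: triv_def)
  let ?C = "coord (\<omega> 0) False V"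
  \<comment> \<open>Chosen so that \<open>V\<close> takes the point of the half \<open>True\<close>
    over \<open>x'\<close> to the point of the half \<open>False\<close> over \<open>x\<close>,
    which \<open>K\<close> moves.\<close>
  define x' where "x' = word_act (shift \<omega>) (rev ?C) x"
  have V: "word_act \<omega> V (sub True x') = sub False x"
    using odd by (simp add: word_act_sub x'_def)
  have "word_act \<omega> K (sub True x') = sub True x'"
    using K by (simp add: word_act_sub word_act_Cons)
  moreover have "word_act \<omega> K (sub False x) \<noteq> sub False x"
    using K x by (simp add: word_act_sub sub_inject)
  ultimately have "\<not> triv \<omega> (comm_word V K)"
    unfolding triv_comm_word using V by metis
  then show ?thesis unfolding K_def by blast
qed

text \<open>One nontrivial coordinate suffices: lifting \<open>g\<close> and \<open>h\<close> to the
  side \<open>i\<close> reproduces the given commutator there, whatever happens on the other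
  side.\<close>

lemma lift_not_centralizing:
  assumes \<omega>: "\<omega> \<in> Oracles" and even: "even (count_list V La)"
    and *: "\<not> triv (shift \<omega>) (comm_word (coord (\<omega> 0) i V) (comm_word g h))"
  shows "\<exists>g h. \<not> triv \<omega> (comm_word V (comm_word g h))"
proof -
  define u where "u = sing_letter (\<omega> 0)"
  have u: "u \<noteq> La" "\<omega> 0 \<in> swap_symbols u"
    using sing_letter_oracle[OF \<omega>] by (simp_all add: u_def)
  let ?K = "comm_word (lift_word u i g) (lift_word u i h)"
  have "coord (\<omega> 0) i (comm_word V ?K) = comm_word (coord (\<omega> 0) i V) (comm_word g h)"
    using even u by (simp add: coord_comm_word even_comm_word even_lift_word coord_lift_word_same)
  then have "\<not> triv \<omega> (comm_word V ?K)"
    using * triv_iff_coord[of \<omega> "comm_word V ?K"] by metis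
  then show ?thesis by blast
qed

end

text \<open>At least two symbols remain in every tail. In this form a symbol different from a given
  one, such as the current symbol of the oracle, can be chosen directly.\<close>

definition nondegenerate :: "oracle_seq \<Rightarrow> nat set \<Rightarrow> bool" where
  "nondegenerate \<omega> F \<longleftrightarrow> \<omega> \<in> Oracles \<and> F \<subseteq> {0, 1, 2} \<and> (\<forall>N s. \<exists>t\<in>tail_symbols \<omega> F N. t \<noteq> s)"

lemma nondegenerate_shift: "nondegenerate \<omega> F \<Longrightarrow> nondegenerate (shift \<omega>) F"
  by (simp add: nondegenerate_def shift_in_Oracles tail_symbols_shift)

context self_similar
begin

lemma odd_not_centralizing_nondegenerate:
  assumes "nondegenerate \<omega> F" "odd (count_list V La)"
  shows "\<exists>g h. \<not> triv \<omega> (comm_word V (comm_word g h))"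
proof -
  have \<omega>: "\<omega> \<in> Oracles" "F \<subseteq> {0, 1, 2}" using assms by (simp_all add: nondegenerate_def)
  obtain t where "t \<in> tail_symbols \<omega> F (Suc 0)" "t \<noteq> \<omega> 0"
    using assms unfolding nondegenerate_def by blast
  then show ?thesis
    using odd_not_centralizing[OF assms(2) \<omega>(1)] tail_symbols_subset[OF \<omega>] by blast
qed

text \<open>If \<open>y\<close> becomes trivial after one step, its other coordinate is
  \<open>a\<close>, and the odd case can be lifted. Otherwise the commutator of \<open>a\<close> and
  \<open>u\<close> is used, where \<open>u\<close> has coordinate \<open>a\<close> at the first
  symbol: since \<open>u\<close> and \<open>y\<close> commute, the second coordinate amounts to
  \<open>(y a)^2\<close>, which is nontrivial together with \<open>y\<close>.\<close>

lemma letter_not_centralizing: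
  assumes nd: "nondegenerate \<omega> F" and y: "y \<noteq> La" "\<not> triv \<omega> [y]"
  shows "\<exists>g h. \<not> triv \<omega> (comm_word [y] (comm_word g h))"
proof -
  have \<omega>: "\<omega> \<in> Oracles" using nd by (simp add: nondegenerate_def)
  show ?thesis
  proof (cases "triv (shift \<omega>) [y]")
    case True
    then have "\<omega> 0 \<in> swap_symbols y"
      using y by (auto simp: triv_letter tail_symbols_0[of \<omega>])
    then have "coord (\<omega> 0) False [y] = [La]" using y by (simp add: p_word_def)
    moreover obtain g h where "\<not> triv (shift \<omega>) (comm_word [La] (comm_word g h))"
      using odd_not_centralizing_nondegenerate[OF nondegenerate_shift[OF nd], of "[La]"] by auto
    ultimately show ?thesis
      using lift_not_centralizing[OF \<omega>, of "[y]" False g h] y by simp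
  next
    case False
    define u where "u = sing_letter (\<omega> 0)"
    have u: "u \<noteq> La" "swap_symbols u = {\<omega> 0}"
      using sing_letter_oracle[OF \<omega>] by (simp_all add: u_def)
    let ?W = "comm_word [y] (comm_word [La] [u])"
    have "coord (\<omega> 0) True ?W = [y, La, u, y, u, La]"
      using y u by (simp add: comm_word_def p_word_def)
    moreover have "triv (shift \<omega>) [y, La, u, y, u, La] \<longleftrightarrow> triv (shift \<omega>) [y, La, y, La]"
    proof -
      have "act (shift \<omega>) u (act (shift \<omega>) y (act (shift \<omega>) u x)) = act (shift \<omega>) y x" for x
        using y u by (simp add: act_E_prod[of y u] act_E_prod[of u y, symmetric] E_prod_commute[of y u])
      then show ?thesis by (simp add: triv_def word_act_Cons)
    qed
    ultimately have "\<not> triv (shift \<omega>) (coord (\<omega> 0) True ?W)"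
      using False y by (simp add: triv_letter_La_twice')
    then have "\<not> triv \<omega> ?W" using triv_iff_coord by blast
    then show ?thesis by blast
  qed
qed

text \<open>A nontrivial even word has a nontrivial component, with half the bound on its length,
  and a commutator that detects the component can be lifted. Odd words are settled at once, single
  letters end the induction.\<close>

lemma centralizer_trivial:
  "nondegenerate \<omega> F \<Longrightarrow> \<not> triv \<omega> V \<Longrightarrow> \<exists>g h. \<not> triv \<omega> (comm_word V (comm_word g h))"
proof -
  have reduced: "nondegenerate \<omega> F \<Longrightarrow> reduced_word V \<Longrightarrow> length V \<le> 2 ^ N \<Longrightarrow> \<not> triv \<omega> V \<Longrightarrow>
    \<exists>g h. \<not> triv \<omega> (comm_word V (comm_word g h))" for \<omega> V N
  proof (induction N arbitrary: \<omega> V)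
    case 0
    then have "length V \<le> 1" by simp
    then consider "V = []" | y where "V = [y]"
      by (cases V) auto
    then show ?case
    proof cases
      case (2 y)
      then show ?thesis
        using 0 letter_not_centralizing odd_not_centralizing_nondegenerate[of \<omega> "[La]"]
        by (cases "y = La") auto
    qed (use 0 in simp)
  next
    case (Suc N)
    show ?case
    proof (cases "even (count_list V La)")
      case True
      then obtain i where i: "\<not> triv (shift \<omega>) (component (\<omega> 0) i V)"
        using Suc.prems(4) triv_iff_component by blast
      obtain g h where "\<not> triv (shift \<omega>) (comm_word (component (\<omega> 0) i V) (comm_word g h))"
        using Suc.IH[OF nondegenerate_shift[OF Suc.prems(1)] _ length_component[OF Suc.prems(2,3)] i]
        by (auto simp: component_def reduced_word_reduce)
      then have "\<not> triv (shift \<omega>) (comm_word (coord (\<omega> 0) i V) (comm_word g h))"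
        by (simp add: component_coord triv_comm_word word_act_reduce)
      then show ?thesis
        using lift_not_centralizing True Suc.prems(1) unfolding nondegenerate_def by blast
    qed (use Suc.prems odd_not_centralizing_nondegenerate in blast)
  qed
  assume "nondegenerate \<omega> F" "\<not> triv \<omega> V"
  then show ?thesis
    using reduced[of \<omega> "reduce V", OF _ reduced_word_reduce length_le_log_length]
    by (simp add: triv_reduce triv_comm_word word_act_reduce)
qed

end

text \<open>This consequence of the equality of two points is what passes to the shifted oracles,
  because double commutators can be lifted.\<close>

definition same_double_commutators ::
  "oracle_seq \<Rightarrow> nat set \<Rightarrow> oracle_seq \<Rightarrow> nat set \<Rightarrow> bool" where
  "same_double_commutators \<omega> F \<omega>' F' \<longleftrightarrow> (\<forall>p q r t.
     germ.triv F \<omega> (comm_word (comm_word p q) (comm_word r t)) \<longleftrightarrow>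
     germ.triv F' \<omega>' (comm_word (comm_word p q) (comm_word r t)))"

lemma same_double_commutators_shift:
  assumes "same_double_commutators \<omega> F \<omega>' F'" "\<omega> 0 = \<omega>' 0" "\<omega> \<in> Oracles"
  shows "same_double_commutators (shift \<omega>) F (shift \<omega>') F'"
proof -
  define u where "u = sing_letter (\<omega> 0)"
  have u: "u \<noteq> La" "\<omega> 0 \<in> swap_symbols u" "\<omega>' 0 \<in> swap_symbols u"
    using sing_letter_oracle[OF assms(3), of 0] assms(2) by (simp_all add: u_def)
  show ?thesis
    unfolding same_double_commutators_def
    using assms(1) germ.triv_lift_double_commutator[where u = u and \<omega> = \<omega> and F = F and j = True, OF u(1,2)]
      germ.triv_lift_double_commutator[where u = u and \<omega> = \<omega>' and F = F' and j = True, OF u(1,3)]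
    by (simp only: same_double_commutators_def lift_word_comm_word) blast
qed

text \<open>The test word is \<open>(y a)^4\<close>, written as the commutator \<open>V\<close>,
  where \<open>y\<close> swaps at all symbols except \<open>\<omega>' 0\<close>. Relative to
  \<open>\<omega>'\<close> its coordinates are \<open>y y\<close>; relative to
  \<open>\<omega>\<close> one coordinate is \<open>(a y)^2\<close>, which is nontrivial as
  \<open>y\<close> swaps at a later symbol. The commutator of \<open>V\<close> with a further
  commutator is a distinguishing double commutator.\<close>

lemma same_double_commutators_first:
  assumes same: "same_double_commutators \<omega> F \<omega>' F'" and nd: "nondegenerate \<omega> F"
    and \<omega>': "\<omega>' \<in> Oracles"
  shows "\<omega> 0 = \<omega>' 0"
proof (rule ccontr)
  assume neq: "\<omega> 0 \<noteq> \<omega>' 0"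
  have \<omega>: "\<omega> \<in> Oracles" "F \<subseteq> {0, 1, 2}" using nd by (simp_all add: nondegenerate_def)
  have in3: "\<omega> 0 \<in> {0, 1, 2}" "\<omega>' 0 \<in> {0, 1, 2}" using \<omega> \<omega>' by (simp_all add: Oracles_def)
  define y where "y = co_sing_letter (\<omega>' 0)"
  have y: "y \<noteq> La" "swap_symbols y = {0, 1, 2} - {\<omega>' 0}"
    using co_sing_letter[OF in3(2)] by (simp_all add: y_def)
  obtain t where t: "t \<in> tail_symbols \<omega> F (Suc 0)" "t \<noteq> \<omega>' 0"
    using nd unfolding nondegenerate_def by blast
  let ?V = "comm_word [y] [La, y, La]"
  have "\<omega> 0 \<in> swap_symbols y" using in3 neq y by simp
  then have "coord (\<omega> 0) False ?V = [La, y, La, y]" using y(1) by (simp add: comm_word_def p_word_def)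
  moreover have "\<not> germ.triv F (shift \<omega>) [La, y, La, y]"
    using y t tail_symbols_subset[OF \<omega>]
    by (auto simp: germ.triv_letter_La_twice germ.triv_letter tail_symbols_shift)
  ultimately have "\<not> germ.triv F \<omega> ?V" using germ.triv_iff_coord by metis
  then obtain g h where gh: "\<not> germ.triv F \<omega> (comm_word ?V (comm_word g h))"
    using germ.centralizer_trivial[OF nd] by blast
  have "germ.triv F' \<omega>' ?V"
    unfolding germ.triv_iff_coord[of F' \<omega>'] using y
    by (auto simp: all_bool_eq comm_word_def p_word_def germ.triv_def germ.word_act_Cons)
  then have "germ.triv F' \<omega>' (comm_word ?V (comm_word g h))"
    by (rule germ.triv_comm_word_left)
  then show False using gh same unfolding same_double_commutators_def by blast
qed

text \<open>If \<open>t\<close> is missing on the right, the letter swapping at \<open>t\<close>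
  alone is trivial there but not on the left. Two commutators have to be taken before the result has
  the form of a double commutator.\<close>

lemma same_double_commutators_tail_subset:
  assumes same: "same_double_commutators \<omega> F \<omega>' F'" and nd: "nondegenerate \<omega> F"
  shows "tail_symbols \<omega> F 0 \<subseteq> tail_symbols \<omega>' F' 0"
proof (rule ccontr)
  assume "\<not> ?thesis"
  then obtain t where t: "t \<in> tail_symbols \<omega> F 0" "t \<notin> tail_symbols \<omega>' F' 0" by blast
  have "t \<in> {0, 1, 2}"
    using nd t(1) tail_symbols_subset unfolding nondegenerate_def by blast
  then obtain y where y: "y \<noteq> La" "swap_symbols y = {t}" using sing_letter by blast
  have "\<not> germ.triv F \<omega> [y]" using t y by (simp add: germ.triv_letter)
  then obtain g h where "\<not> germ.triv F \<omega> (comm_word [y] (comm_word g h))"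
    using germ.centralizer_trivial[OF nd] by blast
  then obtain k l where
    kl: "\<not> germ.triv F \<omega> (comm_word (comm_word [y] (comm_word g h)) (comm_word k l))"
    using germ.centralizer_trivial[OF nd] by blast
  have "germ.triv F' \<omega>' [y]" using t y by (simp add: germ.triv_letter)
  then have "germ.triv F' \<omega>' (comm_word (comm_word [y] (comm_word g h)) (comm_word k l))"
    by (intro germ.triv_comm_word_left)
  then show False using kl same unfolding same_double_commutators_def by blast
qed

lemma same_double_commutators_all:
  assumes "same_double_commutators \<omega> F \<omega>' F'" "nondegenerate \<omega> F" "\<omega>' \<in> Oracles"
  shows "\<omega> N = \<omega>' N \<and> tail_symbols \<omega> F N \<subseteq> tail_symbols \<omega>' F' N"
  using assms
proof (induction N arbitrary: \<omega> \<omega>')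
  case 0
  then show ?case
    using same_double_commutators_first same_double_commutators_tail_subset by blast
next
  case (Suc N)
  have "\<omega> 0 = \<omega>' 0" using Suc.prems same_double_commutators_first by blast
  then have "same_double_commutators (shift \<omega>) F (shift \<omega>') F'"
    using Suc.prems same_double_commutators_shift unfolding nondegenerate_def by blast
  then show ?case
    using Suc.IH[of "shift \<omega>" "shift \<omega>'"] Suc.prems nondegenerate_shift shift_in_Oracles
    by (simp add: tail_symbols_shift) (simp add: shift_def)
qed

text \<open>Nondegeneracy is assumed on one side only; it passes to the other side with the
  inclusion of tails, after which the roles can be exchanged. In this one-sided form the result also
  separates these points from the degenerate ones.\<close>

theorem germ_point_inject:
  assumes eq: "germ_point \<omega> F = germ_point \<omega>' F'" and nd: "nondegenerate \<omega> F"
    and \<omega>': "\<omega>' \<in> Oracles" "F' \<subseteq> {0, 1, 2}"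
  shows "\<omega> = \<omega>'" "tail_symbols \<omega> F N = tail_symbols \<omega>' F' N"
proof -
  have same: "same_double_commutators \<omega> F \<omega>' F'" "same_double_commutators \<omega>' F' \<omega> F"
    using eq by (simp_all add: same_double_commutators_def germ_point_eq_iff_triv)
  note all = same_double_commutators_all[OF same(1) nd \<omega>'(1)]
  show "\<omega> = \<omega>'" using all by auto
  have "nondegenerate \<omega>' F'"
    using all nd \<omega>' unfolding nondegenerate_def by blast
  moreover have "\<omega> \<in> Oracles" using nd by (simp add: nondegenerate_def)
  ultimately show "tail_symbols \<omega> F N = tail_symbols \<omega>' F' N"
    using all same_double_commutators_all[OF same(2)] by blast
qed

section \<open>Perfect compact sets of marked groups\<close>

definition ternary :: "(nat \<Rightarrow> bool) \<Rightarrow> real" where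
  "ternary t = (\<Sum>m. 2 * of_bool (t m) * (1/3) ^ Suc m)"

lemma ternary_summable: "summable (\<lambda>m. 2 * of_bool (t m) * (1/3 :: real) ^ Suc m)"
proof (rule summable_comparison_test')
  show "summable (\<lambda>m. 2 * (1/3 :: real) ^ Suc m)"
    by (intro summable_mult summable_Suc_iff[THEN iffD2] summable_geometric) simp
qed (auto simp: of_bool_def)

lemma ternary_rec: "ternary t = (2 * of_bool (t 0) + ternary (\<lambda>m. t (Suc m))) / 3"
proof -
  have "ternary t = (\<Sum>m. 2 * of_bool (t (Suc m)) * (1/3) ^ Suc (Suc m)) + 2 * of_bool (t 0) * (1/3)"
    unfolding ternary_def using suminf_split_head[OF ternary_summable[of t]] by simp
  also have "(\<Sum>m. 2 * of_bool (t (Suc m)) * (1/3 :: real) ^ Suc (Suc m)) =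
      (\<Sum>m. (1/3) * (2 * of_bool (t (Suc m)) * (1/3) ^ Suc m))"
    by (simp add: mult_ac)
  also have "\<dots> = (1/3) * ternary (\<lambda>m. t (Suc m))"
    unfolding ternary_def by (rule suminf_mult[OF ternary_summable])
  finally show ?thesis by simp
qed

lemma ternary_ge_0: "0 \<le> ternary t"
  unfolding ternary_def by (intro suminf_nonneg ternary_summable) simp

lemma ternary_le_1: "ternary t \<le> 1"
proof -
  have geo: "(\<lambda>m. 2 * (1/3 :: real) ^ Suc m) sums 1"
    using sums_mult[OF geometric_sums[of "1/3 :: real"], of "2/3"] by (simp add: mult_ac)
  have "ternary t \<le> (\<Sum>m. 2 * (1/3 :: real) ^ Suc m)"
    unfolding ternary_def
    by (intro suminf_le ternary_summable sums_summable[OF geo]) (auto simp: of_bool_def)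
  then show ?thesis using sums_unique[OF geo] by simp
qed

lemma ternary_close: "(\<And>j. j < m \<Longrightarrow> t j = u j) \<Longrightarrow> \<bar>ternary t - ternary u\<bar> \<le> (1/3) ^ m"
proof (induction m arbitrary: t u)
  case 0
  then show ?case using ternary_ge_0[of t] ternary_ge_0[of u] ternary_le_1[of t] ternary_le_1[of u]
    by simp
next
  case (Suc m)
  have "\<bar>ternary (\<lambda>m. t (Suc m)) - ternary (\<lambda>m. u (Suc m))\<bar> \<le> (1/3) ^ m"
    using Suc.prems by (intro Suc.IH) simp
  moreover have "t 0 = u 0" using Suc.prems by simp
  ultimately show ?case
    by (subst (1 2) ternary_rec) (simp add: abs_if field_simps split: if_splits)
qed

text \<open>The digits after the first contribute at most 1/3, so values with first digit 0 lie in
  the left third and those with first digit 2 in the right third.\<close>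

lemma ternary_inject:
  assumes "ternary t = ternary u"
  shows "t m = u m"
  using assms
proof (induction m arbitrary: t u)
  case (0 t u)
  then show ?case
    using ternary_rec[of t] ternary_rec[of u]
      ternary_ge_0[of "\<lambda>m. t (Suc m)"] ternary_le_1[of "\<lambda>m. t (Suc m)"]
      ternary_ge_0[of "\<lambda>m. u (Suc m)"] ternary_le_1[of "\<lambda>m. u (Suc m)"]
    by (cases "t 0"; cases "u 0") auto
next
  case (Suc m t u)
  have "t 0 = u 0"
    using Suc.prems ternary_rec[of t] ternary_rec[of u]
      ternary_ge_0[of "\<lambda>m. t (Suc m)"] ternary_le_1[of "\<lambda>m. t (Suc m)"]
      ternary_ge_0[of "\<lambda>m. u (Suc m)"] ternary_le_1[of "\<lambda>m. u (Suc m)"]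
    by (cases "t 0"; cases "u 0") auto
  then show ?case
    using Suc.prems Suc.IH[of "\<lambda>m. t (Suc m)" "\<lambda>m. u (Suc m)"] ternary_rec[of t] ternary_rec[of u]
    by simp
qed

lemma ternary_in_cantor_step: "ternary t \<in> cantor_step n"
proof (induction n arbitrary: t)
  case 0
  then show ?case by (simp add: ternary_ge_0 ternary_le_1)
next
  case (Suc n)
  define q where "q = ternary (\<lambda>m. t (Suc m))"
  have "q \<in> cantor_step n" using Suc by (simp add: q_def)
  moreover have "ternary t = (2 * of_bool (t 0) + q) / 3"
    by (subst ternary_rec) (simp add: q_def)
  ultimately show ?case
    by (cases "t 0") (simp_all add: add.commute)
qed

lemma cantor_step_near_ternary: "p \<in> cantor_step n \<Longrightarrow> \<exists>t. \<bar>p - ternary t\<bar> \<le> (1/3) ^ n"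
proof (induction n arbitrary: p)
  case 0
  \<comment> \<open>Any digits will do, as both numbers lie in the unit interval.\<close>
  then show ?case
    using ternary_ge_0[of undefined] ternary_le_1[of undefined] by (intro exI[of _ undefined]) auto
next
  case (Suc n)
  obtain q i where q: "q \<in> cantor_step n" "p = (2 * of_bool i + q) / 3"
  proof -
    consider q where "q \<in> cantor_step n" "p = q / 3" | q where "q \<in> cantor_step n" "p = (q + 2) / 3"
      using Suc.prems by auto
    then show thesis
      by cases (use that[of _ False] that[of _ True] in \<open>simp_all add: add.commute\<close>)
  qed
  obtain t where t: "\<bar>q - ternary t\<bar> \<le> (1/3) ^ n" using Suc.IH[OF q(1)] by blast
  have "ternary (case_nat i t) = (2 * of_bool i + ternary t) / 3"
    by (subst ternary_rec) simp
  then have *: "p - ternary (case_nat i t) = (q - ternary t) / 3"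
    by (simp add: q(2) field_simps)
  have "\<bar>p - ternary (case_nat i t)\<bar> \<le> (1/3) ^ Suc n"
    unfolding * using t by simp
  then show ?case by blast
qed

section \<open>Coding a perfect compact set by digits\<close>

lemma enumerate_cong:
  fixes A B :: "nat set"
  assumes "infinite A" "infinite B" "A \<inter> {..n} = B \<inter> {..n}"
  shows "enumerate A m \<le> n \<Longrightarrow> enumerate B m = enumerate A m"
proof (induction m)
  case 0
  have AB: "s \<in> A \<longleftrightarrow> s \<in> B" if "s \<le> n" for s using assms(3) that by auto
  have "enumerate A 0 \<in> A" by (rule enumerate_in_set[OF assms(1)])
  moreover have "enumerate A 0 \<le> s" if "s \<in> A" for s
    using that by (simp add: enumerate_0 Least_le)
  ultimately have "(LEAST s. s \<in> B) = enumerate A 0"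
    using AB 0 by (intro Least_equality) (auto, metis nat_le_linear order_trans)
  then show ?case by (simp add: enumerate_0)
next
  case (Suc m)
  have AB: "s \<in> A \<longleftrightarrow> s \<in> B" if "s \<le> n" for s using assms(3) that by auto
  have "enumerate A m < enumerate A (Suc m)" by (rule enumerate_step[OF assms(1)])
  then have IH: "enumerate B m = enumerate A m" using Suc by simp
  have "enumerate A (Suc m) \<in> A" by (rule enumerate_in_set[OF assms(1)])
  moreover have "enumerate A (Suc m) \<le> s" if "s \<in> A" "enumerate A m < s" for s
    using that by (simp add: enumerate_Suc''[OF assms(1)] Least_le)
  ultimately have "(LEAST s. s \<in> B \<and> enumerate A m < s) = enumerate A (Suc m)"
    using AB Suc.prems enumerate_step[OF assms(1), of m]
    by (intro Least_equality) (auto, metis nat_le_linear order_trans)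
  then show ?case by (simp add: enumerate_Suc''[OF assms(2)] IH)
qed

text \<open>The predicates \<open>b n\<close> play the role of countably many clopen sets that
  separate the points of \<open>K\<close>. The points agreeing with \<open>x\<close> below level
  \<open>n\<close> form one piece of a partition that gets finer with \<open>n\<close>.\<close>

locale binary_coding =
  fixes K :: "'a::metric_space set" and b :: "nat \<Rightarrow> 'a \<Rightarrow> bool"
  assumes compact: "compact K" and nonempty: "K \<noteq> {}"
    and perfect: "x \<in> K \<Longrightarrow> x islimpt K"
    and locally_constant: "x \<in> K \<Longrightarrow> \<exists>e>0. \<forall>y\<in>K. dist x y < e \<longrightarrow> b n y = b n x"
    and separating: "x \<in> K \<Longrightarrow> y \<in> K \<Longrightarrow> x \<noteq> y \<Longrightarrow> \<exists>n. b n x \<noteq> b n y"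
begin

definition agree :: "nat \<Rightarrow> 'a \<Rightarrow> 'a \<Rightarrow> bool" where
  "agree n x y \<longleftrightarrow> (\<forall>m<n. b m y = b m x)"

definition split_levels :: "'a \<Rightarrow> nat set" where
  "split_levels x = {n. \<exists>y\<in>K. agree n x y \<and> b n y \<noteq> b n x}"

text \<open>Only the values at the levels where \<open>K\<close> splits are used as digits, so that all
  sequences of digits occur.\<close>

definition digit :: "'a \<Rightarrow> nat \<Rightarrow> bool" where
  "digit x m = b (enumerate (split_levels x) m) x"

lemma locally_agree: "x \<in> K \<Longrightarrow> \<exists>e>0. \<forall>y\<in>K. dist x y < e \<longrightarrow> agree n x y"
proof (induction n)
  case 0
  then show ?case by (auto simp: agree_def intro: exI[of _ 1])
next
  case (Suc n)
  then obtain e where e: "e > 0" "\<And>y. y \<in> K \<Longrightarrow> dist x y < e \<Longrightarrow> agree n x y" by blast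
  obtain d where d: "d > 0" "\<And>y. y \<in> K \<Longrightarrow> dist x y < d \<Longrightarrow> b n y = b n x"
    using locally_constant[OF Suc.prems] by blast
  show ?case
    using e d by (intro exI[of _ "min d e"]) (auto simp: agree_def less_Suc_eq)
qed

lemma first_difference:
  assumes "x \<in> K" "y \<in> K" "x \<noteq> y"
  obtains n where "agree n x y" "b n y \<noteq> b n x" "n \<in> split_levels x"
proof -
  obtain n where "b n y \<noteq> b n x \<and> (\<forall>m<n. b m y = b m x)"
    using separating[OF assms] exists_least_iff[of "\<lambda>n. b n y \<noteq> b n x"] by metis
  then show thesis
    using assms by (intro that[of n]) (auto simp: agree_def split_levels_def)
qed

text \<open>As \<open>K\<close> is perfect, some other point is so close to \<open>x\<close> that
  the two agree below \<open>N\<close>; the level of their first difference is a splitting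
  level.\<close>

lemma infinite_split_levels:
  assumes x: "x \<in> K"
  shows "infinite (split_levels x)"
  unfolding infinite_nat_iff_unbounded_le
proof
  fix N
  obtain e where e: "e > 0" "\<And>y. y \<in> K \<Longrightarrow> dist x y < e \<Longrightarrow> agree N x y"
    using locally_agree[OF x] by blast
  obtain y where y: "y \<in> K" "y \<noteq> x" "dist y x < e"
    using perfect[OF x] e(1) unfolding islimpt_approachable by blast
  obtain n where n: "agree n x y" "b n y \<noteq> b n x" "n \<in> split_levels x"
    using first_difference[OF x y(1)] y(2) by blast
  have "agree N x y" using e(2)[OF y(1)] y(3) by (simp add: dist_commute)
  then have "N \<le> n" using n(2) unfolding agree_def by (meson not_le)
  then show "\<exists>n\<ge>N. n \<in> split_levels x" using n(3) by blast
qed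

text \<open>Whether the piece containing \<open>x\<close> splits at level \<open>m\<close> depends
  only on the piece, hence on the levels below \<open>m\<close>. This is why level \<open>n\<close>
  itself is included.\<close>

lemma split_levels_agree:
  assumes "x \<in> K" "y \<in> K" "agree n x y"
  shows "split_levels x \<inter> {..n} = split_levels y \<inter> {..n}"
proof -
  have "m \<in> split_levels y" if "m \<in> split_levels x" "m \<le> n" "x \<in> K" "agree n x y" for x y m
  proof -
    obtain z where z: "z \<in> K" "agree m x z" "b m z \<noteq> b m x"
      using \<open>m \<in> split_levels x\<close> by (auto simp: split_levels_def)
    have "agree m y x" "agree m y z" using that z by (auto simp: agree_def)
    \<comment> \<open>If \<open>y\<close> differs from \<open>x\<close> at level \<open>m\<close>,
      then \<open>x\<close> is a witness for \<open>y\<close>, otherwise \<open>z\<close>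
      is.\<close>
    moreover have "b m z \<noteq> b m y \<or> b m x \<noteq> b m y" using z by auto
    ultimately show ?thesis using that(3) z(1) by (auto simp: split_levels_def)
  qed
  moreover have "agree n y x" using assms by (auto simp: agree_def)
  ultimately show ?thesis using assms by blast
qed

lemma enumerate_split_levels_agree:
  assumes "x \<in> K" "y \<in> K" "agree n x y" "enumerate (split_levels x) m \<le> n"
  shows "enumerate (split_levels y) m = enumerate (split_levels x) m"
  using enumerate_cong[OF _ _ split_levels_agree[OF assms(1-3)] assms(4)]
    infinite_split_levels assms(1,2) by blast

lemma digit_agree:
  assumes "x \<in> K" "y \<in> K" "agree n x y" "enumerate (split_levels x) m < n"
  shows "digit y m = digit x m"
  using enumerate_split_levels_agree[OF assms(1-3), of m] assms(3,4)
  by (simp add: digit_def agree_def)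

lemma enumerate_less: "x \<in> K \<Longrightarrow> j < m \<Longrightarrow>
    enumerate (split_levels x) j < enumerate (split_levels x) m"
  using enumerate_mono infinite_split_levels by blast

text \<open>If digit \<open>m\<close> is wrong, the splitting at its level supplies a point with the
  other value that agrees on all lower levels, and so has the same earlier digits.\<close>

lemma exists_digits: "\<exists>x\<in>K. \<forall>j<m. digit x j = t j"
proof (induction m)
  case 0
  then show ?case using nonempty by auto
next
  case (Suc m)
  then obtain x where x: "x \<in> K" "\<And>j. j < m \<Longrightarrow> digit x j = t j" by blast
  let ?n = "enumerate (split_levels x) m"
  show ?case
  proof (cases "digit x m = t m")
    case True
    then show ?thesis using x by (auto simp: less_Suc_eq)
  next
    case False
    have "?n \<in> split_levels x" using enumerate_in_set infinite_split_levels[OF x(1)] by blast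
    then obtain y where y: "y \<in> K" "agree ?n x y" "b ?n y \<noteq> b ?n x"
      by (auto simp: split_levels_def)
    have "enumerate (split_levels y) m = ?n"
      by (rule enumerate_split_levels_agree[OF x(1) y(1,2)]) simp
    then have "digit y m = t m" using y(3) False by (auto simp: digit_def)
    moreover have "digit y j = t j" if "j < m" for j
      using digit_agree[OF x(1) y(1,2)] enumerate_less[OF x(1) that] x(2)[OF that] by simp
    ultimately show ?thesis using y(1) by (auto simp: less_Suc_eq)
  qed
qed

lemma inj_on_ternary_digit: "inj_on (\<lambda>x. ternary (digit x)) K"
proof (rule inj_onI, rule ccontr)
  fix x y assume xy: "x \<in> K" "y \<in> K" "ternary (digit x) = ternary (digit y)" "x \<noteq> y"
  obtain n where n: "agree n x y" "b n y \<noteq> b n x" "n \<in> split_levels x"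
    using first_difference[OF xy(1,2,4)] by blast
  obtain m where m: "enumerate (split_levels x) m = n"
    using enumerate_Ex[OF infinite_split_levels[OF xy(1)] n(3)] by blast
  have "enumerate (split_levels y) m = n"
    using enumerate_split_levels_agree[OF xy(1,2) n(1), of m] m by simp
  then have "digit x m \<noteq> digit y m" using m n(2) by (simp add: digit_def)
  then show False using ternary_inject[OF xy(3)] by blast
qed

lemma continuous_on_ternary_digit: "continuous_on K (\<lambda>x. ternary (digit x))"
  unfolding continuous_on_iff
proof (intro ballI allI impI)
  fix x :: 'a and r :: real assume x: "x \<in> K" and r: "0 < r"
  obtain m where m: "(1/3) ^ m < r" using real_arch_pow_inv[OF r, of "1/3"] by auto
  obtain d where d: "d > 0" "\<And>y. y \<in> K \<Longrightarrow> dist x y < d \<Longrightarrow> agree (enumerate (split_levels x) m) x y"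
    using locally_agree[OF x] by blast
  have "dist (ternary (digit y)) (ternary (digit x)) < r" if y: "y \<in> K" "dist y x < d" for y
  proof -
    have "agree (enumerate (split_levels x) m) x y" using d(2) y by (simp add: dist_commute)
    then have "digit y j = digit x j" if "j < m" for j
      using digit_agree[OF x y(1)] enumerate_less[OF x that] by blast
    then have "\<bar>ternary (digit y) - ternary (digit x)\<bar> \<le> (1/3) ^ m"
      by (rule ternary_close)
    then show ?thesis using m by (simp add: dist_real_def)
  qed
  then show "\<exists>d>0. \<forall>x'\<in>K. dist x' x < d \<longrightarrow> dist (ternary (digit x')) (ternary (digit x)) < r"
    using d(1) by blast
qed

text \<open>Finitely many digits can be prescribed, so the image is dense in the Cantor set; being
  compact, it is everything.\<close>

lemma image_ternary_digit: "(\<lambda>x. ternary (digit x)) ` K = cantor_set"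
proof
  show "(\<lambda>x. ternary (digit x)) ` K \<subseteq> cantor_set"
    using ternary_in_cantor_step by (auto simp: cantor_set_def)
  have "closed ((\<lambda>x. ternary (digit x)) ` K)"
    using compact continuous_on_ternary_digit compact_continuous_image compact_imp_closed by blast
  moreover have "p \<in> closure ((\<lambda>x. ternary (digit x)) ` K)" if p: "p \<in> cantor_set" for p
    unfolding closure_approachable
  proof (intro allI impI)
    fix r :: real assume "r > 0"
    then obtain m where m: "(1/3) ^ m < r / 2" using real_arch_pow_inv[of "r / 2" "1/3"] by auto
    obtain t where t: "\<bar>p - ternary t\<bar> \<le> (1/3) ^ m"
      using p cantor_step_near_ternary[of p m] by (auto simp: cantor_set_def)
    obtain x where x: "x \<in> K" "\<And>j. j < m \<Longrightarrow> digit x j = t j" using exists_digits by blast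
    have "\<bar>ternary (digit x) - ternary t\<bar> \<le> (1/3) ^ m"
      using x(2) by (rule ternary_close)
    then have "dist (ternary (digit x)) p < r" using t m by (simp add: dist_real_def)
    then show "\<exists>y\<in>(\<lambda>x. ternary (digit x)) ` K. dist y p < r" using x(1) by blast
  qed
  ultimately show "cantor_set \<subseteq> (\<lambda>x. ternary (digit x)) ` K"
    by (auto simp: closure_closed)
qed

lemma homeomorphic_cantor_set: "K homeomorphic cantor_set"
  using homeomorphic_compact[OF compact continuous_on_ternary_digit image_ternary_digit
      inj_on_ternary_digit] .

end

text \<open>Relations provide the countably many clopen sets: the validity of each is constant on
  small balls, and together they determine the point.\<close>

lift_definition relation_at :: "'k::finite marked \<Rightarrow> ('k \<times> bool) list \<times> ('k \<times> bool) list \<Rightarrow> bool" is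
  "\<lambda>(G, S) (u, v). sval G S u = sval G S v"
  by (auto simp: marked_iso_iff fun_eq_iff)

lemma same_ball_at_iff_relation_at:
  "same_ball_at p q n \<longleftrightarrow>
    (\<forall>u v. length u \<le> n \<longrightarrow> length v \<le> n \<longrightarrow> relation_at p (u, v) = relation_at q (u, v))"
proof (cases p rule: marked_cases)
  case (1 G S)
  note p = this
  show ?thesis
  proof (cases q rule: marked_cases)
    case (1 H T)
    have "relation_at (abs_marked (A, B)) (u, v) \<longleftrightarrow> sval A B u = sval A B v"
      if "is_marked A B" for A :: "nat monoid" and B :: "'a \<Rightarrow> nat" and u v
      using that by (subst relation_at.abs_eq) (auto simp: marked_iso_iff)
    then show ?thesis
      using p 1 by (simp add: same_ball_at_abs same_ball_iff)
  qed
qed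

theorem perfect_compact_marked_homeomorphic_cantor_set:
  fixes K :: "'k::finite marked set"
  assumes "compact K" "K \<noteq> {}" "\<And>x. x \<in> K \<Longrightarrow> x islimpt K"
  shows "K homeomorphic cantor_set"
proof -
  let ?U = "UNIV :: (('k \<times> bool) list \<times> ('k \<times> bool) list) set"
  define b where "b n p = relation_at p (from_nat_into ?U n)" for n and p :: "'k marked"
  have count: "countable ?U"
  proof -
    have "countable (UNIV :: ('k \<times> bool) set)" by (simp add: countable_finite finite_prod)
    then have "countable (UNIV :: ('k \<times> bool) list set)"
      using countable_lists[of "UNIV :: ('k \<times> bool) set"] by simp
    then have "countable ((UNIV :: ('k \<times> bool) list set) \<times> (UNIV :: ('k \<times> bool) list set))"
      by blast
    then show ?thesis by simp
  qed
  interpret binary_coding K b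
  proof
    fix x :: "'k marked" and n assume "x \<in> K"
    obtain u v where uv: "from_nat_into ?U n = (u, v)" by (cases "from_nat_into ?U n")
    let ?N = "max (length u) (length v)"
    have "b n y = b n x" if "dist x y < (1/2) ^ ?N" for y
    proof -
      have "same_ball_at x y ?N"
        using that same_ball_at_antimono dist_marked_less_iff by (metis le_SucI order_refl)
      then show ?thesis by (simp add: same_ball_at_iff_relation_at b_def uv)
    qed
    moreover have "0 < (1/2 :: real) ^ ?N" by simp
    ultimately show "\<exists>e>0. \<forall>y\<in>K. dist x y < e \<longrightarrow> b n y = b n x"
      by blast
  next
    fix x y :: "'k marked" assume "x \<noteq> y"
    then obtain n where "\<not> same_ball_at x y n" using marked_eq_iff by blast
    then obtain u v where uv: "relation_at x (u, v) \<noteq> relation_at y (u, v)"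
      by (auto simp: same_ball_at_iff_relation_at)
    obtain n where "from_nat_into ?U n = (u, v)"
      using from_nat_into_surj[OF count] by blast
    then have "b n x \<noteq> b n y" using uv by (simp add: b_def)
    then show "\<exists>n. b n x \<noteq> b n y" ..
  qed (use assms in auto)
  show ?thesis by (rule homeomorphic_cantor_set)
qed

section \<open>Convergence of oracles\<close>

text \<open>Diagonal argument: at stage \<open>n\<close> the pigeonhole principle makes entry
  \<open>n\<close> constant, and from place \<open>Suc n\<close> on the diagonal sequence is a
  subsequence of that stage.\<close>

lemma finite_valued_convergent_subsequence:
  fixes c :: "nat \<Rightarrow> nat \<Rightarrow> 'b"
  assumes A: "finite A" and c: "\<And>k n. c k n \<in> A"
  obtains r l where "strict_mono (r :: nat \<Rightarrow> nat)" "\<And>n. l n \<in> A"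
    "\<And>n. \<forall>\<^sub>F k in sequentially. c (r k) n = l n"
proof -
  interpret subseqs "\<lambda>n s. \<exists>v\<in>A. \<forall>k. c (s k) n = v"
  proof
    fix n and s :: "nat \<Rightarrow> nat" assume s: "strict_mono s"
    have "finite ((\<lambda>k. c (s k) n) ` UNIV)"
      by (rule finite_subset[OF _ A]) (use c in auto)
    then obtain k0 where inf: "infinite {k \<in> UNIV. c (s k) n = c (s k0) n}"
      using pigeonhole_infinite[of UNIV "\<lambda>k. c (s k) n"] infinite_UNIV_nat by auto
    let ?r = "enumerate {k. c (s k) n = c (s k0) n}"
    have mono: "strict_mono ?r" using inf by (simp add: strict_mono_enumerate)
    have const: "\<forall>k. c ((s \<circ> ?r) k) n = c (s k0) n"
      using enumerate_in_set[OF inf] by simp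
    show "\<exists>r' :: nat \<Rightarrow> nat. strict_mono r' \<and> (\<exists>v\<in>A. \<forall>k. c ((s \<circ> r') k) n = v)"
    proof (intro exI conjI)
      show "strict_mono ?r" by (rule mono)
      show "\<exists>v\<in>A. \<forall>k. c ((s \<circ> ?r) k) n = v"
      proof (rule bexI)
        show "\<forall>k. c ((s \<circ> ?r) k) n = c (s k0) n" by (rule const)
        show "c (s k0) n \<in> A" by (rule c)
      qed
    qed
  qed
  have "\<exists>v\<in>A. \<forall>k. c ((diagseq \<circ> (+) (Suc n)) k) n = v" for n
    by (rule diagseq_holds) auto
  then obtain l where l: "\<And>n. l n \<in> A" "\<And>n k. c (diagseq (Suc n + k)) n = l n"
    unfolding comp_def by metis
  have "\<forall>\<^sub>F k in sequentially. c (diagseq k) n = l n" for n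
    unfolding eventually_sequentially
  proof (intro exI[of _ "Suc n"] allI impI)
    fix k assume "Suc n \<le> k"
    then show "c (diagseq k) n = l n" using l(2)[of n "k - Suc n"] by simp
  qed
  then show thesis using that subseq_diagseq l(1) by blast
qed

text \<open>Symbols and tails are made to converge together. The limits \<open>L N\<close> of the
  tails decrease, and \<open>F\<close> is what survives in all of them. Since \<open>L N\<close> and
  \<open>L (Suc N)\<close> differ at most by \<open>\<omega> N\<close>, a symbol of
  \<open>L N\<close> that does not occur in \<open>\<omega>\<close> from \<open>N\<close> on is
  never removed and lies in \<open>F\<close>.\<close>

lemma oracle_convergent_subsequence:
  fixes w :: "nat \<Rightarrow> oracle_seq" and S :: "nat \<Rightarrow> nat set"
  assumes w: "\<And>k. w k \<in> Oracles" and S: "\<And>k. S k \<subseteq> {0, 1, 2}"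
  obtains r \<omega> F where "strict_mono (r :: nat \<Rightarrow> nat)" "\<omega> \<in> Oracles" "F \<subseteq> {0, 1, 2}"
    "\<forall>N. \<forall>\<^sub>F k in sequentially. (\<forall>n<N. w (r k) n = \<omega> n) \<and>
       tail_symbols (w (r k)) (S (r k)) N = tail_symbols \<omega> F N"
proof -
  define c where "c k n = (w k n, tail_symbols (w k) (S k) n)" for k n
  have fin: "finite ({0, 1, 2} \<times> Pow {0, 1, 2} :: (nat \<times> nat set) set)" by simp
  have "c k n \<in> {0, 1, 2} \<times> Pow {0, 1, 2}" for k n
    using w[of k] tail_symbols_subset[OF w S, of k k n] unfolding c_def Oracles_def by blast
  then obtain r l where r: "strict_mono r" and l: "\<And>n. l n \<in> {0, 1, 2} \<times> Pow {0, 1, 2}"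
    and ev: "\<And>n. \<forall>\<^sub>F k in sequentially. c (r k) n = l n"
    using finite_valued_convergent_subsequence[OF fin, of c] by metis
  define \<omega> L where "\<omega> n = fst (l n)" and "L n = snd (l n)" for n
  have ev\<omega>: "\<forall>\<^sub>F k in sequentially. w (r k) n = \<omega> n" for n
    using ev[of n] by (rule eventually_mono) (drule arg_cong[of _ _ fst], simp add: c_def \<omega>_def)
  have evL: "\<forall>\<^sub>F k in sequentially. tail_symbols (w (r k)) (S (r k)) n = L n" for n
    using ev[of n] by (rule eventually_mono) (drule arg_cong[of _ _ snd], simp add: c_def L_def)
  have L: "L N = insert (\<omega> N) (L (Suc N))" for N
  proof -
    have "\<forall>\<^sub>F k in sequentially. L N = insert (\<omega> N) (L (Suc N))"
      using ev\<omega>[of N] evL[of N] evL[of "Suc N"]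
      by eventually_elim (use tail_symbols_Suc in metis)
    then show ?thesis by simp
  qed
  have anti: "L M \<subseteq> L N" if "N \<le> M" for M N
    using that by (induction M rule: dec_induct) (use L in blast)+
  define F where "F = (\<Inter>N. L N)"
  have tail: "tail_symbols \<omega> F N = L N" for N
  proof
    have "\<omega> n \<in> L N" if "N \<le> n" for n using anti[OF that] L[of n] by blast
    then show "tail_symbols \<omega> F N \<subseteq> L N" by (auto simp: tail_symbols_def F_def)
    show "L N \<subseteq> tail_symbols \<omega> F N"
    proof (rule subsetI, rule ccontr)
      fix x assume x: "x \<in> L N" "x \<notin> tail_symbols \<omega> F N"
      have "x \<in> L M" if "N \<le> M" for M
        using that
      proof (induction M rule: dec_induct)
        case (step M)
        then have "x \<noteq> \<omega> M" using x(2) by (auto simp: tail_symbols_def)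
        then show ?case using step.IH L[of M] by blast
      qed (rule x(1))
      then have "x \<in> L M" for M using anti[of M N] x(1) nat_le_linear[of M N] by blast
      then show False using x(2) by (simp add: F_def tail_symbols_def)
    qed
  qed
  show thesis
  proof (rule that[OF r])
    have "\<omega> n \<in> {0, 1, 2}" "L n \<subseteq> {0, 1, 2}" for n
      using l[of n] by (auto simp: \<omega>_def L_def simp del: insert_iff)
    then show "\<omega> \<in> Oracles" "F \<subseteq> {0, 1, 2}"
      unfolding Oracles_def F_def by blast+
    show "\<forall>N. \<forall>\<^sub>F k in sequentially. (\<forall>n<N. w (r k) n = \<omega> n) \<and>
       tail_symbols (w (r k)) (S (r k)) N = tail_symbols \<omega> F N"
    proof
      fix N
      have "\<forall>\<^sub>F k in sequentially. \<forall>n\<in>{..<N}. w (r k) n = \<omega> n"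
        by (rule eventually_ball_finite) (use ev\<omega> in auto)
      then show "\<forall>\<^sub>F k in sequentially. (\<forall>n<N. w (r k) n = \<omega> n) \<and>
         tail_symbols (w (r k)) (S (r k)) N = tail_symbols \<omega> F N"
        unfolding tail using evL[of N] by eventually_elim auto
    qed
  qed
qed

lemma germ_point_tendsto:
  assumes "\<forall>N. \<forall>\<^sub>F k in sequentially. (\<forall>n<N. w k n = \<omega> n) \<and>
     tail_symbols (w k) (S k) N = tail_symbols \<omega> F N"
  shows "(\<lambda>k. germ_point (w k) (S k)) \<longlonglongrightarrow> germ_point \<omega> F"
  unfolding tendsto_iff
proof (intro allI impI)
  fix e :: real assume "e > 0"
  then obtain m where m: "(1/2) ^ m < e" using real_arch_pow_inv[of e "1/2"] by auto
  \<comment> \<open>Distance below \<open>(1/2) ^ m\<close> means equal balls of radius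
    \<open>Suc m\<close>, hence relators of length up to \<open>2 * Suc m\<close>, for which
    \<open>m + 2\<close> decompositions suffice.\<close>
  have pow: "2 * Suc m \<le> 2 ^ (m + 2)" using less_exp[of "Suc m"] by simp
  show "\<forall>\<^sub>F k in sequentially. dist (germ_point (w k) (S k)) (germ_point \<omega> F) < e"
    using spec[OF assms, of "m + 2"]
  proof eventually_elim
    case (elim k)
    then have "same_ball_at (germ_point (w k) (S k)) (germ_point \<omega> F) (Suc m)"
      by (intro germ_point_same_ball[OF _ _ pow]) auto
    then show ?case using m dist_marked_less_iff[of "germ_point (w k) (S k)" "germ_point \<omega> F" m] by linarith
  qed
qed

subsection \<open>Symbols occurring infinitely often\<close>

lemma occurs_inf_iff: "occurs_inf \<omega> s \<longleftrightarrow> (\<forall>m. \<exists>n\<ge>m. \<omega> n = s)"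
  by (auto simp: occurs_inf_def infinite_nat_iff_unbounded_le)

lemma occurs_inf_cong:
  assumes "\<And>n. n \<ge> M \<Longrightarrow> \<omega> n = \<omega>' n"
  shows "occurs_inf \<omega> s \<longleftrightarrow> occurs_inf \<omega>' s"
  unfolding occurs_inf_iff
  by (metis assms max.cobounded1 max.cobounded2 order_trans)

lemma eventual_symbols:
  assumes "\<omega> \<in> Oracles"
  obtains M where "\<And>n. n \<ge> M \<Longrightarrow> occurs_inf \<omega> (\<omega> n)"
proof -
  let ?B = "\<Union>s\<in>{s \<in> {0, 1, 2}. \<not> occurs_inf \<omega> s}. {n. \<omega> n = s}"
  have "finite ?B" by (rule finite_UN_I) (auto simp: occurs_inf_def)
  then obtain M where M: "\<forall>n\<in>?B. n < M" using finite_nat_set_iff_bounded by blast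
  have "occurs_inf \<omega> (\<omega> n)" if "n \<ge> M" for n
  proof (rule ccontr)
    assume *: "\<not> occurs_inf \<omega> (\<omega> n)"
    have "\<omega> n \<in> {0, 1, 2}" using assms unfolding Oracles_def by blast
    then have "n \<in> ?B" using * by blast
    then show False using M that by (meson not_le)
  qed
  then show thesis by (rule that)
qed

definition inf_symbols :: "oracle_seq \<Rightarrow> nat set" where
  "inf_symbols \<omega> = {s. occurs_inf \<omega> s}"

lemma inf_symbols_subset_image: "inf_symbols \<omega> \<subseteq> \<omega> ` {N..}"
proof
  fix s assume "s \<in> inf_symbols \<omega>"
  then obtain n where "n \<ge> N" "\<omega> n = s" by (auto simp: inf_symbols_def occurs_inf_iff)
  then show "s \<in> \<omega> ` {N..}" by auto
qed

lemma inf_symbols_subset: "\<omega> \<in> Oracles \<Longrightarrow> inf_symbols \<omega> \<subseteq> {0, 1, 2}"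
  by (rule order_trans[OF inf_symbols_subset_image[of _ 0]])
    (simp add: Oracles_def image_subset_iff del: insert_iff)

lemma inf_symbols_eq:
  assumes "\<omega> \<in> Oracles"
  shows "{s \<in> {0, 1, 2}. occurs_inf \<omega> s} = inf_symbols \<omega>"
  using inf_symbols_subset[OF assms] unfolding inf_symbols_def by blast

lemma inf_symbols_nonempty: "\<omega> \<in> Oracles \<Longrightarrow> inf_symbols \<omega> \<noteq> {}"
  using eventual_symbols[of \<omega>] unfolding inf_symbols_def by blast

lemma Oracles0_iff: "\<omega> \<in> Oracles0 \<longleftrightarrow> \<omega> \<in> Oracles \<and> inf_symbols \<omega> = {0, 1, 2}"
  using inf_symbols_subset[of \<omega>] unfolding Oracles0_def inf_symbols_def by blast

lemma Oracles1_iff: "\<omega> \<in> Oracles1 \<longleftrightarrow> \<omega> \<in> Oracles \<and> card (inf_symbols \<omega>) = 2"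
  using inf_symbols_eq[of \<omega>] by (auto simp: Oracles1_def)

lemma inf_symbols_eventually_const:
  assumes "\<And>n. n \<ge> M \<Longrightarrow> \<omega> n = s"
  shows "inf_symbols \<omega> = {s}"
proof -
  have "inf_symbols \<omega> \<subseteq> \<omega> ` {M..}" by (rule inf_symbols_subset_image)
  moreover have "s \<in> inf_symbols \<omega>"
    unfolding inf_symbols_def occurs_inf_iff mem_Collect_eq
  proof
    show "\<exists>n\<ge>m. \<omega> n = s" for m
      by (rule exI[of _ "max m M"]) (simp add: assms)
  qed
  ultimately show ?thesis using assms by auto
qed

lemma Oracles2_iff: "\<omega> \<in> Oracles2 \<longleftrightarrow> \<omega> \<in> Oracles \<and> (\<exists>s. inf_symbols \<omega> = {s})"
proof
  assume "\<omega> \<in> Oracles2"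
  then show "\<omega> \<in> Oracles \<and> (\<exists>s. inf_symbols \<omega> = {s})"
    using inf_symbols_eventually_const
    unfolding Oracles2_def eventually_sequentially by blast
next
  assume *: "\<omega> \<in> Oracles \<and> (\<exists>s. inf_symbols \<omega> = {s})"
  then obtain s where s: "inf_symbols \<omega> = {s}" by blast
  obtain M where "\<And>n. n \<ge> M \<Longrightarrow> occurs_inf \<omega> (\<omega> n)"
    using eventual_symbols * by blast
  then have "\<forall>n\<ge>M. \<omega> n = s" using s unfolding inf_symbols_def by blast
  then show "\<omega> \<in> Oracles2"
    using * unfolding Oracles2_def eventually_sequentially by blast
qed

lemma Oracles_Un: "Oracles = Oracles0 \<union> Oracles1 \<union> Oracles2"
proof
  show "Oracles \<subseteq> Oracles0 \<union> Oracles1 \<union> Oracles2"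
  proof
    fix \<omega> assume \<omega>: "\<omega> \<in> Oracles"
    have fin: "finite (inf_symbols \<omega>)"
      using inf_symbols_subset[OF \<omega>] by (rule finite_subset) simp
    have "card (inf_symbols \<omega>) \<le> 3"
      using card_mono[OF _ inf_symbols_subset[OF \<omega>]] by simp
    moreover have "card (inf_symbols \<omega>) > 0"
      using fin inf_symbols_nonempty[OF \<omega>] by (simp add: card_gt_0_iff)
    ultimately consider "card (inf_symbols \<omega>) = 1" | "card (inf_symbols \<omega>) = 2" | "card (inf_symbols \<omega>) = 3"
      by linarith
    then show "\<omega> \<in> Oracles0 \<union> Oracles1 \<union> Oracles2"
    proof cases
      case 1
      then show ?thesis using \<omega> by (auto simp: Oracles2_iff card_1_singleton_iff)
    next
      case 3
      then have "inf_symbols \<omega> = {0, 1, 2}"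
        using inf_symbols_subset[OF \<omega>] by (intro card_subset_eq) auto
      then show ?thesis using \<omega> by (simp add: Oracles0_iff)
    qed (use \<omega> in \<open>simp add: Oracles1_iff\<close>)
  qed
qed (auto simp: Oracles0_def Oracles1_def Oracles2_def)

lemma tail_symbols_inf_symbols:
  assumes "S \<subseteq> inf_symbols \<omega>"
  shows "tail_symbols \<omega> (F \<union> S) N = tail_symbols \<omega> F N"
  using assms inf_symbols_subset_image[of \<omega> N] by (auto simp: tail_symbols_def)

lemma germ_point_inf_symbols:
  assumes "F - F' \<subseteq> inf_symbols \<omega>" "F' - F \<subseteq> inf_symbols \<omega>"
  shows "germ_point \<omega> F = germ_point \<omega> F'"
proof (rule germ_point_cong)
  fix N
  have "tail_symbols \<omega> F N = tail_symbols \<omega> (F \<union> (F' - F)) N"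
    by (rule tail_symbols_inf_symbols[OF assms(2), symmetric])
  also have "F \<union> (F' - F) = F' \<union> (F - F')" by auto
  also have "tail_symbols \<omega> \<dots> N = tail_symbols \<omega> F' N"
    by (rule tail_symbols_inf_symbols[OF assms(1)])
  finally show "tail_symbols \<omega> F N = tail_symbols \<omega> F' N" .
qed

lemma eventual_tail_symbols:
  assumes "\<omega> \<in> Oracles"
  obtains M where "tail_symbols \<omega> F M = F \<union> inf_symbols \<omega>"
proof -
  obtain M where "\<And>n. n \<ge> M \<Longrightarrow> occurs_inf \<omega> (\<omega> n)"
    using eventual_symbols[OF assms] by blast
  then have "\<omega> ` {M..} \<subseteq> inf_symbols \<omega>" by (auto simp: inf_symbols_def)
  then show thesis
    using that[of M] inf_symbols_subset_image[of \<omega> M] by (auto simp: tail_symbols_def)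
qed

lemma nondegenerate_iff:
  assumes "\<omega> \<in> Oracles" "F \<subseteq> {0, 1, 2}"
  shows "nondegenerate \<omega> F \<longleftrightarrow> (\<forall>s. F \<union> inf_symbols \<omega> \<noteq> {s})"
proof
  assume nd: "nondegenerate \<omega> F"
  obtain M where M: "tail_symbols \<omega> F M = F \<union> inf_symbols \<omega>"
    using eventual_tail_symbols[OF assms(1)] by blast
  show "\<forall>s. F \<union> inf_symbols \<omega> \<noteq> {s}"
  proof
    fix s
    obtain t where "t \<in> tail_symbols \<omega> F M" "t \<noteq> s"
      using nd unfolding nondegenerate_def by blast
    then show "F \<union> inf_symbols \<omega> \<noteq> {s}" unfolding M by blast
  qed
next
  assume *: "\<forall>s. F \<union> inf_symbols \<omega> \<noteq> {s}"
  have "\<exists>t\<in>tail_symbols \<omega> F N. t \<noteq> s" for N s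
  proof -
    have "\<not> F \<union> inf_symbols \<omega> \<subseteq> {s}"
      using * inf_symbols_nonempty[OF assms(1)] unfolding subset_singleton_iff by simp
    then obtain t where "t \<in> F \<union> inf_symbols \<omega>" "t \<noteq> s" by blast
    then show ?thesis using inf_symbols_subset_image[of \<omega> N] by (auto simp: tail_symbols_def)
  qed
  then show "nondegenerate \<omega> F" using assms by (simp add: nondegenerate_def)
qed

text \<open>If only \<open>s\<close> remains, then \<open>F\<close> is contained in
  \<open>{s}\<close> and \<open>s\<close> recurs in the oracle itself, so that \<open>F\<close> may
  be replaced by the empty set.\<close>

lemma degenerate:
  assumes "\<omega> \<in> Oracles" "F \<subseteq> {0, 1, 2}" "\<not> nondegenerate \<omega> F"
  obtains s M where "\<And>n. n \<ge> M \<Longrightarrow> \<omega> n = s" "\<omega> \<in> Oracles2"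
    "tail_symbols \<omega> F M = {s}" "germ_point \<omega> F = germ_point \<omega> {}"
proof -
  obtain s where s: "F \<union> inf_symbols \<omega> = {s}" using assms nondegenerate_iff by blast
  then have "inf_symbols \<omega> \<subseteq> {s}" by blast
  then have inf: "inf_symbols \<omega> = {s}"
    using inf_symbols_nonempty[OF assms(1)] by (simp add: subset_singleton_iff)
  obtain M where M: "tail_symbols \<omega> F M = {s}"
    using eventual_tail_symbols[OF assms(1)] s by metis
  show thesis
  proof (rule that[OF _ _ M])
    show "\<omega> n = s" if "n \<ge> M" for n
      using M that by (auto simp: tail_symbols_def)
    show "\<omega> \<in> Oracles2" using assms(1) inf by (simp add: Oracles2_iff)
    show "germ_point \<omega> F = germ_point \<omega> {}"
      by (rule germ_point_inf_symbols) (use s inf in auto)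
  qed
qed

subsection \<open>Limit points\<close>

definition nondegenerate_points :: "letter marked set" where
  "nondegenerate_points = {germ_point \<omega> F | \<omega> F. nondegenerate \<omega> F}"

definition all_points :: "letter marked set" where
  "all_points = {germ_point \<omega> F | \<omega> F. \<omega> \<in> Oracles \<and> F \<subseteq> {0, 1, 2}}"

lemma XX_eq: "XX = (\<lambda>\<omega>. germ_point \<omega> {}) ` Oracles"
  by (simp add: XX_def overgroup_points_eq)

lemma XX1_eq: "XX1 = (\<lambda>\<omega>. germ_point \<omega> {}) ` Oracles1"
  unfolding XX1_def by (rule overgroup_points_eq) (auto simp: Oracles1_def)

lemma XX2_eq: "XX2 = (\<lambda>\<omega>. germ_point \<omega> {}) ` Oracles2"
  unfolding XX2_def by (rule overgroup_points_eq) (auto simp: Oracles2_def)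

lemma XX0_eq: "XX0 = (\<lambda>\<omega>. germ_point \<omega> {0, 1, 2}) ` Oracles0"
proof -
  have "XX0 = (\<lambda>\<omega>. germ_point \<omega> {}) ` Oracles0"
    unfolding XX0_def by (rule overgroup_points_eq) (auto simp: Oracles0_def)
  also have "\<dots> = (\<lambda>\<omega>. germ_point \<omega> {0, 1, 2}) ` Oracles0"
    by (intro image_cong refl germ_point_inf_symbols) (auto simp: Oracles0_iff)
  finally show ?thesis .
qed

lemma XX1_alpha_eq: "XX1_alpha = (\<lambda>\<omega>. germ_point \<omega> {0, 1, 2}) ` Oracles1"
  unfolding XX1_alpha_def by (rule alpha_points_eq) (auto simp: Oracles1_def)

lemma XX2_alpha_eq: "XX2_alpha = (\<lambda>\<omega>. germ_point \<omega> {0, 1, 2}) ` Oracles2"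
  unfolding XX2_alpha_def by (rule alpha_points_eq) (auto simp: Oracles2_def)

lemma YY_eq: "YY = (\<lambda>\<omega>. germ_point \<omega> {0, 1, 2}) ` Oracles"
  by (simp only: YY_def XX0_eq XX1_alpha_eq XX2_alpha_eq Oracles_Un image_Un)

lemma XX2_beta_eq: "XX2_beta = {germ_point \<omega> {i, j} | \<omega> i j k.
    \<omega> \<in> Oracles2 \<and> {i, j, k} = {0, 1, 2} \<and> finite {n. \<omega> n = k}}"
  unfolding XX2_beta_def by (rule beta_points_eq) (auto simp: Oracles2_def)

lemma XX_subset_all_points: "XX \<subseteq> all_points"
  unfolding XX_eq all_points_def by blast

lemma all_points_split: "all_points \<subseteq> XX2 \<union> nondegenerate_points"
proof
  fix p assume "p \<in> all_points"
  then obtain \<omega> F where p: "p = germ_point \<omega> F" "\<omega> \<in> Oracles" "F \<subseteq> {0, 1, 2}"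
    unfolding all_points_def by blast
  show "p \<in> XX2 \<union> nondegenerate_points"
  proof (cases "nondegenerate \<omega> F")
    case False
    then show ?thesis using degenerate[OF p(2,3)] p(1) unfolding XX2_eq by (metis UnI1 image_eqI)
  qed (use p in \<open>auto simp: nondegenerate_points_def\<close>)
qed

text \<open>A nondegenerate point determines its tails, also against a degenerate competitor; but
  the latter has a tail with a single symbol.\<close>

lemma XX2_disjoint_nondegenerate: "XX2 \<inter> nondegenerate_points = {}"
proof (rule ccontr)
  assume "\<not> ?thesis"
  then obtain \<omega>' \<omega> F where \<omega>: "\<omega>' \<in> Oracles2" "nondegenerate \<omega> F" "germ_point \<omega> F = germ_point \<omega>' {}"
    unfolding XX2_eq nondegenerate_points_def by auto metis
  then have \<omega>': "\<omega>' \<in> Oracles" by (simp add: Oracles2_def)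
  obtain s where s: "inf_symbols \<omega>' = {s}" using \<omega>(1) by (auto simp: Oracles2_iff)
  obtain M where M: "tail_symbols \<omega>' {} M = {s}"
    using eventual_tail_symbols[OF \<omega>', of "{}"] s by auto
  have "tail_symbols \<omega> F M = {s}"
    using germ_point_inject(2)[OF \<omega>(3,2) \<omega>'] M by simp
  then show False using \<omega>(2) unfolding nondegenerate_def by blast
qed

section \<open>Compactness and location of the limit points\<close>

lemma points_convergent_subsequence:
  assumes "\<And>n::nat. f n = germ_point (w n) (S n)" "\<And>n. w n \<in> Oracles" "\<And>n. S n \<subseteq> {0, 1, 2}"
  obtains r \<omega> F where "strict_mono (r :: nat \<Rightarrow> nat)" "\<omega> \<in> Oracles" "F \<subseteq> {0, 1, 2}"
    "(f \<circ> r) \<longlonglongrightarrow> germ_point \<omega> F"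
    "\<forall>N. \<forall>\<^sub>F k in sequentially. (\<forall>n<N. w (r k) n = \<omega> n) \<and>
       tail_symbols (w (r k)) (S (r k)) N = tail_symbols \<omega> F N"
proof -
  obtain r \<omega> F where r: "strict_mono (r :: nat \<Rightarrow> nat)" "\<omega> \<in> Oracles" "F \<subseteq> {0, 1, 2}"
    "\<forall>N. \<forall>\<^sub>F k in sequentially. (\<forall>n<N. w (r k) n = \<omega> n) \<and>
       tail_symbols (w (r k)) (S (r k)) N = tail_symbols \<omega> F N"
    by (rule oracle_convergent_subsequence[of w S, OF assms(2,3)]) (rule that)
  have "(f \<circ> r) = (\<lambda>k. germ_point (w (r k)) (S (r k)))" using assms(1) by auto
  then have "(f \<circ> r) \<longlonglongrightarrow> germ_point \<omega> F" using germ_point_tendsto[OF r(4)] by simp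
  then show thesis by (rule that[OF r(1-3) _ r(4)])
qed

lemma compact_all_points: "compact all_points"
  unfolding compact_eq_seq_compact_metric seq_compact_def
proof (intro allI impI)
  fix f :: "nat \<Rightarrow> letter marked" assume "\<forall>n. f n \<in> all_points"
  then have "\<forall>n. \<exists>\<omega> F. f n = germ_point \<omega> F \<and> \<omega> \<in> Oracles \<and> F \<subseteq> {0, 1, 2}"
    unfolding all_points_def by blast
  then obtain w S where w: "\<And>n. f n = germ_point (w n) (S n)" "\<And>n. w n \<in> Oracles" "\<And>n. S n \<subseteq> {0, 1, 2}"
    by metis
  obtain r \<omega> F where "strict_mono (r :: nat \<Rightarrow> nat)" "\<omega> \<in> Oracles" "F \<subseteq> {0, 1, 2}"
    "(f \<circ> r) \<longlonglongrightarrow> germ_point \<omega> F"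
    "\<forall>N. \<forall>\<^sub>F k in sequentially. (\<forall>n<N. w (r k) n = \<omega> n) \<and>
       tail_symbols (w (r k)) (S (r k)) N = tail_symbols \<omega> F N"
    by (rule points_convergent_subsequence[of f w S, OF w]) (rule that)
  then show "\<exists>l\<in>all_points. \<exists>r. strict_mono r \<and> (f \<circ> r) \<longlonglongrightarrow> l"
    unfolding all_points_def by blast
qed

lemma compact_YY: "compact YY"
  unfolding compact_eq_seq_compact_metric seq_compact_def
proof (intro allI impI)
  fix f :: "nat \<Rightarrow> letter marked" assume "\<forall>n. f n \<in> YY"
  then have "\<forall>n. \<exists>\<omega>. f n = germ_point \<omega> {0, 1, 2} \<and> \<omega> \<in> Oracles"
    unfolding YY_eq by blast
  then obtain w where w: "\<And>n. f n = germ_point (w n) {0, 1, 2}" "\<And>n. w n \<in> Oracles"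
    by metis
  obtain r \<omega> F where r: "strict_mono (r :: nat \<Rightarrow> nat)" "\<omega> \<in> Oracles" "F \<subseteq> {0, 1, 2}"
    "(f \<circ> r) \<longlonglongrightarrow> germ_point \<omega> F"
    "\<forall>N. \<forall>\<^sub>F k in sequentially. (\<forall>n<N. w (r k) n = \<omega> n) \<and>
       tail_symbols (w (r k)) {0, 1, 2} N = tail_symbols \<omega> F N"
    by (rule points_convergent_subsequence[of f w "\<lambda>_. {0, 1, 2}", OF w order_refl]) (rule that)
  \<comment> \<open>The limit may come with another \<open>F\<close>, but all tails in the sequence
    are full, and so are those of the limit.\<close>
  have "tail_symbols \<omega> F N = tail_symbols \<omega> {0, 1, 2} N" for N
  proof -
    have "\<forall>\<^sub>F k in sequentially. tail_symbols \<omega> F N = {0, 1, 2}"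
      using spec[OF r(5), of N] by eventually_elim (use tail_symbols_full[OF w(2)] in auto)
    then show ?thesis using tail_symbols_full[OF r(2)] by simp
  qed
  then have "germ_point \<omega> F = germ_point \<omega> {0, 1, 2}" by (rule germ_point_cong)
  then have "germ_point \<omega> F \<in> YY" using r(2) by (simp add: YY_eq)
  then show "\<exists>l\<in>YY. \<exists>r. strict_mono r \<and> (f \<circ> r) \<longlonglongrightarrow> l"
    using r(1,4) by blast
qed

text \<open>Suppose that the limit is degenerate, with tail \<open>{s}\<close> from \<open>M\<close>
  on. Terms with the same first \<open>M\<close> symbols and the same tail set must continue with
  \<open>s\<close> forever, so they equal the limit, which the sequence avoids.\<close>

lemma limit_points_subset_nondegenerate:
  assumes "V \<subseteq> all_points"
  shows "limit_points V \<subseteq> nondegenerate_points"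
proof
  fix p assume "p \<in> limit_points V"
  then obtain f where f: "\<And>n. f n \<in> V - {p}" "f \<longlonglongrightarrow> p"
    unfolding limit_points_def islimpt_sequential by blast
  have "\<forall>n. \<exists>\<omega> F. f n = germ_point \<omega> F \<and> \<omega> \<in> Oracles \<and> F \<subseteq> {0, 1, 2}"
    using f(1) assms unfolding all_points_def by blast
  then obtain w S where w: "\<And>n. f n = germ_point (w n) (S n)" "\<And>n. w n \<in> Oracles" "\<And>n. S n \<subseteq> {0, 1, 2}"
    by metis
  obtain r \<omega> F where r: "strict_mono (r :: nat \<Rightarrow> nat)" "\<omega> \<in> Oracles" "F \<subseteq> {0, 1, 2}"
    "(f \<circ> r) \<longlonglongrightarrow> germ_point \<omega> F"
    "\<forall>N. \<forall>\<^sub>F k in sequentially. (\<forall>n<N. w (r k) n = \<omega> n) \<and>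
       tail_symbols (w (r k)) (S (r k)) N = tail_symbols \<omega> F N"
    by (rule points_convergent_subsequence[of f w S, OF w]) (rule that)
  have p: "p = germ_point \<omega> F"
    using LIMSEQ_unique[OF LIMSEQ_subseq_LIMSEQ[OF f(2) r(1)] r(4)] .
  have "nondegenerate \<omega> F"
  proof (rule ccontr)
    assume "\<not> nondegenerate \<omega> F"
    then obtain s M where s: "\<And>n. n \<ge> M \<Longrightarrow> \<omega> n = s" "tail_symbols \<omega> F M = {s}"
      "germ_point \<omega> F = germ_point \<omega> {}"
      using degenerate[OF r(2,3)] by metis
    have "\<exists>k. (\<forall>n<M. w (r k) n = \<omega> n) \<and> tail_symbols (w (r k)) (S (r k)) M = {s}"
      using eventually_happens'[OF sequentially_bot spec[OF r(5), of M]] s(2) by simp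
    then obtain k where k: "\<And>n. n < M \<Longrightarrow> w (r k) n = \<omega> n" "tail_symbols (w (r k)) (S (r k)) M = {s}"
      by blast
    have "w (r k) n = \<omega> n" for n
    proof (cases "n < M")
      case False
      then have "w (r k) n = s" using k(2) by (auto simp: tail_symbols_def)
      then show ?thesis using s(1) False by simp
    qed (rule k(1))
    then have eq: "w (r k) = \<omega>" by auto
    have "germ_point (w (r k)) (S (r k)) = germ_point \<omega> {}"
      unfolding eq
    proof (rule germ_point_inf_symbols)
      have "S (r k) \<subseteq> {s}" using k(2) by (auto simp: tail_symbols_def)
      then show "S (r k) - {} \<subseteq> inf_symbols \<omega>"
        using inf_symbols_eventually_const[OF s(1)] by auto
    qed simp
    then have "f (r k) = p" using w(1) s(3) p by simp
    then show False using f(1)[of "r k"] by blast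
  qed
  then show "p \<in> nondegenerate_points" using p unfolding nondegenerate_points_def by blast
qed

text \<open>The oracle is changed at the place \<open>N\<close>, then all symbols of its tail are listed, and
  finally it is continued by \<open>g\<close>.\<close>

lemma perturbed_oracle:
  assumes nd: "nondegenerate \<omega> F" and g: "\<And>n. g n \<in> tail_symbols \<omega> F N"
  obtains \<omega>' M where "\<omega>' \<in> Oracles" "\<And>n. n < N \<Longrightarrow> \<omega>' n = \<omega> n" "\<omega>' \<noteq> \<omega>"
    "\<omega>' ` {N..} = tail_symbols \<omega> F N" "\<And>n. n \<ge> M \<Longrightarrow> \<omega>' n = g n"
proof -
  let ?T = "tail_symbols \<omega> F N"
  have \<omega>: "\<omega> \<in> Oracles" "F \<subseteq> {0, 1, 2}" using nd by (simp_all add: nondegenerate_def)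
  note T = tail_symbols_subset[OF \<omega>, of N]
  obtain t where t: "t \<in> ?T" "t \<noteq> \<omega> N" using nd unfolding nondegenerate_def by blast
  have "finite ?T" using T by (rule finite_subset) simp
  then obtain e :: "nat \<Rightarrow> nat" and m where e: "e ` {i. i < m} = ?T"
    using finite_imp_nat_seg_image_inj_on by metis
  define \<omega>' where "\<omega>' n = (if n < N then \<omega> n else if n = N then t
    else if n - Suc N < m then e (n - Suc N) else g n)" for n
  have tail: "\<omega>' n \<in> ?T" if "n \<ge> N" for n
    using that t(1) g[of n] e by (auto simp: \<omega>'_def)
  have "?T \<subseteq> \<omega>' ` {N..}"
  proof
    fix s assume "s \<in> ?T"
    then obtain i where i: "i < m" "s = e i" using e by blast
    then have "\<omega>' (Suc N + i) = s" by (simp add: \<omega>'_def)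
    then show "s \<in> \<omega>' ` {N..}" by (intro image_eqI[of _ _ "Suc N + i"]) simp_all
  qed
  then have image: "\<omega>' ` {N..} = ?T" using tail by auto
  show thesis
  proof (rule that[OF _ _ _ image])
    have "\<omega>' n \<in> {0, 1, 2}" for n
    proof (cases "n < N")
      case True
      then show ?thesis using \<omega>(1) unfolding Oracles_def \<omega>'_def by auto
    next
      case False
      then show ?thesis using tail[of n] T by (meson not_le subsetD)
    qed
    then show "\<omega>' \<in> Oracles" unfolding Oracles_def by blast
    have "\<omega>' N \<noteq> \<omega> N" using t(2) by (simp add: \<omega>'_def)
    then show "\<omega>' \<noteq> \<omega>" by auto
    show "\<omega>' n = g n" if "n \<ge> Suc N + m" for n using that by (auto simp: \<omega>'_def)
  qed (simp add: \<omega>'_def)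
qed

text \<open>The oracle is changed at a far place while the set of symbols in its tail is kept, so
  the new point is close; it is different because a nondegenerate point determines its oracle. The
  choice of \<open>g\<close> and \<open>F'\<close> makes the new point land in
  \<open>V\<close>.\<close>

lemma nondegenerate_point_limit:
  assumes nd: "nondegenerate \<omega> F"
    and ex: "\<And>N. \<exists>g F'. (\<forall>n. g n \<in> tail_symbols \<omega> F N) \<and> F' \<subseteq> tail_symbols \<omega> F N \<and>
       (\<forall>\<omega>' M. \<omega>' \<in> Oracles \<longrightarrow> (\<forall>n\<ge>M. \<omega>' n = g n) \<longrightarrow> germ_point \<omega>' F' \<in> V)"
  shows "germ_point \<omega> F \<in> limit_points V"
  unfolding limit_points_def mem_Collect_eq islimpt_approachable
proof (intro allI impI)
  fix e :: real assume "e > 0"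
  then obtain m where m: "(1/2) ^ m < e" using real_arch_pow_inv[of e "1/2"] by auto
  have pow: "2 * Suc m \<le> 2 ^ (m + 2)" using less_exp[of "Suc m"] by simp
  have \<omega>: "\<omega> \<in> Oracles" "F \<subseteq> {0, 1, 2}" using nd by (simp_all add: nondegenerate_def)
  let ?T = "tail_symbols \<omega> F (m + 2)"
  obtain g F' where g: "\<And>n. g n \<in> ?T" "F' \<subseteq> ?T"
    "\<And>\<omega>' M. \<omega>' \<in> Oracles \<Longrightarrow> \<forall>n\<ge>M. \<omega>' n = g n \<Longrightarrow> germ_point \<omega>' F' \<in> V"
    using ex[of "m + 2"] by blast
  obtain \<omega>' M where \<omega>': "\<omega>' \<in> Oracles" "\<And>n. n < m + 2 \<Longrightarrow> \<omega>' n = \<omega> n" "\<omega>' \<noteq> \<omega>"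
    "\<omega>' ` {m + 2..} = ?T" "\<And>n. n \<ge> M \<Longrightarrow> \<omega>' n = g n"
    using perturbed_oracle[OF nd, of g "m + 2"] g(1) by metis
  have "germ_point \<omega>' F' \<in> V" using g(3) \<omega>' by blast
  moreover have "tail_symbols \<omega>' F' (m + 2) = ?T"
    unfolding tail_symbols_def[of \<omega>'] \<omega>'(4) using g(2) by blast
  then have "same_ball_at (germ_point \<omega>' F') (germ_point \<omega> F) (Suc m)"
    by (intro germ_point_same_ball[OF _ _ pow]) (use \<omega>'(2) in auto)
  then have "dist (germ_point \<omega>' F') (germ_point \<omega> F) < e"
    using m dist_marked_less_iff[of "germ_point \<omega>' F'" "germ_point \<omega> F" m] by linarith
  moreover have "germ_point \<omega>' F' \<noteq> germ_point \<omega> F"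
  proof
    assume eq: "germ_point \<omega>' F' = germ_point \<omega> F"
    have "F' \<subseteq> {0, 1, 2}" using g(2) tail_symbols_subset[OF \<omega>] by blast
    then show False using germ_point_inject(1)[OF eq[symmetric] nd \<omega>'(1)] \<omega>'(3) by simp
  qed
  ultimately show "\<exists>x'\<in>V. x' \<noteq> germ_point \<omega> F \<and> dist x' (germ_point \<omega> F) < e" by blast
qed

section \<open>Continuations that lead into the given families\<close>

lemma inf_symbols_eventually_eq:
  "\<forall>n\<ge>M. \<omega> n = g n \<Longrightarrow> inf_symbols \<omega> = inf_symbols g"
  using occurs_inf_cong[of M \<omega> g] by (simp add: inf_symbols_def)

lemma inf_symbols_const: "inf_symbols (\<lambda>n. s) = {s}"
  by (rule inf_symbols_eventually_const) simp

lemma inf_symbols_alternating: "inf_symbols (\<lambda>n. if even n then i else j) = {i, j}"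
proof
  show "inf_symbols (\<lambda>n. if even n then i else j) \<subseteq> {i, j}"
    using inf_symbols_subset_image[of _ 0] by fastforce
  have "\<exists>n\<ge>m. even n" "\<exists>n\<ge>m. odd n" for m :: nat
    by (metis dvd_triv_left le_add2 mult_2, metis even_Suc le_SucI le_add2 mult_2 dvd_triv_left)
  then show "{i, j} \<subseteq> inf_symbols (\<lambda>n. if even n then i else j)"
    by (auto simp: inf_symbols_def occurs_inf_iff)
qed

lemma inf_symbols_mod_3: "inf_symbols (\<lambda>n. n mod 3) = {0, 1, 2}"
proof
  have "(\<lambda>n. n mod 3) ` {0..} \<subseteq> {0, 1, 2 :: nat}" by auto
  then show "inf_symbols (\<lambda>n. n mod 3) \<subseteq> {0, 1, 2}"
    by (rule order_trans[OF inf_symbols_subset_image])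
  have "\<exists>n\<ge>m. n mod 3 = s" if "s < 3" for m s :: nat
    using that by (intro exI[of _ "3 * m + s"]) auto
  then show "{0, 1, 2} \<subseteq> inf_symbols (\<lambda>n. n mod 3)"
    by (auto simp: inf_symbols_def occurs_inf_iff)
qed

text \<open>Every tail has two distinct symbols \<open>i\<close> and \<open>j\<close>. A constant
  continuation leads to \<open>XX2\<close>, an alternating one to \<open>XX1\<close>, and the
  constant one with \<open>{i, j}\<close> at infinity to \<open>XX2_beta\<close>; the third symbol
  occurs only finitely often in the last case.\<close>

lemma nondegenerate_subset_limit_points:
  "nondegenerate_points \<subseteq> limit_points XX1"
  "nondegenerate_points \<subseteq> limit_points XX2"
  "nondegenerate_points \<subseteq> limit_points XX2_beta"
proof -
  have "germ_point \<omega> F \<in> limit_points XX1 \<and> germ_point \<omega> F \<in> limit_points XX2 \<and>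
      germ_point \<omega> F \<in> limit_points XX2_beta" if nd: "nondegenerate \<omega> F" for \<omega> F
  proof (intro conjI nondegenerate_point_limit[OF nd])
    fix N
    obtain i where i: "i \<in> tail_symbols \<omega> F N" using nd unfolding nondegenerate_def by blast
    obtain j where j: "j \<in> tail_symbols \<omega> F N" "j \<noteq> i" using nd unfolding nondegenerate_def by blast
    have ij: "i \<in> {0, 1, 2}" "j \<in> {0, 1, 2}"
      using i j nd tail_symbols_subset unfolding nondegenerate_def by blast+
    have two: "germ_point \<omega>' {} \<in> XX2" "\<omega>' \<in> Oracles2"
      if "\<omega>' \<in> Oracles" "\<forall>n\<ge>M. \<omega>' n = i" for \<omega>' M
      using that inf_symbols_eventually_const[of M \<omega>' i] by (auto simp: XX2_eq Oracles2_iff)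
    show "\<exists>g F'. (\<forall>n. g n \<in> tail_symbols \<omega> F N) \<and> F' \<subseteq> tail_symbols \<omega> F N \<and>
       (\<forall>\<omega>' M. \<omega>' \<in> Oracles \<longrightarrow> (\<forall>n\<ge>M. \<omega>' n = g n) \<longrightarrow> germ_point \<omega>' F' \<in> XX2)"
      using i two(1) by (intro exI[of _ "\<lambda>n. i"] exI[of _ "{}"]) auto
    have "germ_point \<omega>' {} \<in> XX1"
      if "\<omega>' \<in> Oracles" "\<forall>n\<ge>M. \<omega>' n = (if even n then i else j)" for \<omega>' M
      using that(1) inf_symbols_eventually_eq[OF that(2)] inf_symbols_alternating[of i j] j(2)
      by (simp add: XX1_eq Oracles1_iff)
    then show "\<exists>g F'. (\<forall>n. g n \<in> tail_symbols \<omega> F N) \<and> F' \<subseteq> tail_symbols \<omega> F N \<and>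
       (\<forall>\<omega>' M. \<omega>' \<in> Oracles \<longrightarrow> (\<forall>n\<ge>M. \<omega>' n = g n) \<longrightarrow> germ_point \<omega>' F' \<in> XX1)"
      using i j(1) by (intro exI[of _ "\<lambda>n. if even n then i else j"] exI[of _ "{}"]) auto
    have "germ_point \<omega>' {i, j} \<in> XX2_beta"
      if \<omega>': "\<omega>' \<in> Oracles" "\<forall>n\<ge>M. \<omega>' n = i" for \<omega>' M
    proof -
      obtain k where k: "{i, j, k} = {0, 1, 2}" "k \<noteq> i"
      proof -
        have "i \<noteq> j" using j(2) by simp
        \<comment> \<open>The three symbols add up to 3.\<close>
        then have "{i, j, 3 - (i + j)} = {0, 1, 2} \<and> 3 - (i + j) \<noteq> i"
          using ij by auto
        then show thesis using that by blast
      qed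
      have "k \<notin> inf_symbols \<omega>'"
        using inf_symbols_eventually_const[of M \<omega>' i] \<omega>'(2) k(2) by auto
      then have "finite {n. \<omega>' n = k}" by (simp add: inf_symbols_def occurs_inf_def)
      then show ?thesis using two(2)[OF \<omega>'] k(1) unfolding XX2_beta_eq by blast
    qed
    then show "\<exists>g F'. (\<forall>n. g n \<in> tail_symbols \<omega> F N) \<and> F' \<subseteq> tail_symbols \<omega> F N \<and>
       (\<forall>\<omega>' M. \<omega>' \<in> Oracles \<longrightarrow> (\<forall>n\<ge>M. \<omega>' n = g n) \<longrightarrow> germ_point \<omega>' F' \<in> XX2_beta)"
      using i j(1) by (intro exI[of _ "\<lambda>n. i"] exI[of _ "{i, j}"]) auto
  qed
  then show "nondegenerate_points \<subseteq> limit_points XX1"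
    "nondegenerate_points \<subseteq> limit_points XX2" "nondegenerate_points \<subseteq> limit_points XX2_beta"
    unfolding nondegenerate_points_def by blast+
qed

lemma nondegenerate_full: "\<omega> \<in> Oracles \<Longrightarrow> nondegenerate \<omega> {0, 1, 2}"
  unfolding nondegenerate_def tail_symbols_full by (metis insertI1 insertI2 order_refl zero_neq_one)

lemma YY_subset_limit_points:
  "YY \<subseteq> limit_points XX0" "YY \<subseteq> limit_points XX1_alpha" "YY \<subseteq> limit_points XX2_alpha"
proof -
  have lim: "YY \<subseteq> limit_points ((\<lambda>\<omega>. germ_point \<omega> {0, 1, 2}) ` A)"
    if g: "\<And>n. g n \<in> {0, 1, 2}"
      and A: "\<And>\<omega> M. \<omega> \<in> Oracles \<Longrightarrow> \<forall>n\<ge>M. \<omega> n = g n \<Longrightarrow> \<omega> \<in> A" for A g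
  proof -
    have "germ_point \<omega> {0, 1, 2} \<in> limit_points ((\<lambda>\<omega>. germ_point \<omega> {0, 1, 2}) ` A)"
      if "\<omega> \<in> Oracles" for \<omega>
    proof (rule nondegenerate_point_limit[OF nondegenerate_full[OF that]])
      show "\<exists>g F'. (\<forall>n. g n \<in> tail_symbols \<omega> {0, 1, 2} N) \<and> F' \<subseteq> tail_symbols \<omega> {0, 1, 2} N \<and>
          (\<forall>\<omega>' M. \<omega>' \<in> Oracles \<longrightarrow> (\<forall>n\<ge>M. \<omega>' n = g n) \<longrightarrow>
            germ_point \<omega>' F' \<in> (\<lambda>\<omega>. germ_point \<omega> {0, 1, 2}) ` A)" for N
        unfolding tail_symbols_full[OF that]
        by (intro exI[of _ g] exI[of _ "{0, 1, 2}"] conjI allI impI g order_refl imageI) (rule A)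
    qed
    then show ?thesis unfolding YY_eq by blast
  qed
  show "YY \<subseteq> limit_points XX0"
    unfolding XX0_eq
  proof (rule lim[of "\<lambda>n. n mod 3"])
    show "n mod 3 \<in> {0, 1, 2}" for n :: nat by auto
    show "\<omega> \<in> Oracles0" if "\<omega> \<in> Oracles" "\<forall>n\<ge>M. \<omega> n = n mod 3" for \<omega> M
      using that(1) inf_symbols_eventually_eq[OF that(2)] inf_symbols_mod_3 by (simp add: Oracles0_iff)
  qed
  show "YY \<subseteq> limit_points XX1_alpha"
    unfolding XX1_alpha_eq
  proof (rule lim[of "\<lambda>n. if even n then 0 else 1"])
    show "\<omega> \<in> Oracles1" if "\<omega> \<in> Oracles" "\<forall>n\<ge>M. \<omega> n = (if even n then 0 else 1)" for \<omega> M
      using that(1) inf_symbols_eventually_eq[OF that(2)] inf_symbols_alternating[of 0 1]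
      by (simp add: Oracles1_iff)
  qed auto
  show "YY \<subseteq> limit_points XX2_alpha"
    unfolding XX2_alpha_eq
  proof (rule lim[of "\<lambda>n. 0"])
    show "\<omega> \<in> Oracles2" if "\<omega> \<in> Oracles" "\<forall>n\<ge>M. \<omega> n = 0" for \<omega> M
      using that(1) inf_symbols_eventually_eq[OF that(2)] inf_symbols_const[of 0]
      by (auto simp: Oracles2_iff)
  qed auto
qed

lemma limit_points_mono: "V \<subseteq> W \<Longrightarrow> limit_points V \<subseteq> limit_points W"
  unfolding limit_points_def using islimpt_subset by blast

lemma limit_points_subset_YY: "V \<subseteq> YY \<Longrightarrow> limit_points V \<subseteq> YY"
proof -
  assume "V \<subseteq> YY"
  then have "limit_points V \<subseteq> limit_points YY" by (rule limit_points_mono)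
  also have "\<dots> \<subseteq> YY"
    using compact_imp_closed[OF compact_YY] by (auto simp: limit_points_def closed_limpt)
  finally show ?thesis .
qed

text \<open>What matters is which symbols remain forever, in \<open>F\<close> or by recurring in the
  oracle. Three of them give \<open>YY\<close>; two give \<open>XX1\<close> if both recur, and
  otherwise \<open>XX2_beta\<close>, the oracle being eventually constant.\<close>

lemma nondegenerate_points_eq: "nondegenerate_points = YY \<union> XX1 \<union> XX2_beta"
proof
  show "YY \<union> XX1 \<union> XX2_beta \<subseteq> nondegenerate_points"
  proof (intro Un_least subsetI)
    fix p assume "p \<in> YY"
    then show "p \<in> nondegenerate_points"
      unfolding YY_eq nondegenerate_points_def using nondegenerate_full by blast
  next
    fix p assume "p \<in> XX1"
    then obtain \<omega> where \<omega>: "p = germ_point \<omega> {}" "\<omega> \<in> Oracles" "card (inf_symbols \<omega>) = 2"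
      by (auto simp: XX1_eq Oracles1_iff)
    then have "nondegenerate \<omega> {}"
      by (auto simp: nondegenerate_iff)
    then show "p \<in> nondegenerate_points" using \<omega>(1) unfolding nondegenerate_points_def by blast
  next
    fix p assume "p \<in> XX2_beta"
    then obtain \<omega> i j k where p: "p = germ_point \<omega> {i, j}" "\<omega> \<in> Oracles2" "{i, j, k} = {0, 1, 2}"
      unfolding XX2_beta_eq by blast
    have "card {i, j, k} = 3" unfolding p(3) by simp
    then have "i \<noteq> j" by (auto simp: card_insert_if split: if_splits)
    moreover have "{i, j} \<subseteq> {0, 1, 2}" unfolding p(3)[symmetric] by blast
    ultimately have "nondegenerate \<omega> {i, j}"
      using p(2) by (subst nondegenerate_iff) (auto simp: Oracles2_def)
    then show "p \<in> nondegenerate_points" using p(1) unfolding nondegenerate_points_def by blast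
  qed
  show "nondegenerate_points \<subseteq> YY \<union> XX1 \<union> XX2_beta"
  proof
    fix p assume "p \<in> nondegenerate_points"
    then obtain \<omega> F where p: "p = germ_point \<omega> F" and nd: "nondegenerate \<omega> F"
      unfolding nondegenerate_points_def by blast
    then have \<omega>: "\<omega> \<in> Oracles" "F \<subseteq> {0, 1, 2}" by (simp_all add: nondegenerate_def)
    let ?T = "F \<union> inf_symbols \<omega>"
    have T: "?T \<subseteq> {0, 1, 2}" using \<omega> inf_symbols_subset by blast
    have p': "p = germ_point \<omega> ?T" unfolding p by (rule germ_point_inf_symbols) auto
    show "p \<in> YY \<union> XX1 \<union> XX2_beta"
    proof (cases "?T = {0, 1, 2}")
      case True
      then show ?thesis using p' \<omega>(1) unfolding YY_eq by auto
    next
      case False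
      then obtain k where k: "k \<in> {0, 1, 2}" "k \<notin> ?T" using T by blast
      obtain i where i: "i \<in> inf_symbols \<omega>" using inf_symbols_nonempty[OF \<omega>(1)] by blast
      obtain j where j: "j \<in> ?T" "j \<noteq> i" using nd i nondegenerate_iff[OF \<omega>] by blast
      have "i \<in> {0, 1, 2}" "j \<in> {0, 1, 2}" "k \<noteq> i" "k \<noteq> j" using T i j k by blast+
      then have ijk: "{i, j, k} = {0, 1, 2}" using j(2) k(1) by auto
      then have T': "?T = {i, j}" using T k(2) i j(1) by blast
      show ?thesis
      proof (cases "j \<in> inf_symbols \<omega>")
        case True
        then have inf: "inf_symbols \<omega> = {i, j}" using T' i by blast
        then have "\<omega> \<in> Oracles1" using \<omega>(1) j(2) by (simp add: Oracles1_iff)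
        moreover have "p = germ_point \<omega> {}"
          unfolding p using T' inf by (intro germ_point_inf_symbols) auto
        ultimately show ?thesis unfolding XX1_eq by blast
      next
        case False
        then have "inf_symbols \<omega> = {i}" using T' i by blast
        then have "\<omega> \<in> Oracles2" using \<omega>(1) by (simp add: Oracles2_iff)
        moreover have "finite {n. \<omega> n = k}"
          using k(2) by (simp add: inf_symbols_def occurs_inf_def)
        ultimately show ?thesis using p' ijk unfolding T' XX2_beta_eq by blast
      qed
    qed
  qed
qed

theorem theorem2:
  shows "(closure XX = limit_points XX \<union> XX2 \<and> limit_points XX \<inter> XX2 = {} \<and>
      XX2 = {p. p isolated_in XX}) \<and>
    (limit_points XX homeomorphic cantor_set \<and> YY homeomorphic cantor_set) \<and>
    (YY = limit_points XX0 \<and> YY = limit_points XX1_alpha \<and> YY = limit_points XX2_alpha) \<and>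
    (limit_points XX = YY \<union> XX1 \<union> XX2_beta \<and> limit_points XX = limit_points XX1 \<and>
      limit_points XX = limit_points XX2_beta \<and> limit_points XX = limit_points XX2)"
proof -
  note sub = nondegenerate_subset_limit_points
  have "XX1 \<subseteq> XX" "XX2 \<subseteq> XX"
    unfolding XX_eq XX1_eq XX2_eq by (auto simp: Oracles1_def Oracles2_def)
  have nd_all: "nondegenerate_points \<subseteq> all_points"
    unfolding nondegenerate_points_def all_points_def nondegenerate_def by blast
  then have "XX2_beta \<subseteq> all_points" using nondegenerate_points_eq by blast
  then have beta: "limit_points XX2_beta = nondegenerate_points"
    using limit_points_subset_nondegenerate sub(3) by blast
  have XX: "limit_points XX = nondegenerate_points" "limit_points XX1 = nondegenerate_points"
    "limit_points XX2 = nondegenerate_points"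
    using limit_points_subset_nondegenerate[OF XX_subset_all_points] sub
      limit_points_mono[OF \<open>XX1 \<subseteq> XX\<close>] limit_points_mono[OF \<open>XX2 \<subseteq> XX\<close>] by blast+
  have split: "XX \<subseteq> nondegenerate_points \<union> XX2"
    using XX_subset_all_points all_points_split by blast
  have "closure XX = limit_points XX \<union> XX"
    by (auto simp: closure_def limit_points_def)
  then have clos: "closure XX = limit_points XX \<union> XX2"
    using split \<open>XX2 \<subseteq> XX\<close> XX(1) by blast
  have disj: "limit_points XX \<inter> XX2 = {}"
    using XX2_disjoint_nondegenerate XX(1) by blast
  have "{p. p isolated_in XX} = XX - limit_points XX"
    by (auto simp: isolated_in_islimpt_iff limit_points_def)
  then have isol: "XX2 = {p. p isolated_in XX}"
    using split disj \<open>XX2 \<subseteq> XX\<close> XX(1) by blast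
  have "XX0 \<subseteq> YY" "XX1_alpha \<subseteq> YY" "XX2_alpha \<subseteq> YY" by (auto simp: YY_def)
  then have YY: "YY = limit_points XX0" "YY = limit_points XX1_alpha" "YY = limit_points XX2_alpha"
    using limit_points_subset_YY YY_subset_limit_points by blast+
  have ne: "YY \<noteq> {}"
    unfolding YY_eq Oracles_def by (auto intro: exI[of _ "\<lambda>_. 0"])
  have "YY homeomorphic cantor_set"
  proof (rule perfect_compact_marked_homeomorphic_cantor_set[OF compact_YY ne])
    fix p assume "p \<in> YY"
    \<comment> \<open>\<open>YY\<close> is the set of limit points of its own subset
      \<open>XX0\<close>, so it has no isolated points.\<close>
    then show "p islimpt YY"
      using YY(1) limit_points_mono[OF \<open>XX0 \<subseteq> YY\<close>] by (auto simp: limit_points_def)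
  qed
  moreover have "limit_points XX homeomorphic cantor_set"
  proof (rule perfect_compact_marked_homeomorphic_cantor_set)
    have "limit_points XX \<subseteq> all_points" using XX(1) nd_all by simp
    moreover have "closed (limit_points XX)"
      unfolding limit_points_def by (rule closed_limpts)
    ultimately show "compact (limit_points XX)"
      using compact_Int_closed[OF compact_all_points] by (metis inf.absorb2)
    show "limit_points XX \<noteq> {}" using ne unfolding XX(1) nondegenerate_points_eq by blast
    \<comment> \<open>Here too the set contains a family, namely \<open>XX1\<close>, of which it is
      the set of limit points.\<close>
    have "XX1 \<subseteq> limit_points XX" unfolding XX(1) nondegenerate_points_eq by blast
    then show "p islimpt limit_points XX" if "p \<in> limit_points XX" for p
      using that XX limit_points_mono[of XX1 "limit_points XX"] by (auto simp: limit_points_def)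
  qed
  ultimately show ?thesis
    using clos disj isol YY XX beta nondegenerate_points_eq by simp
qed

end
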